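(* Let $X$ be the McLaughlin graph or the graph $\mathrm{O}^-(6,3)$, and let $N$ be its number of vertices. Then $P^X_{4,+}$ contains the flip, that is, the element $$\sum_{0\le x,y<N}\delta_x\otimes\delta_y\otimes\delta_x\otimes\delta_y .$$
   Context: For a finite simple graph $X$ with vertex set $\{0,\dots,N-1\}$ and adjacency matrix $A$, $\mathcal{O}(\mathrm{Aut}^+(X))$ is the universal unital $*$-algebra generated by projections $u_{ij}$ ($0\le i,j<N$) such that projections in the same row or the same column of $u=(u_{ij})$ are orthogonal, every row and column of $u$ sums to $1$, and $Au=uA$. Let $Q$ be the algebra of complex functions on $\{0,\dots,N-1\}$ with basis $(\delta_x)_x$, on which $\mathrm{Aut}^+(X)$ acts through $u$. Then $P^X_{k,+}=\mathrm{Hom}_{\mathrm{Aut}^+(X)}(\mathbb{C},Q^{\otimes k})\subset Q^{\otimes k}$: concretely, $T=\sum T_{x_0,\dots,x_{k-1}}\delta_{x_0}\otimes\cdots\otimes\delta_{x_{k-1}}$ belongs to $P^X_{k,+}$ iff $\sum_{y_0,\dots,y_{k-1}}T_{y_0,\dots,y_{k-1}}\,u_{x_0y_0}\cdots u_{x_{k-1}y_{k-1}}=T_{x_0,\dots,x_{k-1}}1$ for all $x_0,\dots,x_{k-1}$. (Containing the flip is equivalent to $\mathcal{O}(\mathrm{Aut}^+(X))$ being commutative, i.e. $X$ having no quantum symmetry.) The McLaughlin graph is the unique strongly regular graph with parameters $(275,112,30,56)$. The graph $\mathrm{O}^-(6,3)$: take an anisotropic quadratic form $Q_e$ on $\mathbb{F}_3^2$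 (e.g. $v_0^2+v_1^2$) and $Q(v)=v_0v_1+v_2v_3+Q_e(v_4,v_5)$ on $\mathbb{F}_3^6$; the vertices are the points $\langle v\rangle$ of $\mathbb{P}^5(\mathbb{F}_3)$ with $Q(v)=0$, and two distinct vertices $\langle v\rangle,\langle w\rangle$ are adjacent iff $Q(v+w)=0$. *)

theory Defs
  imports "HOL-Analysis.Finite_Cartesian_Product" "HOL-Library.Numeral_Type"
    "HOL-Library.Poly_Mapping"
begin

section \<open>Graphs\<close>

definition simple_graph :: "'v set \<Rightarrow> ('v \<Rightarrow> 'v \<Rightarrow> bool) \<Rightarrow> bool" where
  "simple_graph V E \<longleftrightarrow> finite V \<and> (\<forall>x y. E x y \<longrightarrow> x \<in> V \<and> y \<in> V) \<and> symp E \<and> irreflp E"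

definition strongly_regular ::
    "'v set \<Rightarrow> ('v \<Rightarrow> 'v \<Rightarrow> bool) \<Rightarrow> nat \<Rightarrow> nat \<Rightarrow> nat \<Rightarrow> nat \<Rightarrow> bool" where
  "strongly_regular V E n k l m \<longleftrightarrow>
     simple_graph V E \<and> card V = n \<and>
     (\<forall>x\<in>V. card {z\<in>V. E x z} = k) \<and>
     (\<forall>x\<in>V. \<forall>y\<in>V. E x y \<longrightarrow> card {z\<in>V. E x z \<and> E y z} = l) \<and>
     (\<forall>x\<in>V. \<forall>y\<in>V. x \<noteq> y \<and> \<not> E x y \<longrightarrow> card {z\<in>V. E x z \<and> E y z} = m)"

definition graph_isomorphic ::
    "'v set \<Rightarrow> ('v \<Rightarrow> 'v \<Rightarrow> bool) \<Rightarrow> 'w set \<Rightarrow> ('w \<Rightarrow> 'w \<Rightarrow> bool) \<Rightarrow> bool" where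
  "graph_isomorphic V E W F \<longleftrightarrow>
     (\<exists>f. bij_betw f V W \<and> (\<forall>x\<in>V. \<forall>y\<in>V. E x y \<longleftrightarrow> F (f x) (f y)))"

text \<open>The McLaughlin graph is determined up to isomorphism by its parameters.\<close>

definition is_McLaughlin_graph :: "'v set \<Rightarrow> ('v \<Rightarrow> 'v \<Rightarrow> bool) \<Rightarrow> bool" where
  "is_McLaughlin_graph V E \<longleftrightarrow> strongly_regular V E 275 112 30 56"


section \<open>The graph O-minus(6,3)\<close>

text \<open>The numeral type \<open>3\<close> is the ring of integers modulo 3, i.e. the field with three elements;
  the coordinates of a vector of type \<open>3^6\<close> are indexed by \<open>0, \<dots>, 5\<close>.\<close>

definition Q_minus :: "3^6 \<Rightarrow> 3" where
  "Q_minus v = v$0 * v$1 + v$2 * v$3 + ((v$4)^2 + (v$5)^2)"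

definition proj_point :: "3^6 \<Rightarrow> (3^6) set" where
  "proj_point v = range (\<lambda>c. c *s v)"

definition O_minus_6_3_verts :: "(3^6) set set" where
  "O_minus_6_3_verts = {proj_point v |v. v \<noteq> 0 \<and> Q_minus v = 0}"

definition O_minus_6_3_adj :: "(3^6) set \<Rightarrow> (3^6) set \<Rightarrow> bool" where
  "O_minus_6_3_adj p q \<longleftrightarrow>
     p \<in> O_minus_6_3_verts \<and> q \<in> O_minus_6_3_verts \<and> p \<noteq> q \<and>
     (\<exists>v w. p = proj_point v \<and> q = proj_point w \<and> Q_minus (v + w) = 0)"

definition is_O_minus_6_3_graph :: "'v set \<Rightarrow> ('v \<Rightarrow> 'v \<Rightarrow> bool) \<Rightarrow> bool" where
  "is_O_minus_6_3_graph V E \<longleftrightarrow>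
     simple_graph V E \<and> graph_isomorphic V E O_minus_6_3_verts O_minus_6_3_adj"

lemma F3_cases: "c = 0 \<or> c = 1 \<or> c = - 1" for c :: 3
proof (cases c rule: bit1_cases)
  case (of_int z)
  then have "z = 0 \<or> z = 1 \<or> z = 2"
    by auto
  moreover have "(2::3) = - 1"
    by simp
  ultimately show ?thesis
    using of_int by auto
qed

lemma hyperbolic_form_identity:
  fixes a b :: "'a::comm_ring_1"
  shows "((a*p0 + b*q0) * (a*p1 + b*q1) + (a*p2 + b*q2) * (a*p3 + b*q3)
      + ((a*p4 + b*q4)^2 + (a*p5 + b*q5)^2))
    - a * b * ((p0 + q0) * (p1 + q1) + (p2 + q2) * (p3 + q3) + ((p4 + q4)^2 + (p5 + q5)^2))
    = (a^2 - a * b) * (p0 * p1 + p2 * p3 + (p4^2 + p5^2))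
      + (b^2 - a * b) * (q0 * q1 + q2 * q3 + (q4^2 + q5^2))"
  by (simp add: power2_eq_square algebra_simps)

lemma Q_minus_add_smult:
  assumes "Q_minus v = 0" "Q_minus w = 0"
  shows "Q_minus (a *s v + b *s w) = a * b * Q_minus (v + w)"
proof -
  have "Q_minus (a *s v + b *s w) - a * b * Q_minus (v + w)
      = (a^2 - a * b) * Q_minus v + (b^2 - a * b) * Q_minus w"
    unfolding Q_minus_def vector_add_component vector_smult_component
    by (rule hyperbolic_form_identity)
  with assms show ?thesis
    by simp
qed

lemma proj_point_eqD:
  assumes "proj_point v = proj_point v'" "v \<noteq> 0"
  shows "\<exists>c. (c = 1 \<or> c = - 1) \<and> v' = c *s v"
proof -
  have "1 *s v' \<in> proj_point v" "1 *s v \<in> proj_point v'"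
    using assms(1) unfolding proj_point_def by blast+
  then have "v' \<in> proj_point v" "v \<in> proj_point v'"
    by simp_all
  then obtain c d where c: "v' = c *s v" and d: "v = d *s v'"
    unfolding proj_point_def by blast
  have "c \<noteq> 0"
  proof
    assume "c = 0"
    with c have "v' = 0"
      by simp
    with d have "v = 0"
      by simp
    with assms(2) show False
      by contradiction
  qed
  then show ?thesis
    using F3_cases[of c] c by blast
qed

text \<open>Adjacency does not depend on the chosen representatives.\<close>

lemma O_minus_6_3_adj_iff:
  assumes v: "v \<noteq> 0" "Q_minus v = 0" and w: "w \<noteq> 0" "Q_minus w = 0"
    and ne: "proj_point v \<noteq> proj_point w"
  shows "O_minus_6_3_adj (proj_point v) (proj_point w) \<longleftrightarrow> Q_minus (v + w) = 0"
proof
  assume "O_minus_6_3_adj (proj_point v) (proj_point w)"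
  then obtain v' w' where eq: "proj_point v = proj_point v'" "proj_point w = proj_point w'"
    and Q: "Q_minus (v' + w') = 0"
    by (auto simp: O_minus_6_3_adj_def)
  obtain c d where c: "c = 1 \<or> c = - 1" "v' = c *s v" and d: "d = 1 \<or> d = - 1" "w' = d *s w"
    using proj_point_eqD[OF eq(1) v(1)] proj_point_eqD[OF eq(2) w(1)] by blast
  then show "Q_minus (v + w) = 0"
    using Q Q_minus_add_smult[OF v(2) w(2), of c d] by auto
next
  assume "Q_minus (v + w) = 0"
  then show "O_minus_6_3_adj (proj_point v) (proj_point w)"
    using assms unfolding O_minus_6_3_adj_def O_minus_6_3_verts_def by blast
qed


section \<open>The free unital *-algebra\<close>

text \<open>It is the monoid algebra over the complex numbers of the free monoid on the symbols
  \<open>u\<^sub>i\<^sub>j\<close> and \<open>u\<^sub>i\<^sub>j\<^sup>*\<close>. The monoid is written additively because multiplication of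
  \<^type>\<open>poly_mapping\<close> is the convolution product with respect to addition of the exponents.\<close>

datatype gen = Gen nat nat | Gen_star nat nat

datatype gen_word = Word (letters: "gen list")

instantiation gen_word :: monoid_add
begin

definition zero_gen_word :: gen_word where
  "0 = Word []"

definition plus_gen_word :: "gen_word \<Rightarrow> gen_word \<Rightarrow> gen_word" where
  "v + w = Word (letters v @ letters w)"

instance
  by standard (simp_all add: zero_gen_word_def plus_gen_word_def)

end

type_synonym free_alg = "gen_word \<Rightarrow>\<^sub>0 complex"

definition scal :: "complex \<Rightarrow> free_alg" where
  "scal c = Poly_Mapping.single 0 c"

definition u :: "nat \<Rightarrow> nat \<Rightarrow> free_alg" where
  "u i j = Poly_Mapping.single (Word [Gen i j]) 1"

fun gen_adj :: "gen \<Rightarrow> gen" where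
  "gen_adj (Gen i j) = Gen_star i j"
| "gen_adj (Gen_star i j) = Gen i j"

definition word_adj :: "gen_word \<Rightarrow> gen_word" where
  "word_adj w = Word (rev (map gen_adj (letters w)))"

definition star :: "free_alg \<Rightarrow> free_alg" where
  "star a = (\<Sum>w\<in>Poly_Mapping.keys a.
     Poly_Mapping.single (word_adj w) (cnj (Poly_Mapping.lookup a w)))"


section \<open>The algebra of the quantum automorphism group\<close>

definition adj_mat :: "(nat \<Rightarrow> nat \<Rightarrow> bool) \<Rightarrow> nat \<Rightarrow> nat \<Rightarrow> complex" where
  "adj_mat E i j = (if E i j then 1 else 0)"

text \<open>The relations \<open>a = b\<close> are recorded as elements \<open>a - b\<close>. The free algebra has a generator for
  every pair of natural numbers; the first rule kills those which are not entries of the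
  \<open>N \<times> N\<close> matrix, so that only the generators \<open>u i j\<close> with \<open>i, j < N\<close> remain.\<close>

inductive_set aut_relators :: "nat \<Rightarrow> (nat \<Rightarrow> nat \<Rightarrow> bool) \<Rightarrow> free_alg set"
  for N :: nat and E :: "nat \<Rightarrow> nat \<Rightarrow> bool" where
  outside: "\<not> (i < N \<and> j < N) \<Longrightarrow> u i j \<in> aut_relators N E"
| selfadjoint: "star (u i j) - u i j \<in> aut_relators N E"
| idempotent: "u i j * u i j - u i j \<in> aut_relators N E"
| row_orthogonal: "j \<noteq> k \<Longrightarrow> u i j * u i k \<in> aut_relators N E"
| column_orthogonal: "i \<noteq> k \<Longrightarrow> u i j * u k j \<in> aut_relators N E"
| row_sum: "i < N \<Longrightarrow> (\<Sum>j<N. u i j) - 1 \<in> aut_relators N E"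
| column_sum: "j < N \<Longrightarrow> (\<Sum>i<N. u i j) - 1 \<in> aut_relators N E"
| commutes_adj_mat: "i < N \<Longrightarrow> j < N \<Longrightarrow>
    (\<Sum>k<N. scal (adj_mat E i k) * u k j) - (\<Sum>k<N. u i k * scal (adj_mat E k j))
      \<in> aut_relators N E"

text \<open>The two-sided *-ideal generated by the relators.\<close>

inductive_set aut_ideal :: "nat \<Rightarrow> (nat \<Rightarrow> nat \<Rightarrow> bool) \<Rightarrow> free_alg set"
  for N :: nat and E :: "nat \<Rightarrow> nat \<Rightarrow> bool" where
  zero: "0 \<in> aut_ideal N E"
| relator: "a \<in> aut_relators N E \<Longrightarrow> a \<in> aut_ideal N E"
| add: "a \<in> aut_ideal N E \<Longrightarrow> b \<in> aut_ideal N E \<Longrightarrow> a + b \<in> aut_ideal N E"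
| mult_left: "a \<in> aut_ideal N E \<Longrightarrow> x * a \<in> aut_ideal N E"
| mult_right: "a \<in> aut_ideal N E \<Longrightarrow> a * x \<in> aut_ideal N E"
| star: "a \<in> aut_ideal N E \<Longrightarrow> star a \<in> aut_ideal N E"

text \<open>The universal unital *-algebra generated by the entries of \<open>u\<close> subject to the relations is
  the quotient of the free one by \<^const>\<open>aut_ideal\<close>; \<open>aut_eq N E a b\<close> says that \<open>a\<close> and \<open>b\<close>
  represent the same element of it.\<close>

definition aut_eq :: "nat \<Rightarrow> (nat \<Rightarrow> nat \<Rightarrow> bool) \<Rightarrow> free_alg \<Rightarrow> free_alg \<Rightarrow> bool" where
  "aut_eq N E a b \<longleftrightarrow> a - b \<in> aut_ideal N E"


section \<open>The spaces of invariant tensors\<close>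

text \<open>The element \<open>T\<close> of the \<open>k\<close>-th tensor power of \<open>Q\<close> is represented by its coefficients with
  respect to the basis \<open>\<delta>\<^sub>x\<^sub>0 \<otimes> \<dots> \<otimes> \<delta>\<^sub>x\<^sub>k\<^sub>-\<^sub>1\<close>, indexed by the lists \<open>[x\<^sub>0, \<dots>, x\<^sub>k\<^sub>-\<^sub>1]\<close>.\<close>

definition indices :: "nat \<Rightarrow> nat \<Rightarrow> nat list set" where
  "indices N k = {xs. length xs = k \<and> set xs \<subseteq> {..<N}}"

definition tensor_power :: "nat \<Rightarrow> nat \<Rightarrow> (nat list \<Rightarrow>\<^sub>0 complex) set" where
  "tensor_power N k = {T. Poly_Mapping.keys T \<subseteq> indices N k}"

definition delta :: "nat list \<Rightarrow> (nat list \<Rightarrow>\<^sub>0 complex)" where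
  "delta xs = Poly_Mapping.single xs 1"

definition P_plus :: "nat \<Rightarrow> (nat \<Rightarrow> nat \<Rightarrow> bool) \<Rightarrow> nat \<Rightarrow> (nat list \<Rightarrow>\<^sub>0 complex) set" where
  "P_plus N E k = {T \<in> tensor_power N k. \<forall>xs\<in>indices N k.
     aut_eq N E
       (\<Sum>ys\<in>indices N k. scal (Poly_Mapping.lookup T ys) * prod_list (map2 u xs ys))
       (scal (Poly_Mapping.lookup T xs))}"

definition flip_tensor :: "nat \<Rightarrow> (nat list \<Rightarrow>\<^sub>0 complex)" where
  "flip_tensor N = (\<Sum>x<N. \<Sum>y<N. delta [x, y, x, y])"

end

theory Submission
  imports Defs
begin

text \<open>The flip is invariant as soon as the entries of \<open>u\<close> commute. They are studied through the
  4-tensors invariant under \<open>u\<close>, which are closed under linear combinations, rotation, composition,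
  and multiplication by functions of cyclically neighbouring indices.

  For the McLaughlin graph, let \<open>P\<close> be the projection onto the 22-dimensional eigenspace. Its rows form a
  spherical 4-design, so \<open>\<Sum>\<^sub>z P a z P b z P c z P d z\<close> is a multiple of
  \<open>P a b P c d + P a d P b c + P a c P b d\<close>. All terms but the last are visibly invariant, hence so is the
  crossing \<open>P a c P b d\<close>, and this makes the entries commute.

  The graph \<open>O\<^sup>-(6,3)\<close> is the collinearity graph of a generalized quadrangle with parameters (3,9). For
  \<open>a, b, c, d\<close> with edges \<open>bc\<close> and \<open>da\<close> and nonadjacent pairs \<open>ab\<close> and \<open>cd\<close>, whether the lines
  through \<open>bc\<close> and \<open>da\<close> meet is an invariant tensor; its threefold composition with itself, restricted to suitable
  masks, counts 153 if the lines meet, and otherwise 8 or 0 according to whether exactly one of the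
  diagonals \<open>ac\<close>, \<open>bd\<close> is an edge. Since each diagonal separately gives an invariant tensor, so does the
  condition that both are edges. Composing this crossing tensor with the one of 4-cycles without
  diagonals yields the flip on edges, so entries for adjacent rows commute. For nonadjacent rows the
  commutation follows by expanding over the 10 common neighbours.\<close>

section \<open>Magic unitaries\<close>

text \<open>The obstacle is planarity. A function of \<open>a\<close>, \<open>c\<close> alone and
  one of \<open>b\<close>, \<open>d\<close> alone are both invariant, because the remaining entries
  of \<open>U\<close> sum to 1. Their product is another matter: the two pairs interleave, and
  exchanging them is the very commutation to be proved. Each graph therefore has to supply an
  identity of its own in which such a product is the only term that planar operations do not already
  produce. For the McLaughlin graph this is the fourth moment of a spherical design. The diagonal
  value of \<open>P\<close> is not taken elsewhere, so a quadratic polynomial recovers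
  \<open>U x a\<close> from the sums of entries weighted by \<open>P\<close>. For the quadrangle,
  the threefold slide sees the two diagonals only through their exclusive or; written with
  indicators \<open>f\<close> and \<open>g\<close> this is \<open>f + g - 2 * f * g\<close>, which
  contains the wanted product. The counts come from splitting off hyperbolic planes, and the passage
  to nonadjacent rows works because the relevant three points have at most 4 common neighbours,
  whereas two nonadjacent points have 10.\<close>

lemma sum_scale_nested:
  fixes F :: "'b \<Rightarrow> 'a::real_algebra_1"
  shows "(\<Sum>c\<in>A. F c * (\<Sum>d\<in>B. (r * k c d) *\<^sub>R G d)) = r *\<^sub>R (\<Sum>c\<in>A. F c * (\<Sum>d\<in>B. k c d *\<^sub>R G d))"
  by (simp only: scaleR_scaleR[symmetric] scaleR_right.sum[symmetric] mult_scaleR_right)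

lemma sum_swap4:
  "(\<Sum>a\<in>A. \<Sum>b\<in>B. \<Sum>c\<in>C. \<Sum>d\<in>D. f a b c d) = (\<Sum>c\<in>C. \<Sum>d\<in>D. \<Sum>a\<in>A. \<Sum>b\<in>B. f a b c d)"
proof -
  have "(\<Sum>a\<in>A. \<Sum>b\<in>B. \<Sum>c\<in>C. \<Sum>d\<in>D. f a b c d) = (\<Sum>a\<in>A. \<Sum>c\<in>C. \<Sum>d\<in>D. \<Sum>b\<in>B. f a b c d)"
    by (intro sum.cong refl, subst sum.swap, intro sum.cong refl, rule sum.swap)
  also have "\<dots> = (\<Sum>c\<in>C. \<Sum>d\<in>D. \<Sum>a\<in>A. \<Sum>b\<in>B. f a b c d)"
    by (subst sum.swap, intro sum.cong refl, rule sum.swap)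
  finally show ?thesis .
qed

lemma sum_swap3:
  "(\<Sum>a\<in>A. \<Sum>b\<in>B. \<Sum>c\<in>C. f a b c) = (\<Sum>c\<in>C. \<Sum>a\<in>A. \<Sum>b\<in>B. f a b c)"
proof -
  have "(\<Sum>a\<in>A. \<Sum>b\<in>B. \<Sum>c\<in>C. f a b c) = (\<Sum>a\<in>A. \<Sum>c\<in>C. \<Sum>b\<in>B. f a b c)"
    by (intro sum.cong refl) (rule sum.swap)
  then show ?thesis by (simp only: sum.swap[of _ A C])
qed

lemma sum_nested_assoc:
  fixes F :: "'b \<Rightarrow> 'a::semiring_0"
  shows "(\<Sum>b\<in>A. F b * (\<Sum>d\<in>B. P b d * G d)) = (\<Sum>d\<in>B. (\<Sum>b\<in>A. F b * P b d) * G d)"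
  unfolding sum_distrib_left sum_distrib_right mult.assoc by (rule sum.swap)

lemma sum_nested_scale:
  fixes F :: "'b \<Rightarrow> 'a::real_algebra_1"
  shows "(\<Sum>b\<in>A. F b * (\<Sum>d\<in>B. k b d *\<^sub>R G d)) = (\<Sum>d\<in>B. (\<Sum>b\<in>A. k b d *\<^sub>R F b) * G d)"
  using sum_nested_assoc[of F "\<lambda>b d. k b d *\<^sub>R 1" G B A] by simp

text \<open>The relations are stated over any real algebra and any finite vertex set, so that the
  results apply both to the entries indexed by numbers and to their relabelling by points of the
  quadric. Real scalars suffice because the tensors below are real-valued.\<close>

locale magic_unitary =
  fixes V :: "'v set" and E :: "'v \<Rightarrow> 'v \<Rightarrow> bool" and U :: "'v \<Rightarrow> 'v \<Rightarrow> 'a::real_algebra_1"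
  assumes finite_V: "finite V"
    and idem: "x \<in> V \<Longrightarrow> a \<in> V \<Longrightarrow> U x a * U x a = U x a"
    and row_orth: "x \<in> V \<Longrightarrow> a \<in> V \<Longrightarrow> b \<in> V \<Longrightarrow> a \<noteq> b \<Longrightarrow> U x a * U x b = 0"
    and col_orth: "x \<in> V \<Longrightarrow> y \<in> V \<Longrightarrow> a \<in> V \<Longrightarrow> x \<noteq> y \<Longrightarrow> U x a * U y a = 0"
    and row_sum: "x \<in> V \<Longrightarrow> (\<Sum>a\<in>V. U x a) = 1"
    and col_sum: "a \<in> V \<Longrightarrow> (\<Sum>x\<in>V. U x a) = 1"
    and commutes_adj: "x \<in> V \<Longrightarrow> a \<in> V \<Longrightarrow>
      (\<Sum>k\<in>V. of_bool (E x k) *\<^sub>R U k a) = (\<Sum>k\<in>V. of_bool (E k a) *\<^sub>R U x k)"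
begin

lemma row_mult: "x \<in> V \<Longrightarrow> a \<in> V \<Longrightarrow> b \<in> V \<Longrightarrow> U x a * U x b = (if a = b then U x a else 0)"
  using idem row_orth by auto

lemma col_mult: "x \<in> V \<Longrightarrow> y \<in> V \<Longrightarrow> a \<in> V \<Longrightarrow> U x a * U y a = (if x = y then U x a else 0)"
  using idem col_orth by auto

lemma row_pick:
  assumes "x \<in> V" "a \<in> V"
  shows "U x a * (\<Sum>b\<in>V. U x b * F b) = U x a * F a"
proof -
  have "U x a * (\<Sum>b\<in>V. U x b * F b) = (\<Sum>b\<in>V. (U x a * U x b) * F b)"
    by (simp add: sum_distrib_left mult.assoc)
  also have "\<dots> = (\<Sum>b\<in>V. if b = a then U x a * F a else 0)"
    using assms by (intro sum.cong) (auto simp: row_mult)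
  also have "\<dots> = U x a * F a"
    using assms finite_V by simp
  finally show ?thesis .
qed

text \<open>Multiplying the commutation with the adjacency matrix by \<open>U x a\<close> on the
  left and \<open>U y b\<close> on the right leaves one matrix entry on each side,
  \<open>E x y\<close> by column orthogonality and \<open>E a b\<close> by row
  orthogonality.\<close>

lemma edge_orth:
  assumes "x \<in> V" "y \<in> V" "a \<in> V" "b \<in> V" "E x y \<noteq> E a b"
  shows "U x a * U y b = 0"
proof -
  have "U x a * (\<Sum>k\<in>V. of_bool (E x k) *\<^sub>R U k b) * U y b = of_bool (E x y) *\<^sub>R (U x a * U y b)"
  proof -
    have "(\<Sum>k\<in>V. of_bool (E x k) *\<^sub>R U k b) * U y b = (\<Sum>k\<in>V. if k = y then of_bool (E x y) *\<^sub>R U y b else 0)"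
      unfolding sum_distrib_right using assms by (intro sum.cong) (auto simp: col_mult)
    also have "\<dots> = of_bool (E x y) *\<^sub>R U y b"
      using assms finite_V by simp
    finally show ?thesis by (simp add: mult.assoc)
  qed
  moreover have "U x a * (\<Sum>k\<in>V. of_bool (E k b) *\<^sub>R U x k) = of_bool (E a b) *\<^sub>R U x a"
  proof -
    have "U x a * (\<Sum>k\<in>V. of_bool (E k b) *\<^sub>R U x k) = (\<Sum>k\<in>V. if k = a then of_bool (E a b) *\<^sub>R U x a else 0)"
      unfolding sum_distrib_left using assms by (intro sum.cong) (auto simp: row_mult)
    also have "\<dots> = of_bool (E a b) *\<^sub>R U x a"
      using assms finite_V by simp
    finally show ?thesis .
  qed
  ultimately have "of_bool (E x y) *\<^sub>R (U x a * U y b) = of_bool (E a b) *\<^sub>R (U x a * U y b)"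
    using commutes_adj[OF assms(1,4)] by (metis mult_scaleR_left)
  then show ?thesis using assms(5) by (cases "E x y"; cases "E a b") auto
qed

section \<open>Invariant functions of two indices and invariant 4-tensors\<close>

definition inv2 :: "('v \<Rightarrow> 'v \<Rightarrow> real) \<Rightarrow> bool" where
  "inv2 f \<longleftrightarrow> (\<forall>x\<in>V. \<forall>y\<in>V. \<forall>a\<in>V. \<forall>b\<in>V. f a b *\<^sub>R (U x a * U y b) = f x y *\<^sub>R (U x a * U y b))"

lemma inv2D: "inv2 f \<Longrightarrow> x \<in> V \<Longrightarrow> y \<in> V \<Longrightarrow> a \<in> V \<Longrightarrow> b \<in> V \<Longrightarrow>
    f a b *\<^sub>R (U x a * U y b) = f x y *\<^sub>R (U x a * U y b)"
  by (simp add: inv2_def)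

text \<open>\<open>inv2 f\<close> says that \<open>f\<close> agrees on \<open>x y\<close> and
  \<open>a b\<close> whenever \<open>U x a * U y b\<close> is nonzero. The product is nonzero only
  if both pairs are in the same one of the three relations equality, adjacency and
  nonadjacency.\<close>

lemma inv2_relation:
  "inv2 (\<lambda>a b. h (a = b) (E a b))"
  unfolding inv2_def
proof (intro ballI)
  fix x y a b assume *: "x \<in> V" "y \<in> V" "a \<in> V" "b \<in> V"
  show "h (a = b) (E a b) *\<^sub>R (U x a * U y b) = h (x = y) (E x y) *\<^sub>R (U x a * U y b)"
  proof (cases "(x = y) = (a = b) \<and> E x y = E a b")
    case False
    then have "U x a * U y b = 0"
      using * edge_orth[of x y a b] by (auto simp: row_orth col_orth)
    then show ?thesis by simp
  qed auto
qed

text \<open>Fixed vectors of the fourth tensor power of \<open>U\<close>. The sums are nested rather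
  than expanded so that a factor multiplied from the left can be absorbed by \<open>row_pick\<close>
  one level at a time.\<close>

definition inv4 :: "('v \<Rightarrow> 'v \<Rightarrow> 'v \<Rightarrow> 'v \<Rightarrow> real) \<Rightarrow> bool" where
  "inv4 T \<longleftrightarrow> (\<forall>x\<in>V. \<forall>y\<in>V. \<forall>z\<in>V. \<forall>w\<in>V.
     (\<Sum>a\<in>V. U x a * (\<Sum>b\<in>V. U y b * (\<Sum>c\<in>V. U z c * (\<Sum>d\<in>V. T a b c d *\<^sub>R U w d)))) = T x y z w *\<^sub>R 1)"

lemma inv4_cong:
  assumes "inv4 T" "\<And>a b c d. a \<in> V \<Longrightarrow> b \<in> V \<Longrightarrow> c \<in> V \<Longrightarrow> d \<in> V \<Longrightarrow> T a b c d = T' a b c d"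
  shows "inv4 T'"
  using assms(1) unfolding inv4_def by (simp add: assms(2) cong: sum.cong)

lemma inv4_add: "inv4 T \<Longrightarrow> inv4 T' \<Longrightarrow> inv4 (\<lambda>a b c d. T a b c d + T' a b c d)"
  unfolding inv4_def by (simp add: scaleR_left_distrib sum.distrib distrib_left)

lemma inv4_scale: "inv4 T \<Longrightarrow> inv4 (\<lambda>a b c d. r * T a b c d)"
proof -
  have *: "(\<Sum>d\<in>V. (r * T a b c d) *\<^sub>R U w d) = r *\<^sub>R (\<Sum>d\<in>V. T a b c d *\<^sub>R U w d)" for a b c w
    by (simp add: scaleR_right.sum)
  have **: "(\<Sum>c\<in>V. F c * (r *\<^sub>R G c)) = r *\<^sub>R (\<Sum>c\<in>V. F c * G c)" for F G :: "'v \<Rightarrow> 'a"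
    by (simp add: scaleR_right.sum)
  show "inv4 T \<Longrightarrow> ?thesis"
    unfolding inv4_def * ** by simp
qed

lemma inv4_diff: "inv4 T \<Longrightarrow> inv4 T' \<Longrightarrow> inv4 (\<lambda>a b c d. T a b c d - T' a b c d)"
  using inv4_add[OF _ inv4_scale[of T' "-1"]] by simp

text \<open>The factors \<open>U x a\<close> and \<open>U y b\<close> stand next to each other, so
  \<open>inv2\<close> trades \<open>f a b\<close> for the constant \<open>f x y\<close>. This is
  what confines masks on arbitrary tensors to cyclically neighbouring positions.\<close>

lemma mask_step:
  assumes "inv2 f" "x \<in> V" "y \<in> V" "a \<in> V"
  shows "U x a * (\<Sum>b\<in>V. U y b * (f a b *\<^sub>R G b)) = f x y *\<^sub>R (U x a * (\<Sum>b\<in>V. U y b * G b))"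
proof -
  have step: "U x a * (U y b * (f a b *\<^sub>R G b)) = f x y *\<^sub>R (U x a * (U y b * G b))" if "b \<in> V" for b
  proof -
    have "U x a * (U y b * (f a b *\<^sub>R G b)) = (f a b *\<^sub>R (U x a * U y b)) * G b"
      by (simp add: mult.assoc)
    also have "\<dots> = (f x y *\<^sub>R (U x a * U y b)) * G b"
      by (simp only: inv2D[OF assms that])
    finally show ?thesis by (simp add: mult.assoc)
  qed
  show ?thesis
    unfolding sum_distrib_left scaleR_right.sum by (intro sum.cong refl step)
qed

lemma inv4_mask01:
  assumes "inv4 T" "inv2 f"
  shows "inv4 (\<lambda>a b c d. f a b * T a b c d)"
  unfolding inv4_def
proof (intro ballI)
  fix x y z w assume *: "x \<in> V" "y \<in> V" "z \<in> V" "w \<in> V"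
  let ?G = "\<lambda>a b. \<Sum>c\<in>V. U z c * (\<Sum>d\<in>V. T a b c d *\<^sub>R U w d)"
  have G: "(\<Sum>c\<in>V. U z c * (\<Sum>d\<in>V. (f a b * T a b c d) *\<^sub>R U w d)) = f a b *\<^sub>R ?G a b" for a b
    by (rule sum_scale_nested)
  have "(\<Sum>a\<in>V. U x a * (\<Sum>b\<in>V. U y b * (f a b *\<^sub>R ?G a b))) = (\<Sum>a\<in>V. f x y *\<^sub>R (U x a * (\<Sum>b\<in>V. U y b * ?G a b)))"
    by (intro sum.cong refl mask_step assms(2) * ) auto
  also have "\<dots> = (f x y * T x y z w) *\<^sub>R 1"
    using assms(1) * unfolding inv4_def by (simp add: scaleR_right.sum[symmetric])
  finally show "(\<Sum>a\<in>V. U x a * (\<Sum>b\<in>V. U y b * (\<Sum>c\<in>V. U z c * (\<Sum>d\<in>V. (f a b * T a b c d) *\<^sub>R U w d))))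
      = (f x y * T x y z w) *\<^sub>R 1" unfolding G .
qed

text \<open>Frobenius reciprocity for the first leg: multiplying the invariance equation by
  \<open>U x a\<close> isolates the summand \<open>a\<close>, and summing over \<open>x\<close>
  removes the factor again by \<open>col_sum\<close>.\<close>

lemma inv4_split1:
  assumes "inv4 T" "a \<in> V" "y \<in> V" "z \<in> V" "w \<in> V"
  shows "(\<Sum>b\<in>V. U y b * (\<Sum>c\<in>V. U z c * (\<Sum>d\<in>V. T a b c d *\<^sub>R U w d))) = (\<Sum>x\<in>V. T x y z w *\<^sub>R U x a)"
proof -
  let ?L = "\<lambda>a. \<Sum>b\<in>V. U y b * (\<Sum>c\<in>V. U z c * (\<Sum>d\<in>V. T a b c d *\<^sub>R U w d))"
  have "T x y z w *\<^sub>R U x a = U x a * ?L a" if "x \<in> V" for x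
  proof -
    have "U x a * ?L a = U x a * (\<Sum>a\<in>V. U x a * ?L a)"
      using row_pick[OF that assms(2), of ?L] by simp
    also have "\<dots> = U x a * (T x y z w *\<^sub>R 1)"
      using assms that unfolding inv4_def by simp
    finally show ?thesis by simp
  qed
  then have "(\<Sum>x\<in>V. T x y z w *\<^sub>R U x a) = (\<Sum>x\<in>V. U x a) * ?L a"
    by (simp add: sum_distrib_right)
  with col_sum assms show ?thesis by simp
qed

text \<open>\<open>inv4_split1\<close> moves the first leg of \<open>T\<close> to the right of the
  other three, where column orthogonality against \<open>U w d\<close> fixes its index to be
  \<open>w\<close>.\<close>

lemma inv4_rot:
  assumes "inv4 T"
  shows "inv4 (\<lambda>a b c d. T d a b c)"
  unfolding inv4_def
proof (intro ballI)
  fix x y z w assume *: "x \<in> V" "y \<in> V" "z \<in> V" "w \<in> V"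
  have "(\<Sum>a\<in>V. U x a * (\<Sum>b\<in>V. U y b * (\<Sum>c\<in>V. U z c * (\<Sum>d\<in>V. T d a b c *\<^sub>R U w d))))
     = (\<Sum>d\<in>V. (\<Sum>a\<in>V. U x a * (\<Sum>b\<in>V. U y b * (\<Sum>c\<in>V. T d a b c *\<^sub>R U z c))) * U w d)"
    by (simp only: sum_nested_scale sum_nested_assoc)
  also have "\<dots> = (\<Sum>d\<in>V. (\<Sum>t\<in>V. T t x y z *\<^sub>R U t d) * U w d)"
    by (intro sum.cong refl arg_cong2[where f="(*)"] inv4_split1 assms * ) auto
  also have "\<dots> = (\<Sum>d\<in>V. T w x y z *\<^sub>R U w d)"
  proof (intro sum.cong refl)
    fix d assume d: "d \<in> V"
    have "(\<Sum>t\<in>V. T t x y z *\<^sub>R U t d) * U w d = (\<Sum>t\<in>V. if t = w then T w x y z *\<^sub>R U w d else 0)"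
      unfolding sum_distrib_right using * d by (intro sum.cong) (auto simp: col_mult)
    then show "(\<Sum>t\<in>V. T t x y z *\<^sub>R U t d) * U w d = T w x y z *\<^sub>R U w d"
      using * finite_V by simp
  qed
  also have "\<dots> = T w x y z *\<^sub>R 1"
    using row_sum * by (simp add: scaleR_right.sum[symmetric])
  finally show "(\<Sum>a\<in>V. U x a * (\<Sum>b\<in>V. U y b * (\<Sum>c\<in>V. U z c * (\<Sum>d\<in>V. T d a b c *\<^sub>R U w d)))) = T w x y z *\<^sub>R 1" .
qed

text \<open>Moving legs across one after the other reverses their order, hence
  \<open>U y b * U x a\<close>. This reversal is what later turns invariance of the flip into
  commutation.\<close>

lemma inv4_split2:
  assumes "inv4 T" "a \<in> V" "b \<in> V" "z \<in> V" "w \<in> V"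
  shows "(\<Sum>c\<in>V. U z c * (\<Sum>d\<in>V. T a b c d *\<^sub>R U w d)) = (\<Sum>x\<in>V. \<Sum>y\<in>V. T x y z w *\<^sub>R (U y b * U x a))"
proof -
  let ?L = "\<lambda>b. \<Sum>c\<in>V. U z c * (\<Sum>d\<in>V. T a b c d *\<^sub>R U w d)"
  have "(\<Sum>x\<in>V. T x y z w *\<^sub>R (U y b * U x a)) = U y b * ?L b" if "y \<in> V" for y
  proof -
    have "U y b * ?L b = U y b * (\<Sum>b\<in>V. U y b * ?L b)"
      using row_pick[OF that assms(3), of ?L] by simp
    also have "\<dots> = U y b * (\<Sum>x\<in>V. T x y z w *\<^sub>R U x a)"
      using inv4_split1[OF assms(1,2) that assms(4,5)] by simp
    finally show ?thesis by (simp add: sum_distrib_left)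
  qed
  then have "(\<Sum>y\<in>V. \<Sum>x\<in>V. T x y z w *\<^sub>R (U y b * U x a)) = (\<Sum>y\<in>V. U y b) * ?L b"
    by (simp add: sum_distrib_right)
  with col_sum assms sum.swap[of "\<lambda>x y. T x y z w *\<^sub>R (U y b * U x a)" V V] show ?thesis by simp
qed


text \<open>The contracted legs occur as \<open>q p\<close> in \<open>T\<close> and as
  \<open>p q\<close> in \<open>T'\<close>: \<open>inv4_split2\<close> brings the first two legs of
  \<open>T'\<close> to the left in reversed order, where they complete the fourfold product under
  which \<open>T\<close> is invariant.\<close>

lemma inv4_compose:
  assumes "inv4 T" "inv4 T'"
  shows "inv4 (\<lambda>a b c d. \<Sum>p\<in>V. \<Sum>q\<in>V. T a b q p * T' p q c d)"
  unfolding inv4_def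
proof (intro ballI)
  fix x y z w assume *: "x \<in> V" "y \<in> V" "z \<in> V" "w \<in> V"
  have 1: "(\<Sum>c\<in>V. U z c * (\<Sum>d\<in>V. (\<Sum>p\<in>V. \<Sum>q\<in>V. T a b q p * T' p q c d) *\<^sub>R U w d))
     = (\<Sum>r\<in>V. \<Sum>s\<in>V. T' r s z w *\<^sub>R (\<Sum>q\<in>V. U s q * (\<Sum>p\<in>V. T a b q p *\<^sub>R U r p)))" for a b
  proof -
    have "(\<Sum>c\<in>V. U z c * (\<Sum>d\<in>V. (\<Sum>p\<in>V. \<Sum>q\<in>V. T a b q p * T' p q c d) *\<^sub>R U w d))
       = (\<Sum>c\<in>V. \<Sum>d\<in>V. \<Sum>p\<in>V. \<Sum>q\<in>V. T a b q p *\<^sub>R (U z c * (T' p q c d *\<^sub>R U w d)))"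
      by (simp add: scaleR_left.sum sum_distrib_left)
    also have "\<dots> = (\<Sum>p\<in>V. \<Sum>q\<in>V. \<Sum>c\<in>V. \<Sum>d\<in>V. T a b q p *\<^sub>R (U z c * (T' p q c d *\<^sub>R U w d)))"
      by (rule sum_swap4)
    also have "\<dots> = (\<Sum>p\<in>V. \<Sum>q\<in>V. T a b q p *\<^sub>R (\<Sum>c\<in>V. U z c * (\<Sum>d\<in>V. T' p q c d *\<^sub>R U w d)))"
      by (simp only: scaleR_right.sum sum_distrib_left)
    also have "\<dots> = (\<Sum>p\<in>V. \<Sum>q\<in>V. T a b q p *\<^sub>R (\<Sum>r\<in>V. \<Sum>s\<in>V. T' r s z w *\<^sub>R (U s q * U r p)))"
      by (intro sum.cong refl arg_cong2[where f=scaleR] inv4_split2 assms * ) auto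
    also have "\<dots> = (\<Sum>p\<in>V. \<Sum>q\<in>V. \<Sum>r\<in>V. \<Sum>s\<in>V. T' r s z w *\<^sub>R (U s q * (T a b q p *\<^sub>R U r p)))"
      by (simp add: scaleR_right.sum mult.commute)
    also have "\<dots> = (\<Sum>r\<in>V. \<Sum>s\<in>V. \<Sum>p\<in>V. \<Sum>q\<in>V. T' r s z w *\<^sub>R (U s q * (T a b q p *\<^sub>R U r p)))"
      by (rule sum_swap4)
    also have "\<dots> = (\<Sum>r\<in>V. \<Sum>s\<in>V. T' r s z w *\<^sub>R (\<Sum>q\<in>V. U s q * (\<Sum>p\<in>V. T a b q p *\<^sub>R U r p)))"
      by (intro sum.cong refl) (simp only: scaleR_right.sum sum_distrib_left, rule sum.swap)
    finally show ?thesis .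
  qed
  have "(\<Sum>a\<in>V. U x a * (\<Sum>b\<in>V. U y b * (\<Sum>r\<in>V. \<Sum>s\<in>V. T' r s z w *\<^sub>R (\<Sum>q\<in>V. U s q * (\<Sum>p\<in>V. T a b q p *\<^sub>R U r p)))))
    = (\<Sum>a\<in>V. \<Sum>b\<in>V. \<Sum>r\<in>V. \<Sum>s\<in>V. T' r s z w *\<^sub>R (U x a * (U y b * (\<Sum>q\<in>V. U s q * (\<Sum>p\<in>V. T a b q p *\<^sub>R U r p)))))"
    by (simp only: sum_distrib_left mult_scaleR_right)
  also have "\<dots> = (\<Sum>r\<in>V. \<Sum>s\<in>V. \<Sum>a\<in>V. \<Sum>b\<in>V. T' r s z w *\<^sub>R (U x a * (U y b * (\<Sum>q\<in>V. U s q * (\<Sum>p\<in>V. T a b q p *\<^sub>R U r p)))))"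
    by (rule sum_swap4)
  also have "\<dots> = (\<Sum>r\<in>V. \<Sum>s\<in>V. T' r s z w *\<^sub>R (\<Sum>a\<in>V. U x a * (\<Sum>b\<in>V. U y b * (\<Sum>q\<in>V. U s q * (\<Sum>p\<in>V. T a b q p *\<^sub>R U r p)))))"
    by (simp only: sum_distrib_left scaleR_right.sum)
  also have "\<dots> = (\<Sum>r\<in>V. \<Sum>s\<in>V. T' r s z w *\<^sub>R (T x y s r *\<^sub>R 1))"
    using assms(1) * unfolding inv4_def by simp
  also have "\<dots> = (\<Sum>p\<in>V. \<Sum>q\<in>V. T x y q p * T' p q z w) *\<^sub>R 1"
    by (simp add: scaleR_left.sum mult.commute)
  finally show "(\<Sum>a\<in>V. U x a * (\<Sum>b\<in>V. U y b * (\<Sum>c\<in>V. U z c *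
      (\<Sum>d\<in>V. (\<Sum>p\<in>V. \<Sum>q\<in>V. T a b q p * T' p q c d) *\<^sub>R U w d))))
    = (\<Sum>p\<in>V. \<Sum>q\<in>V. T x y q p * T' p q z w) *\<^sub>R 1"
    unfolding 1 .
qed

lemma inv4_rot2: "inv4 T \<Longrightarrow> inv4 (\<lambda>a b c d. T c d a b)"
  by (drule inv4_rot, drule inv4_rot)

lemma inv4_rot3: "inv4 T \<Longrightarrow> inv4 (\<lambda>a b c d. T b c d a)"
  by (drule inv4_rot, drule inv4_rot2)

lemma inv4_mask12: "inv4 T \<Longrightarrow> inv2 f \<Longrightarrow> inv4 (\<lambda>a b c d. f b c * T a b c d)"
  using inv4_rot3[OF inv4_mask01[OF inv4_rot]] .

lemma inv4_mask23: "inv4 T \<Longrightarrow> inv2 f \<Longrightarrow> inv4 (\<lambda>a b c d. f c d * T a b c d)"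
  using inv4_rot2[OF inv4_mask01[OF inv4_rot2]] .

lemma inv4_mask30: "inv4 T \<Longrightarrow> inv2 f \<Longrightarrow> inv4 (\<lambda>a b c d. f d a * T a b c d)"
  using inv4_rot[OF inv4_mask01[OF inv4_rot3]] .

text \<open>Summing over \<open>d\<close> and then over \<open>b\<close> gives 1 by
  \<open>row_sum\<close>, which makes the factors belonging to \<open>x\<close> and \<open>z\<close>
  neighbours.\<close>

lemma inv4_diagonal02:
  assumes "inv2 f"
  shows "inv4 (\<lambda>a b c d. f a c)"
  unfolding inv4_def
proof (intro ballI)
  fix x y z w assume *: "x \<in> V" "y \<in> V" "z \<in> V" "w \<in> V"
  have "(\<Sum>a\<in>V. U x a * (\<Sum>b\<in>V. U y b * (\<Sum>c\<in>V. U z c * (\<Sum>d\<in>V. f a c *\<^sub>R U w d))))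
     = (\<Sum>a\<in>V. U x a * (\<Sum>c\<in>V. U z c * (f a c *\<^sub>R 1)))"
    using * row_sum by (simp add: scaleR_right.sum[symmetric] sum_distrib_right[symmetric])
  also have "\<dots> = (\<Sum>a\<in>V. f x z *\<^sub>R (U x a * (\<Sum>c\<in>V. U z c * 1)))"
    using mask_step[OF assms, of x z _ "\<lambda>_. 1"] * by (intro sum.cong refl) auto
  also have "\<dots> = f x z *\<^sub>R 1"
    using * row_sum by (simp add: scaleR_right.sum[symmetric])
  finally show "(\<Sum>a\<in>V. U x a * (\<Sum>b\<in>V. U y b * (\<Sum>c\<in>V. U z c * (\<Sum>d\<in>V. f a c *\<^sub>R U w d)))) = f x z *\<^sub>R 1" .
qed

lemma inv4_diagonal13: "inv2 f \<Longrightarrow> inv4 (\<lambda>a b c d. f b d)"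
  using inv4_rot3[OF inv4_diagonal02] .

text \<open>The weighted sum \<open>W x t\<close> is a combination of the row \<open>x\<close> and,
  by \<open>commutes_adj\<close>, also of the column \<open>t\<close>. A product of four such sums
  over the same column collapses by column orthogonality to one sum with multiplied weights.\<close>

lemma inv4_star:
  "inv4 (\<lambda>a b c d. \<Sum>t\<in>V. of_bool (E a t) * of_bool (E b t) * of_bool (E c t) * of_bool (E d t))"
  unfolding inv4_def
proof (intro ballI)
  fix x y z w assume *: "x \<in> V" "y \<in> V" "z \<in> V" "w \<in> V"
  define A where "A a t = (of_bool (E a t) :: real)" for a t
  define W where "W x t = (\<Sum>a\<in>V. A a t *\<^sub>R U x a)" for x t
  have W: "W x t = (\<Sum>s\<in>V. A x s *\<^sub>R U s t)" if "x \<in> V" "t \<in> V" for x t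
    using commutes_adj[OF that] by (simp add: W_def A_def)
  have WU: "W x t * (\<Sum>s\<in>V. k s *\<^sub>R U s t) = (\<Sum>s\<in>V. (A x s * k s) *\<^sub>R U s t)" if "x \<in> V" "t \<in> V" for x t k
  proof -
    have "W x t * (\<Sum>s\<in>V. k s *\<^sub>R U s t) = (\<Sum>r\<in>V. \<Sum>s\<in>V. (A x r * k s) *\<^sub>R (U r t * U s t))"
      unfolding W[OF that] sum_product by (simp add: mult.commute)
    also have "\<dots> = (\<Sum>r\<in>V. \<Sum>s\<in>V. if s = r then (A x r * k r) *\<^sub>R U r t else 0)"
      using that by (intro sum.cong refl) (auto simp: col_mult)
    also have "\<dots> = (\<Sum>r\<in>V. (A x r * k r) *\<^sub>R U r t)"
      using finite_V by simp
    finally show ?thesis .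
  qed
  have pull: "(\<Sum>a\<in>V. U v a * (\<Sum>t\<in>V. A a t *\<^sub>R F t)) = (\<Sum>t\<in>V. W v t * F t)" for v F
    unfolding sum_nested_scale W_def ..
  have "(\<Sum>a\<in>V. U x a * (\<Sum>b\<in>V. U y b * (\<Sum>c\<in>V. U z c * (\<Sum>d\<in>V. (\<Sum>t\<in>V. A a t * A b t * A c t * A d t) *\<^sub>R U w d))))
      = (\<Sum>a\<in>V. U x a * (\<Sum>b\<in>V. U y b * (\<Sum>c\<in>V. U z c * (\<Sum>t\<in>V. (A a t * A b t * A c t) *\<^sub>R W w t))))"
    unfolding W_def scaleR_left.sum scaleR_right.sum scaleR_scaleR by (subst sum.swap) simp
  also have "\<dots> = (\<Sum>a\<in>V. U x a * (\<Sum>b\<in>V. U y b * (\<Sum>t\<in>V. (A a t * A b t) *\<^sub>R (W z t * W w t))))"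
    using pull[of z "\<lambda>t. (A _ t * A _ t) *\<^sub>R W w t"] by (simp add: mult.commute)
  also have "\<dots> = (\<Sum>a\<in>V. U x a * (\<Sum>t\<in>V. A a t *\<^sub>R (W y t * (W z t * W w t))))"
    using pull[of y "\<lambda>t. A _ t *\<^sub>R (W z t * W w t)"] by (simp add: mult.commute)
  also have "\<dots> = (\<Sum>t\<in>V. W x t * (W y t * (W z t * W w t)))"
    by (rule pull)
  also have "\<dots> = (\<Sum>t\<in>V. \<Sum>s\<in>V. (A x s * (A y s * (A z s * A w s))) *\<^sub>R U s t)"
    using * by (intro sum.cong refl) (simp add: W[of w] WU)
  also have "\<dots> = (\<Sum>s\<in>V. (A x s * (A y s * (A z s * A w s))) *\<^sub>R (\<Sum>t\<in>V. U s t))"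
    by (subst sum.swap) (simp add: scaleR_right.sum)
  also have "\<dots> = (\<Sum>t\<in>V. A x t * A y t * A z t * A w t) *\<^sub>R 1"
    using row_sum by (simp add: scaleR_left.sum mult.assoc)
  finally show "(\<Sum>a\<in>V. U x a * (\<Sum>b\<in>V. U y b * (\<Sum>c\<in>V. U z c * (\<Sum>d\<in>V.
      (\<Sum>t\<in>V. of_bool (E a t) * of_bool (E b t) * of_bool (E c t) * of_bool (E d t)) *\<^sub>R U w d))))
    = (\<Sum>t\<in>V. of_bool (E x t) * of_bool (E y t) * of_bool (E z t) * of_bool (E w t)) *\<^sub>R 1"
    unfolding A_def .
qed

text \<open>For the flip, the two sides of \<open>inv4_split2\<close> are
  \<open>U x a * U y b\<close> and \<open>U y b * U x a\<close>. If \<open>a\<close> and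
  \<open>b\<close> are not adjacent, both products vanish.\<close>

lemma inv4_flip_commute:
  assumes flip: "inv4 (\<lambda>a b c d. of_bool (a = c \<and> b = d \<and> E a b))"
    and E: "symp E" and x: "x \<in> V" "y \<in> V" "a \<in> V" "b \<in> V" and xy: "E x y"
  shows "U x a * U y b = U y b * U x a"
proof (cases "E a b")
  case True
  have "(\<Sum>c\<in>V. U x c * (\<Sum>d\<in>V. of_bool (a = c \<and> b = d \<and> E a b) *\<^sub>R U y d)) = U x a * U y b"
  proof -
    have "(\<Sum>d\<in>V. of_bool (a = c \<and> b = d \<and> E a b) *\<^sub>R U y d) = (if c = a then U y b else 0)" for c
      using x finite_V True by (simp add: of_bool_def if_distrib[of "\<lambda>r. r *\<^sub>R _"] cong: if_cong)
    then show ?thesis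
      using x finite_V by (simp add: if_distrib[of "\<lambda>r. _ * r"] cong: if_cong)
  qed
  moreover have "(\<Sum>p\<in>V. \<Sum>q\<in>V. of_bool (p = x \<and> q = y \<and> E p q) *\<^sub>R (U q b * U p a)) = U y b * U x a"
  proof -
    have "(\<Sum>q\<in>V. of_bool (p = x \<and> q = y \<and> E p q) *\<^sub>R (U q b * U p a)) = (if p = x then U y b * U x a else 0)" for p
    proof -
      have "(\<Sum>q\<in>V. of_bool (p = x \<and> q = y \<and> E p q) *\<^sub>R (U q b * U p a))
          = (\<Sum>q\<in>V. if q = y then (if p = x then U y b * U x a else 0) else 0)"
        using xy by (intro sum.cong) auto
      then show ?thesis using x finite_V by simp
    qed
    then show ?thesis using x finite_V by simp
  qed
  ultimately show ?thesis
    using inv4_split2[OF flip, of a b x y] x by simp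
next
  case False
  then have "\<not> E b a" "E y x" using E xy by (auto dest: sympD)
  then show ?thesis using edge_orth[of x y a b] edge_orth[of y x b a] x xy False by simp
qed

end

lemma (in magic_unitary) commuting_flip:
  assumes comm: "\<And>x y a b. x \<in> V \<Longrightarrow> y \<in> V \<Longrightarrow> a \<in> V \<Longrightarrow> b \<in> V \<Longrightarrow> U x a * U y b = U y b * U x a"
    and x: "x \<in> V" "y \<in> V" "z \<in> V" "w \<in> V"
  shows "(\<Sum>a\<in>V. \<Sum>b\<in>V. U x a * (U y b * (U z a * U w b))) = of_bool (x = z \<and> y = w)"
proof -
  have "U x a * (U y b * (U z a * U w b)) = (U x a * U z a) * (U y b * U w b)" if "a \<in> V" "b \<in> V" for a b
  proof -
    have "U y b * (U z a * U w b) = U z a * (U y b * U w b)"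
      using comm[OF x(2,3) that(2,1)] by (metis mult.assoc)
    then show ?thesis by (simp add: mult.assoc)
  qed
  then have "(\<Sum>a\<in>V. \<Sum>b\<in>V. U x a * (U y b * (U z a * U w b))) = (\<Sum>a\<in>V. U x a * U z a) * (\<Sum>b\<in>V. U y b * U w b)"
    by (simp add: sum_product)
  then show ?thesis using x row_sum by (auto simp: col_mult)
qed

section \<open>The McLaughlin graph\<close>

context magic_unitary
begin

text \<open>Inserting the row sum of \<open>x\<close> creates the products
  \<open>U x c * U k a\<close>, in which \<open>inv2\<close> trades \<open>f x k\<close> for
  \<open>f c a\<close>; the column sum of \<open>a\<close> then removes the other factor.\<close>

lemma inv2_transfer:
  assumes "inv2 f" "x \<in> V" "a \<in> V"
  shows "(\<Sum>k\<in>V. f x k *\<^sub>R U k a) = (\<Sum>k\<in>V. f k a *\<^sub>R U x k)"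
proof -
  have "(\<Sum>k\<in>V. f x k *\<^sub>R U k a) = (\<Sum>k\<in>V. \<Sum>c\<in>V. f x k *\<^sub>R (U x c * U k a))"
    using assms row_sum by (simp add: scaleR_right.sum[symmetric] sum_distrib_right[symmetric])
  also have "\<dots> = (\<Sum>k\<in>V. \<Sum>c\<in>V. f c a *\<^sub>R (U x c * U k a))"
    using assms by (intro sum.cong refl inv2D[OF assms(1), symmetric])
  also have "\<dots> = (\<Sum>c\<in>V. f c a *\<^sub>R U x c)"
    using assms col_sum
    by (subst sum.swap) (simp add: scaleR_right.sum[symmetric] sum_distrib_left[symmetric])
  finally show ?thesis .
qed

lemma inv2_total:
  assumes "inv2 f" "x \<in> V" "y \<in> V"
  shows "(\<Sum>a\<in>V. \<Sum>b\<in>V. f a b *\<^sub>R (U x a * U y b)) = f x y *\<^sub>R 1"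
proof -
  have "(\<Sum>a\<in>V. \<Sum>b\<in>V. f a b *\<^sub>R (U x a * U y b)) = (\<Sum>a\<in>V. \<Sum>b\<in>V. f x y *\<^sub>R (U x a * U y b))"
    using assms by (intro sum.cong refl inv2D[OF assms(1)])
  then show ?thesis
    using assms row_sum by (simp add: scaleR_right.sum[symmetric] sum_product[symmetric])
qed

lemma inv2_total':
  assumes "inv2 f" "a \<in> V" "b \<in> V"
  shows "(\<Sum>x\<in>V. \<Sum>y\<in>V. f x y *\<^sub>R (U x a * U y b)) = f a b *\<^sub>R 1"
proof -
  have "(\<Sum>x\<in>V. \<Sum>y\<in>V. f x y *\<^sub>R (U x a * U y b)) = (\<Sum>x\<in>V. \<Sum>y\<in>V. f a b *\<^sub>R (U x a * U y b))"
    using assms by (intro sum.cong refl inv2D[OF assms(1), symmetric])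
  then show ?thesis
    using assms col_sum by (simp add: scaleR_right.sum[symmetric] sum_product[symmetric])
qed

lemma row_combination_mult:
  assumes "x \<in> V"
  shows "(\<Sum>c\<in>V. f c *\<^sub>R U x c) * (\<Sum>c\<in>V. g c *\<^sub>R U x c) = (\<Sum>c\<in>V. (f c * g c) *\<^sub>R U x c)"
proof -
  have "(\<Sum>c\<in>V. f c *\<^sub>R U x c) * (\<Sum>c\<in>V. g c *\<^sub>R U x c) = (\<Sum>c\<in>V. \<Sum>d\<in>V. if d = c then (f c * g c) *\<^sub>R U x c else 0)"
    unfolding sum_product using assms by (intro sum.cong refl) (auto simp: row_mult mult.commute)
  then show ?thesis using finite_V by simp
qed

lemma col_combination_mult:
  assumes "a \<in> V"
  shows "(\<Sum>c\<in>V. f c *\<^sub>R U c a) * (\<Sum>c\<in>V. g c *\<^sub>R U c a) = (\<Sum>c\<in>V. (f c * g c) *\<^sub>R U c a)"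
proof -
  have "(\<Sum>c\<in>V. f c *\<^sub>R U c a) * (\<Sum>c\<in>V. g c *\<^sub>R U c a) = (\<Sum>c\<in>V. \<Sum>d\<in>V. if d = c then (f c * g c) *\<^sub>R U c a else 0)"
    unfolding sum_product using assms by (intro sum.cong refl) (auto simp: col_mult mult.commute)
  then show ?thesis using finite_V by simp
qed

text \<open>The element \<open>H\<close> is evaluated twice, through the rows \<open>x\<close>,
  \<open>y\<close> and through the columns \<open>a\<close>, \<open>b\<close>. Two of the three
  pairings in the quartic identity contribute the same both times; the remaining one contributes
  \<open>W x b * W y a\<close> in one evaluation and \<open>W y a * W x b\<close> in the
  other.\<close>

lemma quartic_commute:
  fixes P :: "'v \<Rightarrow> 'v \<Rightarrow> real"
  assumes inv: "inv2 P" and sym: "\<And>a b. a \<in> V \<Longrightarrow> b \<in> V \<Longrightarrow> P a b = P b a"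
    and quartic: "\<And>a b c d. a \<in> V \<Longrightarrow> b \<in> V \<Longrightarrow> c \<in> V \<Longrightarrow> d \<in> V \<Longrightarrow>
      (\<Sum>z\<in>V. P a z * P b z * (P c z * P d z)) = k * (P a b * P c d + P a d * P b c + P a c * P b d)"
    and "k \<noteq> 0" and x: "x \<in> V" "y \<in> V" "a \<in> V" "b \<in> V"
  shows "(\<Sum>c\<in>V. P c b *\<^sub>R U x c) * (\<Sum>c\<in>V. P c a *\<^sub>R U y c) = (\<Sum>c\<in>V. P c a *\<^sub>R U y c) * (\<Sum>c\<in>V. P c b *\<^sub>R U x c)"
proof -
  define W where "W x a = (\<Sum>c\<in>V. P c a *\<^sub>R U x c)" for x a
  have W: "W x a = (\<Sum>c\<in>V. P x c *\<^sub>R U c a)" if "x \<in> V" "a \<in> V" for x a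
    using inv2_transfer[OF inv that] by (simp add: W_def)
  define S where "S a b c d = (\<Sum>z\<in>V. P a z * P b z * (P c z * P d z))" for a b c d
  define H where "H = (\<Sum>c\<in>V. \<Sum>z\<in>V. (P x c * P y c * (P z a * P z b)) *\<^sub>R U c z)"
  have "(\<Sum>c\<in>V. \<Sum>d\<in>V. S c d a b *\<^sub>R (U x c * U y d)) = (\<Sum>c\<in>V. \<Sum>d\<in>V. \<Sum>z\<in>V. (P a z * P b z) *\<^sub>R ((P c z *\<^sub>R U x c) * (P d z *\<^sub>R U y d)))"
    unfolding S_def by (simp add: scaleR_left.sum mult_ac)
  also have "\<dots> = (\<Sum>z\<in>V. \<Sum>c\<in>V. \<Sum>d\<in>V. (P a z * P b z) *\<^sub>R ((P c z *\<^sub>R U x c) * (P d z *\<^sub>R U y d)))"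
    by (rule sum_swap3)
  also have "\<dots> = (\<Sum>z\<in>V. (P a z * P b z) *\<^sub>R (W x z * W y z))"
    unfolding W_def sum_product scaleR_right.sum ..
  also have "\<dots> = (\<Sum>z\<in>V. (P a z * P b z) *\<^sub>R (\<Sum>c\<in>V. (P x c * P y c) *\<^sub>R U c z))"
    using x by (intro sum.cong refl) (simp add: W col_combination_mult)
  also have "\<dots> = H"
    unfolding H_def scaleR_right.sum using sym x by (subst sum.swap) (intro sum.cong refl, simp add: mult_ac)
  finally have 1: "(\<Sum>c\<in>V. \<Sum>d\<in>V. S c d a b *\<^sub>R (U x c * U y d)) = H" .
  have "(\<Sum>c\<in>V. \<Sum>d\<in>V. S x y c d *\<^sub>R (U c a * U d b)) = (\<Sum>c\<in>V. \<Sum>d\<in>V. \<Sum>z\<in>V. (P x z * P y z) *\<^sub>R ((P c z *\<^sub>R U c a) * (P d z *\<^sub>R U d b)))"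
    unfolding S_def by (simp add: scaleR_left.sum mult_ac)
  also have "\<dots> = (\<Sum>z\<in>V. \<Sum>c\<in>V. \<Sum>d\<in>V. (P x z * P y z) *\<^sub>R ((P c z *\<^sub>R U c a) * (P d z *\<^sub>R U d b)))"
    by (rule sum_swap3)
  also have "\<dots> = (\<Sum>z\<in>V. (P x z * P y z) *\<^sub>R ((\<Sum>c\<in>V. P c z *\<^sub>R U c a) * (\<Sum>d\<in>V. P d z *\<^sub>R U d b)))"
    unfolding sum_product scaleR_right.sum ..
  also have "\<dots> = (\<Sum>z\<in>V. (P x z * P y z) *\<^sub>R (W z a * W z b))"
    using x sym by (intro sum.cong refl) (simp add: W cong: sum.cong)
  also have "\<dots> = H"
    unfolding H_def W_def using x by (intro sum.cong refl) (simp add: row_combination_mult scaleR_right.sum)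
  finally have 2: "(\<Sum>c\<in>V. \<Sum>d\<in>V. S x y c d *\<^sub>R (U c a * U d b)) = H" .
  have "(\<Sum>c\<in>V. \<Sum>d\<in>V. S c d a b *\<^sub>R (U x c * U y d))
      = (\<Sum>c\<in>V. \<Sum>d\<in>V. k *\<^sub>R (P a b *\<^sub>R (P c d *\<^sub>R (U x c * U y d)) + (P c b *\<^sub>R U x c) * (P d a *\<^sub>R U y d)
          + (P c a *\<^sub>R U x c) * (P d b *\<^sub>R U y d)))"
    unfolding S_def using x by (intro sum.cong refl) (simp add: quartic, simp add: algebra_simps)
  also have "\<dots> = k *\<^sub>R (P a b *\<^sub>R (\<Sum>c\<in>V. \<Sum>d\<in>V. P c d *\<^sub>R (U x c * U y d)) + W x b * W y a + W x a * W y b)"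
    unfolding W_def sum_product by (simp only: scaleR_right.sum[symmetric] sum.distrib)
  finally have 3: "H = k *\<^sub>R ((P a b * P x y) *\<^sub>R 1 + W x b * W y a + W x a * W y b)"
    using 1 inv2_total[OF inv] x by simp
  have "(\<Sum>c\<in>V. \<Sum>d\<in>V. S x y c d *\<^sub>R (U c a * U d b))
      = (\<Sum>c\<in>V. \<Sum>d\<in>V. k *\<^sub>R (P x y *\<^sub>R (P c d *\<^sub>R (U c a * U d b)) + (P y c *\<^sub>R U c a) * (P x d *\<^sub>R U d b)
          + (P x c *\<^sub>R U c a) * (P y d *\<^sub>R U d b)))"
    unfolding S_def using x by (intro sum.cong refl) (simp add: quartic, simp add: algebra_simps)
  also have "\<dots> = k *\<^sub>R (P x y *\<^sub>R (\<Sum>c\<in>V. \<Sum>d\<in>V. P c d *\<^sub>R (U c a * U d b)) + W y a * W x b + W x a * W y b)"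
    using x by (simp only: W sum_product) (simp only: scaleR_right.sum[symmetric] sum.distrib)
  finally have 4: "H = k *\<^sub>R ((P a b * P x y) *\<^sub>R 1 + W y a * W x b + W x a * W y b)"
    using 2 inv2_total'[OF inv] x by (simp add: mult.commute)
  from 3 4 \<open>k \<noteq> 0\<close> have "W x b * W y a = W y a * W x b" by simp
  then show ?thesis unfolding W_def .
qed

text \<open>Row combinations multiply pointwise. With \<open>r\<close> and \<open>s\<close> the two
  values of \<open>P\<close> off the diagonal, \<open>(W x a - r) * (W x a - s)\<close> therefore
  retains only the diagonal term, a nonzero multiple of \<open>U x a\<close>. Commutation passes
  from \<open>W\<close> to these polynomials.\<close>

lemma commute_of_quartic:
  fixes h :: "bool \<Rightarrow> bool \<Rightarrow> real"
  defines "P \<equiv> \<lambda>a b. h (a = b) (E a b)"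
  assumes E: "symp E" "irreflp E"
    and h: "h True False \<noteq> h False True" "h True False \<noteq> h False False"
    and quartic: "\<And>a b c d. a \<in> V \<Longrightarrow> b \<in> V \<Longrightarrow> c \<in> V \<Longrightarrow> d \<in> V \<Longrightarrow>
      (\<Sum>z\<in>V. P a z * P b z * (P c z * P d z)) = k * (P a b * P c d + P a d * P b c + P a c * P b d)"
    and "k \<noteq> 0" and x: "x \<in> V" "y \<in> V" "a \<in> V" "b \<in> V"
  shows "U x a * U y b = U y b * U x a"
proof -
  define W where "W x a = (\<Sum>c\<in>V. P c a *\<^sub>R U x c)" for x a
  have inv: "inv2 P" unfolding P_def by (rule inv2_relation)
  have sym: "P a b = P b a" for a b
    using E by (auto simp: P_def dest: sympD intro: arg_cong2[where f=h])
  let ?r = "h False True" and ?s = "h False False" and ?t = "h True False"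
  have shift: "W x a - r *\<^sub>R 1 = (\<Sum>c\<in>V. (P c a - r) *\<^sub>R U x c)" if "x \<in> V" for x a r
    using row_sum[OF that] by (simp add: W_def scaleR_left_diff_distrib sum_subtractf scaleR_right.sum[symmetric])
  have U: "((?t - ?r) * (?t - ?s)) *\<^sub>R U x a = (W x a - ?r *\<^sub>R 1) * (W x a - ?s *\<^sub>R 1)" if "x \<in> V" "a \<in> V" for x a
  proof -
    have "(W x a - ?r *\<^sub>R 1) * (W x a - ?s *\<^sub>R 1) = (\<Sum>c\<in>V. ((P c a - ?r) * (P c a - ?s)) *\<^sub>R U x c)"
      using that by (simp add: shift row_combination_mult)
    also have "\<dots> = (\<Sum>c\<in>V. if c = a then ((?t - ?r) * (?t - ?s)) *\<^sub>R U x a else 0)"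
    proof (rule sum.cong[OF refl])
      fix c
      show "((P c a - ?r) * (P c a - ?s)) *\<^sub>R U x c = (if c = a then ((?t - ?r) * (?t - ?s)) *\<^sub>R U x a else 0)"
        using E by (cases "E c a") (auto simp: P_def irreflp_def)
    qed
    finally show ?thesis using that finite_V by simp
  qed
  have comm_poly: "((p - r *\<^sub>R 1) * (p - s *\<^sub>R 1)) * q = q * ((p - r *\<^sub>R 1) * (p - s *\<^sub>R 1))"
    if "p * q = q * p" for p q :: 'a and r s :: real
  proof -
    have *: "(p - r *\<^sub>R 1) * q = q * (p - r *\<^sub>R 1)" for r :: real
      using that by (simp add: algebra_simps)
    show ?thesis by (metis * mult.assoc)
  qed
  have "W x a * W y b = W y b * W x a"
    unfolding W_def using inv sym quartic \<open>k \<noteq> 0\<close> x by (intro quartic_commute) auto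
  then have "((?t - ?r) * (?t - ?s)) *\<^sub>R U x a * ((?t - ?r) * (?t - ?s)) *\<^sub>R U y b
      = ((?t - ?r) * (?t - ?s)) *\<^sub>R U y b * ((?t - ?r) * (?t - ?s)) *\<^sub>R U x a"
    unfolding U[OF x(1,3)] U[OF x(2,4)] using comm_poly by metis
  then show ?thesis using h by simp
qed

end

text \<open>The quartic identity says that the rows of \<open>P\<close> form a spherical 4-design; it follows from
  the vanishing of the sum of the squares of the differences of the two sides.\<close>

lemma quartic_identity:
  fixes P :: "'v \<Rightarrow> 'v \<Rightarrow> real"
  assumes fin: "finite V" and sym: "\<And>a b. a \<in> V \<Longrightarrow> b \<in> V \<Longrightarrow> P a b = P b a"
    and idem: "\<And>a b. a \<in> V \<Longrightarrow> b \<in> V \<Longrightarrow> (\<Sum>c\<in>V. P a c * P c b) = P a b"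
    and total: "(\<Sum>z\<in>V. \<Sum>w\<in>V. P z w ^ 4) - 6 * k * (\<Sum>z\<in>V. P z z ^ 2)
        + k ^ 2 * (3 * (\<Sum>z\<in>V. P z z) ^ 2 + 6 * (\<Sum>z\<in>V. P z z)) = 0"
    and abcd: "a \<in> V" "b \<in> V" "c \<in> V" "d \<in> V"
  shows "(\<Sum>z\<in>V. P a z * P b z * (P c z * P d z)) = k * (P a b * P c d + P a d * P b c + P a c * P b d)"
proof -
  define S where "S a b c d = (\<Sum>z\<in>V. P a z * P b z * (P c z * P d z))" for a b c d
  define G where "G a b c d = P a b * P c d + P a d * P b c + P a c * P b d" for a b c d
  have idem1: "(\<Sum>c\<in>V. P c a * P c b) = P a b" if "a \<in> V" "b \<in> V" for a b
    using idem[OF that] sym that by (simp cong: sum.cong)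
  have idem2: "(\<Sum>c\<in>V. P a c * P b c) = P a b" if "a \<in> V" "b \<in> V" for a b
    using idem[OF that] sym that by (simp cong: sum.cong)
  let ?d = "\<Sum>z\<in>V. P z z"
  have SF: "(\<Sum>a\<in>V. \<Sum>b\<in>V. \<Sum>c\<in>V. \<Sum>d\<in>V. S a b c d * F a b c d)
      = (\<Sum>z\<in>V. \<Sum>a\<in>V. P a z * (\<Sum>b\<in>V. P b z * (\<Sum>c\<in>V. P c z * (\<Sum>d\<in>V. P d z * F a b c d))))" for F
  proof -
    have "(\<Sum>a\<in>V. \<Sum>b\<in>V. \<Sum>c\<in>V. \<Sum>d\<in>V. S a b c d * F a b c d)
        = (\<Sum>a\<in>V. \<Sum>b\<in>V. \<Sum>c\<in>V. \<Sum>d\<in>V. \<Sum>z\<in>V. P a z * (P b z * (P c z * (P d z * F a b c d))))"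
      unfolding S_def sum_distrib_right mult.assoc ..
    also have "\<dots> = (\<Sum>a\<in>V. \<Sum>b\<in>V. \<Sum>z\<in>V. \<Sum>c\<in>V. \<Sum>d\<in>V. P a z * (P b z * (P c z * (P d z * F a b c d))))"
      by (rule sum.cong[OF refl], rule sum.cong[OF refl], rule sum_swap3)
    also have "\<dots> = (\<Sum>z\<in>V. \<Sum>a\<in>V. \<Sum>b\<in>V. \<Sum>c\<in>V. \<Sum>d\<in>V. P a z * (P b z * (P c z * (P d z * F a b c d))))"
      by (rule sum_swap3)
    finally show ?thesis by (simp add: sum_distrib_left)
  qed
  have contract: "(\<Sum>a\<in>V. P a z * (\<Sum>w\<in>V. P a w * g w)) = (\<Sum>w\<in>V. P z w * g w)" if "z \<in> V" for z g
  proof -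
    have "(\<Sum>a\<in>V. P a z * (\<Sum>w\<in>V. P a w * g w)) = (\<Sum>w\<in>V. (\<Sum>a\<in>V. P a z * P a w) * g w)"
      by (rule sum_nested_assoc)
    then show ?thesis using idem1[OF that] by (simp cong: sum.cong)
  qed
  \<comment> \<open>Each of the sums over \<open>d\<close>, \<open>c\<close>, \<open>b\<close>,
    \<open>a\<close> contracts two factors \<open>P\<close> into one by idempotence, and the four
    resulting factors \<open>P z w\<close> make the fourth power.\<close>
  have SS: "(\<Sum>a\<in>V. \<Sum>b\<in>V. \<Sum>c\<in>V. \<Sum>d\<in>V. S a b c d * S a b c d) = (\<Sum>z\<in>V. \<Sum>w\<in>V. P z w ^ 4)"
    unfolding SF
  proof (rule sum.cong[OF refl])
    fix z assume z: "z \<in> V"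
    have "(\<Sum>d\<in>V. P d z * S a b c d) = (\<Sum>w\<in>V. P c w * (P a w * P b w * P z w))" for a b c
      using contract[OF z, of "\<lambda>w. P a w * P b w * P c w"] by (simp add: S_def mult_ac)
    moreover have "(\<Sum>c\<in>V. P c z * (\<Sum>w\<in>V. P c w * (P a w * P b w * P z w))) = (\<Sum>w\<in>V. P b w * (P a w * P z w ^ 2))" for a b
      unfolding contract[OF z] by (simp add: power2_eq_square mult_ac)
    moreover have "(\<Sum>b\<in>V. P b z * (\<Sum>w\<in>V. P b w * (P a w * P z w ^ 2))) = (\<Sum>w\<in>V. P a w * P z w ^ 3)" for a
      unfolding contract[OF z] by (simp add: power2_eq_square power3_eq_cube mult_ac)
    moreover have "(\<Sum>a\<in>V. P a z * (\<Sum>w\<in>V. P a w * P z w ^ 3)) = (\<Sum>w\<in>V. P z w ^ 4)"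
      unfolding contract[OF z] by (simp add: power3_eq_cube power4_eq_xxxx mult_ac)
    ultimately show "(\<Sum>a\<in>V. P a z * (\<Sum>b\<in>V. P b z * (\<Sum>c\<in>V. P c z * (\<Sum>d\<in>V. P d z * S a b c d)))) = (\<Sum>w\<in>V. P z w ^ 4)"
      by simp
  qed
  have SG: "(\<Sum>a\<in>V. \<Sum>b\<in>V. \<Sum>c\<in>V. \<Sum>d\<in>V. S a b c d * G a b c d) = (\<Sum>z\<in>V. 3 * P z z ^ 2)"
    unfolding SF
  proof (rule sum.cong[OF refl])
    fix z assume z: "z \<in> V"
    have "(\<Sum>d\<in>V. P d z * G a b c d) = P a b * P c z + P a z * P b c + P a c * P b z" if "a \<in> V" "b \<in> V" "c \<in> V" for a b c
    proof -
      have "(\<Sum>d\<in>V. P d z * G a b c d) = P a b * (\<Sum>d\<in>V. P c d * P d z) + (\<Sum>d\<in>V. P a d * P d z) * P b c + P a c * (\<Sum>d\<in>V. P b d * P d z)"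
        unfolding G_def sum_distrib_left sum_distrib_right sum.distrib[symmetric] by (simp add: algebra_simps)
      then show ?thesis using idem that z by simp
    qed
    moreover have "(\<Sum>c\<in>V. P c z * (P a b * P c z + P a z * P b c + P a c * P b z)) = P a b * P z z + 2 * P a z * P b z" if "a \<in> V" "b \<in> V" for a b
    proof -
      have "(\<Sum>c\<in>V. P c z * (P a b * P c z + P a z * P b c + P a c * P b z)) = P a b * (\<Sum>c\<in>V. P c z * P c z) + P a z * (\<Sum>c\<in>V. P b c * P c z) + (\<Sum>c\<in>V. P a c * P c z) * P b z"
        unfolding sum_distrib_left sum_distrib_right sum.distrib[symmetric] by (simp add: algebra_simps)
      then show ?thesis using idem idem1 that z by simp
    qed
    moreover have "(\<Sum>b\<in>V. P b z * (P a b * P z z + 2 * P a z * P b z)) = 3 * P a z * P z z" if "a \<in> V" for a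
    proof -
      have "(\<Sum>b\<in>V. P b z * (P a b * P z z + 2 * P a z * P b z)) = (\<Sum>b\<in>V. P a b * P b z) * P z z + 2 * P a z * (\<Sum>b\<in>V. P b z * P b z)"
        unfolding sum_distrib_left sum_distrib_right sum.distrib[symmetric] by (simp add: algebra_simps)
      then show ?thesis using idem idem1 that z by simp
    qed
    moreover have "(\<Sum>a\<in>V. P a z * (3 * P a z * P z z)) = 3 * P z z ^ 2"
    proof -
      have "(\<Sum>a\<in>V. P a z * (3 * P a z * P z z)) = 3 * (\<Sum>a\<in>V. P a z * P a z) * P z z"
        unfolding sum_distrib_left sum_distrib_right by (simp add: algebra_simps)
      then show ?thesis using idem1 z by (simp add: power2_eq_square)
    qed
    ultimately show "(\<Sum>a\<in>V. P a z * (\<Sum>b\<in>V. P b z * (\<Sum>c\<in>V. P c z * (\<Sum>d\<in>V. P d z * G a b c d)))) = 3 * P z z ^ 2"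
      by simp
  qed
  have sq: "(\<Sum>a\<in>V. \<Sum>b\<in>V. P a b * P a b) = ?d"
    using idem2 by (simp cong: sum.cong)
  have G1: "(\<Sum>a\<in>V. \<Sum>b\<in>V. \<Sum>c\<in>V. \<Sum>d\<in>V. P a b * P c d * G a b c d) = ?d ^ 2 + 2 * ?d"
  proof -
    have "(\<Sum>d\<in>V. P a b * P c d * G a b c d) = P a b * (P a b * P c c + 2 * (P a c * P b c))" if "a \<in> V" "b \<in> V" "c \<in> V" for a b c
    proof -
      have "(\<Sum>d\<in>V. P a b * P c d * G a b c d) = P a b * (P a b * (\<Sum>d\<in>V. P c d * P c d) + P b c * (\<Sum>d\<in>V. P a d * P c d) + P a c * (\<Sum>d\<in>V. P b d * P c d))"
        unfolding G_def sum_distrib_left sum_distrib_right sum.distrib[symmetric] by (simp add: algebra_simps)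
      then show ?thesis using idem2 that by (simp add: mult_ac)
    qed
    moreover have "(\<Sum>c\<in>V. P a b * (P a b * P c c + 2 * (P a c * P b c))) = (?d + 2) * (P a b * P a b)" if "a \<in> V" "b \<in> V" for a b
    proof -
      have "(\<Sum>c\<in>V. P a b * (P a b * P c c + 2 * (P a c * P b c))) = P a b * (P a b * ?d + 2 * (\<Sum>c\<in>V. P a c * P b c))"
        unfolding sum_distrib_left sum_distrib_right sum.distrib[symmetric] by (simp add: algebra_simps)
      then show ?thesis using idem2 that by (simp add: algebra_simps)
    qed
    ultimately have "(\<Sum>a\<in>V. \<Sum>b\<in>V. \<Sum>c\<in>V. \<Sum>d\<in>V. P a b * P c d * G a b c d) = (?d + 2) * (\<Sum>a\<in>V. \<Sum>b\<in>V. P a b * P a b)"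
      by (simp add: sum_distrib_left)
    then show ?thesis by (simp add: sq power2_eq_square algebra_simps)
  qed
  have "(\<Sum>c\<in>V. \<Sum>d\<in>V. P a d * P b c * G a b c d) = P a a * P b b + 2 * (P a b * P a b)"
    "(\<Sum>c\<in>V. \<Sum>d\<in>V. P a c * P b d * G a b c d) = P a a * P b b + 2 * (P a b * P a b)" if ab: "a \<in> V" "b \<in> V" for a b
  proof -
    have 1: "(\<Sum>d\<in>V. P a d * P b c * G a b c d) = P b c * (P a b * P a c + P a a * P b c + P a c * P a b)" if "c \<in> V" for c
    proof -
      have "(\<Sum>d\<in>V. P a d * P b c * G a b c d) = P b c * (P a b * (\<Sum>d\<in>V. P a d * P c d) + (\<Sum>d\<in>V. P a d * P a d) * P b c + P a c * (\<Sum>d\<in>V. P a d * P b d))"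
        unfolding G_def sum_distrib_left sum_distrib_right sum.distrib[symmetric] by (simp add: algebra_simps)
      then show ?thesis using idem2 that ab by (simp add: algebra_simps)
    qed
    have "(\<Sum>c\<in>V. P b c * (P a b * P a c + P a a * P b c + P a c * P a b)) = 2 * P a b * (\<Sum>c\<in>V. P a c * P b c) + P a a * (\<Sum>c\<in>V. P b c * P b c)"
      unfolding sum_distrib_left sum_distrib_right sum.distrib[symmetric] by (simp add: algebra_simps)
    then show "(\<Sum>c\<in>V. \<Sum>d\<in>V. P a d * P b c * G a b c d) = P a a * P b b + 2 * (P a b * P a b)"
      using idem2 ab by (simp add: 1)
    have 2: "(\<Sum>d\<in>V. P a c * P b d * G a b c d) = P a c * (2 * P a b * P b c + P a c * P b b)" if "c \<in> V" for c
    proof -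
      have "(\<Sum>d\<in>V. P a c * P b d * G a b c d) = P a c * (P a b * (\<Sum>d\<in>V. P b d * P c d) + (\<Sum>d\<in>V. P a d * P b d) * P b c + P a c * (\<Sum>d\<in>V. P b d * P b d))"
        unfolding G_def sum_distrib_left sum_distrib_right sum.distrib[symmetric] by (simp add: algebra_simps)
      then show ?thesis using idem2 that ab by (simp add: algebra_simps)
    qed
    have "(\<Sum>c\<in>V. P a c * (2 * P a b * P b c + P a c * P b b)) = 2 * P a b * (\<Sum>c\<in>V. P a c * P b c) + (\<Sum>c\<in>V. P a c * P a c) * P b b"
      unfolding sum_distrib_left sum_distrib_right sum.distrib[symmetric] by (simp add: algebra_simps)
    then show "(\<Sum>c\<in>V. \<Sum>d\<in>V. P a c * P b d * G a b c d) = P a a * P b b + 2 * (P a b * P a b)"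
      using idem2 ab by (simp add: 2)
  qed
  moreover have "(\<Sum>a\<in>V. \<Sum>b\<in>V. P a a * P b b + 2 * (P a b * P a b)) = ?d ^ 2 + 2 * ?d"
    using sq by (simp add: sum.distrib sum_distrib_left[symmetric] power2_eq_square sum_product)
  ultimately have G23: "(\<Sum>a\<in>V. \<Sum>b\<in>V. \<Sum>c\<in>V. \<Sum>d\<in>V. P a d * P b c * G a b c d) = ?d ^ 2 + 2 * ?d"
    "(\<Sum>a\<in>V. \<Sum>b\<in>V. \<Sum>c\<in>V. \<Sum>d\<in>V. P a c * P b d * G a b c d) = ?d ^ 2 + 2 * ?d"
    by simp_all
  have GG: "(\<Sum>a\<in>V. \<Sum>b\<in>V. \<Sum>c\<in>V. \<Sum>d\<in>V. G a b c d * G a b c d) = 3 * ?d ^ 2 + 6 * ?d"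
  proof -
    have "(\<Sum>a\<in>V. \<Sum>b\<in>V. \<Sum>c\<in>V. \<Sum>d\<in>V. G a b c d * G a b c d)
      = (\<Sum>a\<in>V. \<Sum>b\<in>V. \<Sum>c\<in>V. \<Sum>d\<in>V. P a b * P c d * G a b c d + P a d * P b c * G a b c d + P a c * P b d * G a b c d)"
      by (simp add: G_def distrib_right)
    then show ?thesis using G1 G23 by (simp add: sum.distrib)
  qed
  \<comment> \<open>The hypothesis \<open>total\<close> is the expansion of this sum of squares:
    \<open>SS\<close> minus \<open>2 * k\<close> times \<open>SG\<close> plus \<open>k ^ 2\<close>
    times \<open>GG\<close>.\<close>
  have "(\<Sum>a\<in>V. \<Sum>b\<in>V. \<Sum>c\<in>V. \<Sum>d\<in>V. (S a b c d - k * G a b c d)\<^sup>2)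
      = (\<Sum>a\<in>V. \<Sum>b\<in>V. \<Sum>c\<in>V. \<Sum>d\<in>V. S a b c d * S a b c d + (- 2 * k) * (S a b c d * G a b c d) + k ^ 2 * (G a b c d * G a b c d))"
    by (intro sum.cong refl) (simp add: power2_eq_square algebra_simps)
  also have "\<dots> = 0"
    using total by (simp only: sum.distrib sum_distrib_left[symmetric] SS SG GG)
  finally have "(\<Sum>a\<in>V. \<Sum>b\<in>V. \<Sum>c\<in>V. \<Sum>d\<in>V. (S a b c d - k * G a b c d)\<^sup>2) = 0" .
  then have "(S a b c d - k * G a b c d)\<^sup>2 = 0"
    using fin abcd by (simp add: sum_nonneg_eq_0_iff sum_nonneg)
  then show ?thesis by (simp add: S_def G_def)
qed

lemma (in magic_unitary) McLaughlin_commute: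
  assumes srg: "strongly_regular V E 275 112 30 56"
    and x: "x \<in> V" "y \<in> V" "a \<in> V" "b \<in> V"
  shows "U x a * U y b = U y b * U x a"
proof -
  have E: "symp E" "irreflp E" and card: "card V = 275"
    and deg: "\<And>a. a \<in> V \<Longrightarrow> card {z\<in>V. E a z} = 112"
    and lam: "\<And>a b. a \<in> V \<Longrightarrow> b \<in> V \<Longrightarrow> E a b \<Longrightarrow> card {z\<in>V. E a z \<and> E b z} = 30"
    and mu: "\<And>a b. a \<in> V \<Longrightarrow> b \<in> V \<Longrightarrow> a \<noteq> b \<Longrightarrow> \<not> E a b \<Longrightarrow> card {z\<in>V. E a z \<and> E b z} = 56"
    using srg by (auto simp: strongly_regular_def simple_graph_def)
  \<comment> \<open>The adjacency matrix has the eigenvalues 112, 2 and -28, the last with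
    multiplicity 22. The projection onto its eigenspace has the diagonal value 22/275 = 2/25; the
    values at edges and nonedges are this number times -28/112 and 27/162.\<close>
  define h :: "bool \<Rightarrow> bool \<Rightarrow> real" where "h eq e = (if eq then 2/25 else if e then -1/50 else 1/75)" for eq e
  define P where "P a b = h (a = b) (E a b)" for a b
  have sym: "E a b \<longleftrightarrow> E b a" for a b using E by (auto dest: sympD)
  have P: "P a b = 1/75 + 1/15 * of_bool (a = b) - 1/30 * of_bool (E a b)" for a b
    using E by (auto simp: P_def h_def irreflp_def)
  have P4: "P a b ^ 4 = 1/31640625 + (16/390625 - 1/31640625) * of_bool (a = b) + (1/6250000 - 1/31640625) * of_bool (E a b)" for a b
    using E by (auto simp: P_def h_def irreflp_def power4_eq_xxxx)
  have count: "(\<Sum>z\<in>V. of_bool (Q z)) = real (card {z\<in>V. Q z})" for Q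
    using finite_V by (simp add: of_bool_def sum.If_cases Int_def)
  have delta: "(\<Sum>z\<in>V. of_bool (a = z) * f z) = f a" "(\<Sum>z\<in>V. of_bool (z = a) * f z) = f a"
    if "a \<in> V" for a and f :: "'v \<Rightarrow> real"
    using that finite_V by (simp_all add: of_bool_def if_distrib[of "\<lambda>r. r * _"] cong: if_cong)
  have delta1: "(\<Sum>z\<in>V. of_bool (a = z)) = (1::real)" "(\<Sum>z\<in>V. of_bool (z = a)) = (1::real)" if "a \<in> V" for a
    using delta[OF that, of "\<lambda>_. 1"] by simp_all
  have degr: "(\<Sum>z\<in>V. of_bool (E a z)) = (112::real)" "(\<Sum>z\<in>V. of_bool (E z a)) = (112::real)" if "a \<in> V" for a
    using deg[OF that] sym[of _ a] by (simp_all add: count)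
  have common: "(\<Sum>z\<in>V. of_bool (E a z) * of_bool (E z b)) = (56 + 56 * of_bool (a = b) - 26 * of_bool (E a b) :: real)"
    if "a \<in> V" "b \<in> V" for a b
  proof -
    have "(\<Sum>z\<in>V. of_bool (E a z) * of_bool (E z b)) = (\<Sum>z\<in>V. of_bool (E a z \<and> E b z) :: real)"
      using sym by (intro sum.cong) auto
    also have "\<dots> = 56 + 56 * of_bool (a = b) - 26 * of_bool (E a b)"
      unfolding count using deg lam mu that E by (cases "a = b"; cases "E a b") (auto simp: irreflp_def)
    finally show ?thesis .
  qed
  have idem: "(\<Sum>c\<in>V. P a c * P c b) = P a b" if "a \<in> V" "b \<in> V" for a b
  proof -
    have "(\<Sum>c\<in>V. P a c * P c b) = (\<Sum>c\<in>V. (1/75)\<^sup>2 + 1/75 * (1/15) * (of_bool (a = c) + of_bool (c = b))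
        - 1/75 * (1/30) * (of_bool (E a c) + of_bool (E c b)) + (1/15)\<^sup>2 * (of_bool (a = c) * of_bool (c = b))
        - 1/15 * (1/30) * (of_bool (a = c) * of_bool (E c b) + of_bool (c = b) * of_bool (E a c))
        + (1/30)\<^sup>2 * (of_bool (E a c) * of_bool (E c b)))"
      unfolding P by (intro sum.cong refl) (simp add: power2_eq_square algebra_simps)
    also have "\<dots> = 1/75 + 1/15 * of_bool (a = b) - 1/30 * of_bool (E a b)"
      using that by (simp only: sum.distrib sum_subtractf sum_distrib_left[symmetric] delta delta1 degr common sum_constant card)
        (simp add: power2_eq_square)
    finally show ?thesis unfolding P .
  qed
  have tr: "(\<Sum>z\<in>V. P z z) = 22" "(\<Sum>z\<in>V. P z z ^ 2) = 275 * (2/25)^2"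
    using card by (simp_all add: P_def h_def)
  have fourth: "(\<Sum>z\<in>V. \<Sum>w\<in>V. P z w ^ 4) = 275 * (275/31640625 + (16/390625 - 1/31640625) + 112 * (1/6250000 - 1/31640625))"
  proof -
    have "(\<Sum>z\<in>V. \<Sum>w\<in>V. P z w ^ 4) = (\<Sum>z\<in>V. 275/31640625 + (16/390625 - 1/31640625) + 112 * (1/6250000 - 1/31640625))"
      unfolding P4 by (intro sum.cong refl)
        (simp only: sum.distrib sum_distrib_left[symmetric] delta1 degr sum_constant card, simp)
    then show ?thesis using card by simp
  qed
  \<comment> \<open>The constant is 275 * (2/25)^2 / (22 * 24), the fourth-moment factor of 275
    vectors of squared norm 2/25 forming a 4-design in dimension 22.\<close>
  have "(\<Sum>z\<in>V. P a z * P b z * (P c z * P d z)) = 1/300 * (P a b * P c d + P a d * P b c + P a c * P b d)"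
    if "a \<in> V" "b \<in> V" "c \<in> V" "d \<in> V" for a b c d
    using finite_V _ idem _ that
  proof (rule quartic_identity)
    show "P a b = P b a" for a b using sym by (auto simp: P)
    next
    show "(\<Sum>z\<in>V. \<Sum>w\<in>V. P z w ^ 4) - 6 * (1/300) * (\<Sum>z\<in>V. P z z ^ 2)
        + (1/300) ^ 2 * (3 * (\<Sum>z\<in>V. P z z) ^ 2 + 6 * (\<Sum>z\<in>V. P z z)) = 0"
      unfolding tr fourth by (simp add: power2_eq_square)
  qed
  then show ?thesis
    using commute_of_quartic[OF E, of h "1/300"] x by (simp add: P_def h_def)
qed

section \<open>The quadratic form\<close>

lemma F3_two: "(2::3) = - 1" by simp

lemma F3_three: "(3::3) = 0" by simp

lemma F3_square: "c \<noteq> 0 \<Longrightarrow> c * c = 1" for c :: 3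
  using F3_cases[of c] by auto

lemma F3_square': "c \<noteq> 0 \<Longrightarrow> c * (c * a) = a" for c :: 3
  by (simp add: F3_square mult.assoc[symmetric])

lemma F3_mult_eq_0: "a * b = 0 \<longleftrightarrow> a = 0 \<or> b = 0" for a b :: 3
  using F3_cases[of a] F3_cases[of b] by auto

lemma index6_cases: "i = 0 \<or> i = 1 \<or> i = 2 \<or> i = 3 \<or> i = 4 \<or> i = 5" for i :: 6
proof (cases i rule: bit0_cases)
  case (of_int z)
  then have "z = 0 \<or> z = 1 \<or> z = 2 \<or> z = 3 \<or> z = 4 \<or> z = 5" by auto
  then show ?thesis using of_int by auto
qed

lemma smult_minus_one: "(- 1) *s v = - v" for v :: "'a::ring_1 ^ 'n"
  by (simp add: vec_eq_iff)

lemma smult_minus_left: "(- c) *s v = - (c *s v)" for v :: "'a::ring_1 ^ 'n"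
  by (simp add: vec_eq_iff)

text \<open>The polar form. Since 2 = -1 in the field, the anisotropic part enters it with a minus
  sign, and \<open>bf v v = - Q_minus v\<close>, so that a vector is isotropic for \<open>bf\<close>
  exactly when its value under the form is 0.\<close>

definition bf :: "3^6 \<Rightarrow> 3^6 \<Rightarrow> 3" where
  "bf v w = Q_minus (v + w) - Q_minus v - Q_minus w"

lemma bf_eq: "bf v w = v$0 * w$1 + v$1 * w$0 + v$2 * w$3 + v$3 * w$2 - (v$4 * w$4 + v$5 * w$5)"
proof -
  have "bf v w = v$0 * w$1 + v$1 * w$0 + v$2 * w$3 + v$3 * w$2 + 2 * (v$4 * w$4 + v$5 * w$5)"
    by (simp add: bf_def Q_minus_def power2_eq_square algebra_simps)
  then show ?thesis by (simp add: F3_two)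
qed

lemma bf_add_left: "bf (v + v') w = bf v w + bf v' w"
  and bf_add_right: "bf w (v + v') = bf w v + bf w v'"
  and bf_smult_left: "bf (c *s v) w = c * bf v w"
  and bf_smult_right: "bf w (c *s v) = c * bf w v"
  by (simp_all add: bf_eq algebra_simps)

lemma bf_diff_left: "bf (v - v') w = bf v w - bf v' w"
  and bf_diff_right: "bf w (v - v') = bf w v - bf w v'"
  and bf_minus_left: "bf (- v) w = - bf v w"
  and bf_minus_right: "bf w (- v) = - bf w v"
  and bf_zero_left: "bf 0 w = 0"
  and bf_zero_right: "bf w 0 = 0"
  by (simp_all add: bf_eq algebra_simps)

lemma bf_commute: "bf v w = bf w v"
  by (simp add: bf_eq algebra_simps)

lemmas bf_simps = bf_add_left bf_add_right bf_smult_left bf_smult_right bf_diff_left bf_diff_right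
  bf_minus_left bf_minus_right bf_zero_left bf_zero_right

lemma Q_add: "Q_minus (v + w) = Q_minus v + Q_minus w + bf v w"
  by (simp add: bf_def)

lemma Q_smult: "Q_minus (c *s v) = c * c * Q_minus v"
  by (simp add: Q_minus_def power2_eq_square algebra_simps)

lemma Q_minus_uminus: "Q_minus (- v) = Q_minus v"
  by (simp add: Q_minus_def power2_eq_square)

lemma Q_diff: "Q_minus (v - w) = Q_minus v + Q_minus w - bf v w"
  using Q_add[of v "- w"] by (simp add: Q_minus_uminus bf_simps)

lemma Q_zero: "Q_minus 0 = 0"
  by (simp add: Q_minus_def)

lemma bf_self: "bf v v = - Q_minus v"
proof -
  have "bf v v = 2 * Q_minus v"
    by (simp add: bf_eq Q_minus_def power2_eq_square algebra_simps F3_two[symmetric] F3_three)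
  then show ?thesis by (simp add: F3_two)
qed

lemma bf_nondegenerate:
  assumes "\<And>w. bf v w = 0"
  shows "v = 0"
proof -
  have "v $ i = 0" for i
    using index6_cases[of i] assms[of "axis 0 1"] assms[of "axis 1 1"] assms[of "axis 2 1"]
      assms[of "axis 3 1"] assms[of "axis 4 1"] assms[of "axis 5 1"]
    by (auto simp: bf_eq axis_def)
  then show ?thesis by (simp add: vec_eq_iff)
qed

section \<open>Counting\<close>

definition perp :: "(3^6) set \<Rightarrow> (3^6) set" where
  "perp D = {v. \<forall>d\<in>D. bf v d = 0}"

lemma perp_insert: "v \<in> perp (insert d D) \<longleftrightarrow> bf v d = 0 \<and> v \<in> perp D"
  by (auto simp: perp_def)

lemma perp_add: "v \<in> perp D \<Longrightarrow> w \<in> perp D \<Longrightarrow> v + w \<in> perp D"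
  and perp_diff: "v \<in> perp D \<Longrightarrow> w \<in> perp D \<Longrightarrow> v - w \<in> perp D"
  and perp_smult: "v \<in> perp D \<Longrightarrow> c *s v \<in> perp D"
  and perp_minus: "v \<in> perp D \<Longrightarrow> - v \<in> perp D"
  and perp_zero: "0 \<in> perp D"
  by (simp_all add: perp_def bf_simps)

definition nQ :: "(3^6) set \<Rightarrow> 3 \<Rightarrow> nat" where
  "nQ D r = card {v \<in> perp D. Q_minus v = r}"

lemma nQ_sum: "nQ D r = (\<Sum>v\<in>perp D. of_bool (Q_minus v = r))"
  by (simp add: nQ_def of_bool_def sum.If_cases Int_def)

lemma UNIV_3: "(UNIV :: 3 set) = {0, 1, - 1}"
  using F3_cases by auto

lemma F3_distinct: "(0::3) \<noteq> 1" "(0::3) \<noteq> - 1" "(1::3) \<noteq> - 1" "(1::3) \<noteq> 0" "(- 1::3) \<noteq> 0" "(- 1::3) \<noteq> 1"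
  by simp_all

lemma sum_F3: "(\<Sum>c\<in>UNIV. f c) = f 0 + f 1 + f (- 1)" for f :: "3 \<Rightarrow> 'a::comm_monoid_add"
  unfolding UNIV_3 using F3_distinct by (simp add: add.assoc)

text \<open>The hyperbolic plane of \<open>e\<close> and \<open>f\<close> splits off orthogonally.
  As \<open>bf e f = 1\<close>, the coordinate at \<open>e\<close> is the product with
  \<open>f\<close>, and conversely.\<close>

lemma hyperbolic_decomposition:
  assumes e: "e \<in> perp D" "f \<in> perp D" "Q_minus e = 0" "Q_minus f = 0" "bf e f = 1"
  shows "bij_betw (\<lambda>((a, b), w). a *s e + b *s f + w) (UNIV \<times> perp (insert e (insert f D))) (perp D)"
proof (rule bij_betw_byWitness[where f' = "\<lambda>v. ((bf v f, bf v e), v - bf v f *s e - bf v e *s f)"])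
  have e': "bf e e = 0" "bf f f = 0" "bf f e = 1"
    using e by (simp_all add: bf_self bf_commute[of f e])
  show "\<forall>x\<in>UNIV \<times> perp (insert e (insert f D)). (\<lambda>v. ((bf v f, bf v e), v - bf v f *s e - bf v e *s f)) ((\<lambda>((a, b), w). a *s e + b *s f + w) x) = x"
    using e e' by (auto simp: perp_insert bf_simps)
  show "\<forall>v\<in>perp D. (\<lambda>((a, b), w). a *s e + b *s f + w) ((bf v f, bf v e), v - bf v f *s e - bf v e *s f) = v"
    by simp
  show "(\<lambda>((a, b), w). a *s e + b *s f + w) ` (UNIV \<times> perp (insert e (insert f D))) \<subseteq> perp D"
    using e by (auto simp: perp_insert intro!: perp_add perp_smult)
  show "(\<lambda>v. ((bf v f, bf v e), v - bf v f *s e - bf v e *s f)) ` perp D \<subseteq> UNIV \<times> perp (insert e (insert f D))"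
    using e e' by (auto simp: perp_insert bf_simps perp_diff perp_smult)
qed

text \<open>On the hyperbolic plane the form is \<open>a * b\<close>, which takes the value 0 five
  times and each nonzero value twice. The weights 5, 2, 2 are written as 3 at \<open>r\<close> plus
  2 everywhere, which makes the system easy to solve in either direction.\<close>

lemma nQ_hyperbolic:
  assumes e: "e \<in> perp D" "f \<in> perp D" "Q_minus e = 0" "Q_minus f = 0" "bf e f = 1"
  shows "nQ D r = 3 * nQ (insert e (insert f D)) r + 2 * (nQ (insert e (insert f D)) 0 + nQ (insert e (insert f D)) 1 + nQ (insert e (insert f D)) (- 1))"
proof -
  let ?D = "insert e (insert f D)"
  let ?g = "\<lambda>((a, b), w). a *s e + b *s f + w"
  have Q: "Q_minus (a *s e + b *s f + w) = Q_minus w + a * b" if "w \<in> perp ?D" for a b w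
    using e that by (simp add: perp_insert Q_add Q_smult bf_simps bf_commute[of _ w])
  have "nQ D r = (\<Sum>v\<in>perp D. of_bool (Q_minus v = r))"
    by (simp add: nQ_sum)
  also have "\<dots> = (\<Sum>x\<in>UNIV \<times> perp ?D. of_bool (Q_minus (?g x) = r))"
    by (rule sum.reindex_bij_betw[OF hyperbolic_decomposition[OF e], symmetric])
  also have "\<dots> = (\<Sum>p\<in>UNIV. \<Sum>w\<in>perp ?D. of_bool (Q_minus (?g (p, w)) = r))"
    unfolding sum.cartesian_product by (intro sum.cong refl) auto
  also have "\<dots> = (\<Sum>p\<in>UNIV \<times> UNIV. \<Sum>w\<in>perp ?D. of_bool (Q_minus w = r - fst p * snd p))"
    unfolding UNIV_Times_UNIV by (intro sum.cong refl) (auto simp: Q eq_diff_eq split: prod.splits)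
  also have "\<dots> = (\<Sum>a\<in>UNIV. \<Sum>b\<in>UNIV. nQ ?D (r - a * b))"
    unfolding sum.cartesian_product' nQ_sum by (simp only: fst_conv snd_conv)
  also have "\<dots> = 5 * nQ ?D r + 2 * nQ ?D (r - 1) + 2 * nQ ?D (r + 1)"
    by (simp add: sum_F3)
  finally show ?thesis
    using F3_cases[of r] by (auto simp: F3_two)
qed

definition standard_vec :: "3 \<Rightarrow> 3 \<Rightarrow> 3^6" where
  "standard_vec a b = (\<chi> i. if i = 4 then a else if i = 5 then b else 0)"

lemma nQ_standard:
  "nQ {axis 0 1, axis 1 1, axis 2 1, axis 3 1} r = (if r = 0 then 1 else 4)"
proof -
  let ?D = "{axis 0 1, axis 1 1, axis 2 1, axis 3 1} :: (3^6) set"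
  have perp: "v \<in> perp ?D \<longleftrightarrow> v = standard_vec (v $ 4) (v $ 5)" for v
  proof -
    have "v \<in> perp ?D \<longleftrightarrow> v $ 0 = 0 \<and> v $ 1 = 0 \<and> v $ 2 = 0 \<and> v $ 3 = 0"
      by (auto simp: perp_def bf_eq axis_def)
    also have "\<dots> \<longleftrightarrow> v = standard_vec (v $ 4) (v $ 5)"
    proof
      assume v: "v $ 0 = 0 \<and> v $ 1 = 0 \<and> v $ 2 = 0 \<and> v $ 3 = 0"
      show "v = standard_vec (v $ 4) (v $ 5)"
        unfolding vec_eq_iff
      proof
        fix i show "v $ i = standard_vec (v $ 4) (v $ 5) $ i"
          using index6_cases[of i] v by (auto simp: standard_vec_def)
      qed
    next
      assume *: "v = standard_vec (v $ 4) (v $ 5)"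
      show "v $ 0 = 0 \<and> v $ 1 = 0 \<and> v $ 2 = 0 \<and> v $ 3 = 0"
        by (subst *, subst *, subst *, subst *) (simp add: standard_vec_def)
    qed
    finally show ?thesis .
  qed
  have comp: "standard_vec a b $ 4 = a" "standard_vec a b $ 5 = b" "Q_minus (standard_vec a b) = a * a + b * b" for a b
    by (simp_all add: standard_vec_def Q_minus_def power2_eq_square)
  have "{v \<in> perp ?D. Q_minus v = r} = (\<lambda>(a, b). standard_vec a b) ` {p. fst p * fst p + snd p * snd p = r}"
  proof (intro equalityI subsetI)
    fix v assume "v \<in> {v \<in> perp ?D. Q_minus v = r}"
    then show "v \<in> (\<lambda>(a, b). standard_vec a b) ` {p. fst p * fst p + snd p * snd p = r}"
      using perp[of v] comp(3)[of "v $ 4" "v $ 5"] by (intro image_eqI[of _ _ "(v $ 4, v $ 5)"]) auto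
  qed (auto simp: perp comp)
  moreover have "inj (\<lambda>(a, b). standard_vec a b)"
  proof (rule injI)
    fix p q :: "3 \<times> 3" assume "(\<lambda>(a, b). standard_vec a b) p = (\<lambda>(a, b). standard_vec a b) q"
    then have "standard_vec (fst p) (snd p) = standard_vec (fst q) (snd q)" by (simp add: case_prod_beta)
    from arg_cong[OF this, of "\<lambda>v. v $ 4"] arg_cong[OF this, of "\<lambda>v. v $ 5"]
    show "p = q" by (simp add: comp prod_eq_iff)
  qed
  ultimately have "nQ ?D r = card {p :: 3 \<times> 3. fst p * fst p + snd p * snd p = r}"
    unfolding nQ_def by (simp add: card_image inj_on_subset[OF _ subset_UNIV])
  also have "\<dots> = (\<Sum>p\<in>UNIV \<times> UNIV. of_bool (fst p * fst p + snd p * snd p = r))"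
    unfolding UNIV_Times_UNIV by (simp add: of_bool_def sum.If_cases)
  also have "\<dots> = (\<Sum>a\<in>UNIV. \<Sum>b\<in>UNIV. of_bool (a * a + b * b = r))"
    unfolding sum.cartesian_product' by (simp only: fst_conv snd_conv)
  also have "\<dots> = (if r = 0 then 1 else 4)"
    using F3_cases[of r] by (auto simp: sum_F3 F3_two)
  finally show ?thesis .
qed

lemma nQ_whole: "nQ {} r = (if r = 0 then 225 else 252)"
proof -
  let ?e = "axis 0 1 :: 3^6" and ?f = "axis 1 1 :: 3^6" and ?g = "axis 2 1 :: 3^6" and ?h = "axis 3 1 :: 3^6"
  have "nQ (insert ?g (insert ?h {?e, ?f})) r = (if r = 0 then 1 else 4)" for r
    using nQ_standard[of r] by (simp add: insert_commute)
  moreover have "nQ {?e, ?f} r = 3 * nQ (insert ?g (insert ?h {?e, ?f})) r + 2 * (nQ (insert ?g (insert ?h {?e, ?f})) 0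
      + nQ (insert ?g (insert ?h {?e, ?f})) 1 + nQ (insert ?g (insert ?h {?e, ?f})) (- 1))" for r
    by (rule nQ_hyperbolic) (simp_all add: perp_def bf_eq Q_minus_def axis_def)
  moreover have "nQ {} r = 3 * nQ {?e, ?f} r + 2 * (nQ {?e, ?f} 0 + nQ {?e, ?f} 1 + nQ {?e, ?f} (- 1))"
    by (rule nQ_hyperbolic) (simp_all add: perp_def bf_eq Q_minus_def axis_def)
  ultimately show ?thesis by simp
qed

lemma perp_pair_smult: "c \<noteq> 0 \<Longrightarrow> perp {e, c *s f} = perp {e, f}"
  by (auto simp: perp_def bf_simps F3_mult_eq_0)

text \<open>The recursion is read backwards: the counts of the whole space determine those of the
  complement of an arbitrary hyperbolic pair. Rescaling \<open>f\<close> normalises the product to 1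
  and keeps the complement.\<close>

lemma nQ_pair:
  assumes "Q_minus e = 0" "Q_minus f = 0" "bf e f \<noteq> 0"
  shows "nQ {e, f} r = (if r = 0 then 21 else 30)"
proof -
  define h where "h = bf e f *s f"
  have h: "Q_minus h = 0" "bf e h = 1" "perp {e, h} = perp {e, f}"
    using assms by (simp_all add: h_def Q_smult bf_simps F3_square perp_pair_smult)
  have "nQ {} r = 3 * nQ {e, h} r + 2 * (nQ {e, h} 0 + nQ {e, h} 1 + nQ {e, h} (- 1))" for r
    by (rule nQ_hyperbolic) (use assms h in \<open>simp_all add: perp_def\<close>)
  from this[of r] this[of 0] this[of 1] this[of "- 1"] F3_cases[of r]
  have "nQ {e, h} r = (if r = 0 then 21 else 30)" by (auto simp: nQ_whole)
  then show ?thesis by (simp add: nQ_def h(3))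
qed

lemma nQ_two_pairs:
  assumes "Q_minus e = 0" "Q_minus f = 0" "bf e f \<noteq> 0"
    and "g \<in> perp {e, f}" "h \<in> perp {e, f}" "Q_minus g = 0" "Q_minus h = 0" "bf g h = 1"
  shows "nQ {g, h, e, f} r = (if r = 0 then 1 else 4)"
proof -
  have "nQ {e, f} r = 3 * nQ {g, h, e, f} r + 2 * (nQ {g, h, e, f} 0 + nQ {g, h, e, f} 1 + nQ {g, h, e, f} (- 1))" for r
    by (rule nQ_hyperbolic) (use assms in simp_all)
  from this[of r] this[of 0] this[of 1] this[of "- 1"] F3_cases[of r]
  show ?thesis by (auto simp: nQ_pair[OF assms(1-3)])
qed

lemma card_perp: "card (perp D) = nQ D 0 + nQ D 1 + nQ D (- 1)"
proof -
  have "perp D = {v \<in> perp D. Q_minus v = 0} \<union> {v \<in> perp D. Q_minus v = 1} \<union> {v \<in> perp D. Q_minus v = - 1}"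
    using F3_cases by blast
  moreover have "card \<dots> = nQ D 0 + nQ D 1 + nQ D (- 1)"
    unfolding nQ_def by (subst card_Un_disjoint, simp, simp, force)+ simp
  ultimately show ?thesis by simp
qed

lemma perp_anisotropic:
  assumes "Q_minus e = 0" "Q_minus f = 0" "bf e f \<noteq> 0"
    and "g \<in> perp {e, f}" "h \<in> perp {e, f}" "Q_minus g = 0" "Q_minus h = 0" "bf g h = 1"
    and "v \<in> perp {g, h, e, f}" "Q_minus v = 0"
  shows "v = 0"
proof -
  define S where "S = {v \<in> perp {g, h, e, f}. Q_minus v = 0}"
  have "card S = 1"
    using nQ_two_pairs[OF assms(1-8), of 0] by (simp add: nQ_def S_def)
  then obtain x where "S = {x}" by (rule card_1_singletonE)
  moreover have "0 \<in> S" "v \<in> S"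
    using assms(9,10) by (simp_all add: S_def perp_zero Q_zero)
  ultimately show ?thesis by blast
qed

text \<open>A vector not orthogonal to \<open>g\<close> is projected into the complement and scaled
  to have product 1 with \<open>g\<close>. Subtracting a multiple of the singular vector
  \<open>g\<close> then shifts its value under the form to 0.\<close>

lemma hyperbolic_partner:
  assumes e: "Q_minus e = 0" "Q_minus f = 0" "bf e f \<noteq> 0"
    and g: "g \<in> perp {e, f}" "Q_minus g = 0" "g \<noteq> 0"
  obtains h where "h \<in> perp {e, f}" "Q_minus h = 0" "bf g h = 1"
proof -
  obtain t where t: "bf g t \<noteq> 0" using bf_nondegenerate g(3) by blast
  define d where "d = bf e f"
  have d: "d * d = 1" using e(3) by (simp add: d_def F3_square)
  have bb: "bf e e = 0" "bf f f = 0" "bf f e = d" "bf e f = d" "bf g e = 0" "bf g f = 0"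
    using e g by (simp_all add: bf_self d_def bf_commute[of f e] perp_def)
  define t1 where "t1 = bf g t *s (t - (d * bf t f) *s e - (d * bf t e) *s f)"
  have gt: "bf g t1 = 1"
    using t by (simp add: t1_def bf_simps bb F3_square)
  have t1: "t1 \<in> perp {e, f}"
    by (simp add: t1_def perp_def bf_simps bb)
       (simp add: algebra_simps d mult.assoc[symmetric, of d d])
  define h where "h = t1 - Q_minus t1 *s g"
  have "h \<in> perp {e, f}" unfolding h_def by (intro perp_diff perp_smult t1 g)
  moreover have "Q_minus h = 0"
    using g gt by (simp add: h_def Q_diff Q_smult bf_simps bf_commute[of t1 g])
  moreover have "bf g h = 1"
    using g gt by (simp add: h_def bf_simps bf_self)
  ultimately show ?thesis using that by blast
qed

text \<open>The complement of a hyperbolic pair has Witt index 1: after subtraction of its component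
  along \<open>g\<close>, the vector \<open>v\<close> lies in the anisotropic complement of a second
  pair.\<close>

lemma singular_orthogonal_proportional:
  assumes e: "Q_minus e = 0" "Q_minus f = 0" "bf e f \<noteq> 0"
    and g: "g \<in> perp {e, f}" "Q_minus g = 0" "g \<noteq> 0"
    and v: "v \<in> perp {e, f}" "Q_minus v = 0" "bf g v = 0"
  shows "\<exists>c. v = c *s g"
proof -
  obtain h where h: "h \<in> perp {e, f}" "Q_minus h = 0" "bf g h = 1"
    using hyperbolic_partner[OF e g] .
  have "v - bf v h *s g = 0"
  proof (rule perp_anisotropic[OF e g(1) h(1) g(2) h(2,3)])
    show "v - bf v h *s g \<in> perp {g, h, e, f}"
      using g v h perp_diff[OF v(1) perp_smult[OF g(1)]]
      by (simp add: perp_insert bf_simps bf_self bf_commute[of v g])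
    show "Q_minus (v - bf v h *s g) = 0"
      using g v by (simp add: Q_diff Q_smult bf_simps bf_commute[of v g])
  qed
  then show ?thesis by (metis eq_iff_diff_eq_0)
qed

text \<open>The two products fix the component \<open>c\<close> in the span of \<open>g\<close> and
  \<open>h\<close>. The rest lies in the anisotropic plane and must take the nonzero value
  \<open>- Q_minus c\<close>, which is attained four times.\<close>

lemma card_singular_with_two_products:
  assumes e: "Q_minus e = 0" "Q_minus f = 0" "bf e f \<noteq> 0"
    and g: "g \<in> perp {e, f}" "Q_minus g = 0" and h: "h \<in> perp {e, f}" "Q_minus h = 0" "bf g h \<noteq> 0"
    and r: "r \<noteq> 0" "t \<noteq> 0"
  shows "card {s \<in> perp {e, f}. Q_minus s = 0 \<and> bf s g = r \<and> bf s h = t} = 4"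
proof -
  define d where "d = bf g h"
  have d: "d * d = 1" "d * (d * a) = a" for a using h(3) by (simp_all add: d_def F3_square mult.assoc[symmetric])
  have bb: "bf g g = 0" "bf h h = 0" "bf h g = d" "bf g h = d"
    using g h by (simp_all add: bf_self d_def bf_commute[of h g])
  define k where "k = d *s h"
  have k: "k \<in> perp {e, f}" "Q_minus k = 0" "bf g k = 1"
    using h d by (simp_all add: k_def perp_smult Q_smult bf_simps bb)
  have perp: "perp {g, k, e, f} = {v \<in> perp {e, f}. bf v g = 0 \<and> bf v h = 0}"
    using h(3) by (auto simp: perp_insert k_def bf_simps F3_mult_eq_0 d_def)
  define c where "c = (t * d) *s g + (r * d) *s h"
  have c: "c \<in> perp {e, f}" "bf c g = r" "bf c h = t" "Q_minus c = r * t * d"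
    using g h by (simp_all add: c_def perp_add perp_smult bf_simps bb Q_add Q_smult mult_ac d)
  have "bij_betw (\<lambda>v. c + v) {v \<in> perp {g, k, e, f}. Q_minus v = - (r * t * d)}
      {s \<in> perp {e, f}. Q_minus s = 0 \<and> bf s g = r \<and> bf s h = t}"
  proof (rule bij_betw_byWitness[where f' = "\<lambda>s. s - c"])
    have cv: "bf c v = 0" if "bf v g = 0" "bf v h = 0" for v
      using that by (simp add: c_def bf_simps bf_commute[of _ v])
    show "(\<lambda>v. c + v) ` {v \<in> perp {g, k, e, f}. Q_minus v = - (r * t * d)}
        \<subseteq> {s \<in> perp {e, f}. Q_minus s = 0 \<and> bf s g = r \<and> bf s h = t}"
      using c by (auto simp: perp perp_add bf_add_left Q_add[of c] cv)
    show "(\<lambda>s. s - c) ` {s \<in> perp {e, f}. Q_minus s = 0 \<and> bf s g = r \<and> bf s h = t}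
        \<subseteq> {v \<in> perp {g, k, e, f}. Q_minus v = - (r * t * d)}"
    proof clarify
      fix s assume s: "s \<in> perp {e, f}" "Q_minus s = 0" "r = bf s g" "t = bf s h"
      have 1: "bf (s - c) g = 0" "bf (s - c) h = 0"
        using c s by (simp_all add: bf_diff_left)
      have "Q_minus (c + (s - c)) = Q_minus c + Q_minus (s - c)"
        unfolding Q_add[of c] using cv[OF 1] by simp
      then have "Q_minus (s - c) = - (r * t * d)"
        using s c(4) by (simp add: eq_neg_iff_add_eq_0 add.commute)
      then show "s - c \<in> perp {g, k, e, f} \<and> Q_minus (s - c) = - (bf s g * bf s h * d)"
        using 1 s c(1) by (simp add: perp perp_diff)
    qed
  qed auto
  then have "card {s \<in> perp {e, f}. Q_minus s = 0 \<and> bf s g = r \<and> bf s h = t} = nQ {g, k, e, f} (- (r * t * d))"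
    unfolding nQ_def by (rule bij_betw_same_card[symmetric])
  moreover have "r * t * d \<noteq> 0" using r h(3) by (simp add: F3_mult_eq_0 d_def)
  ultimately show ?thesis
    using nQ_two_pairs[OF e g(1) k(1) g(2) k(2,3)] by simp
qed

text \<open>Each of the nine vectors \<open>v\<close> of the anisotropic plane extends uniquely: the
  coefficient of the partner \<open>h\<close> is \<open>r\<close>, and singularity determines the
  coefficient of \<open>w\<close>.\<close>

lemma card_singular_with_product_singular:
  assumes e: "Q_minus e = 0" "Q_minus f = 0" "bf e f \<noteq> 0"
    and w: "w \<in> perp {e, f}" "Q_minus w = 0" "w \<noteq> 0" and r: "r \<noteq> 0"
  shows "card {s \<in> perp {e, f}. Q_minus s = 0 \<and> bf s w = r} = 9"
proof -
  obtain h where h: "h \<in> perp {e, f}" "Q_minus h = 0" "bf w h = 1"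
    using hyperbolic_partner[OF e w] .
  have bb: "bf w w = 0" "bf h h = 0" "bf h w = 1" using w h by (simp_all add: bf_self bf_commute[of h w])
  have rr: "r * r = 1" "r * (r * a) = a" for a using r by (simp_all add: F3_square mult.assoc[symmetric])
  have "bij_betw (\<lambda>v. (- r * Q_minus v) *s w + r *s h + v) (perp {w, h, e, f})
      {s \<in> perp {e, f}. Q_minus s = 0 \<and> bf s w = r}"
  proof (rule bij_betw_byWitness[where f' = "\<lambda>s. s - bf s h *s w - r *s h"])
    show "(\<lambda>v. (- r * Q_minus v) *s w + r *s h + v) ` perp {w, h, e, f} \<subseteq> {s \<in> perp {e, f}. Q_minus s = 0 \<and> bf s w = r}"
    proof clarify
      fix v assume v: "v \<in> perp {w, h, e, f}"
      then have v': "v \<in> perp {e, f}" "bf v w = 0" "bf v h = 0" "bf w v = 0" "bf h v = 0"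
        by (simp_all add: perp_insert[of _ w] perp_insert[of _ h] bf_commute[of w v] bf_commute[of h v])
      show "(- r * Q_minus v) *s w + r *s h + v \<in> perp {e, f} \<and> Q_minus ((- r * Q_minus v) *s w + r *s h + v) = 0
          \<and> bf ((- r * Q_minus v) *s w + r *s h + v) w = r"
        using w h v' bb by (simp add: perp_add perp_smult bf_simps Q_add Q_smult mult_ac rr)
    qed
    show "(\<lambda>s. s - bf s h *s w - r *s h) ` {s \<in> perp {e, f}. Q_minus s = 0 \<and> bf s w = r} \<subseteq> perp {w, h, e, f}"
      using w h bb by (auto simp: perp_insert[of _ w] perp_insert[of _ h] perp_diff perp_smult bf_simps)
    show "\<forall>v\<in>perp {w, h, e, f}. (\<lambda>s. s - bf s h *s w - r *s h) ((- r * Q_minus v) *s w + r *s h + v) = v"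
      using h bb by (auto simp: perp_insert[of _ w] perp_insert[of _ h] bf_simps)
    show "\<forall>s\<in>{s \<in> perp {e, f}. Q_minus s = 0 \<and> bf s w = r}. (\<lambda>v. (- r * Q_minus v) *s w + r *s h + v) (s - bf s h *s w - r *s h) = s"
    proof clarify
      fix s assume s: "s \<in> perp {e, f}" "Q_minus s = 0" "r = bf s w"
      have "Q_minus (s - bf s h *s w - r *s h) = - r * bf s h"
        using s w h bb by (simp add: Q_diff Q_smult bf_simps mult_ac)
      then show "(- bf s w * Q_minus (s - bf s h *s w - bf s w *s h)) *s w + bf s w *s h + (s - bf s h *s w - bf s w *s h) = s"
        using rr s by simp
    qed
  qed
  then show ?thesis
    using nQ_two_pairs[OF e w(1) h(1) w(2) h(2,3)] by (simp add: bij_betw_same_card[symmetric] card_perp)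
qed

text \<open>The line of \<open>w\<close> splits off orthogonally, and its vectors
  \<open>t *s w\<close> take the value 0 once and \<open>Q_minus w\<close> twice.\<close>

lemma nQ_nonsingular:
  assumes w: "w \<in> perp D" "Q_minus w \<noteq> 0"
  shows "nQ D r = nQ (insert w D) r + 2 * nQ (insert w D) (r - Q_minus w)"
proof -
  let ?p = "Q_minus w"
  have pp: "?p * ?p = 1" "?p * (?p * a) = a" for a using w by (simp_all add: F3_square mult.assoc[symmetric])
  have Q: "Q_minus (t *s w + y) = Q_minus y + t * t * ?p" if "y \<in> perp (insert w D)" for t y
    using that by (simp add: perp_insert Q_add Q_smult bf_simps bf_commute[of w])
  have bij: "bij_betw (\<lambda>(t, y). t *s w + y) (UNIV \<times> perp (insert w D)) (perp D)"
  proof (rule bij_betw_byWitness[where f' = "\<lambda>v. (- ?p * bf v w, v + (?p * bf v w) *s w)"])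
    show "(\<lambda>(t, y). t *s w + y) ` (UNIV \<times> perp (insert w D)) \<subseteq> perp D"
      using w by (auto simp: perp_insert perp_add perp_smult)
    show "(\<lambda>v. (- ?p * bf v w, v + (?p * bf v w) *s w)) ` perp D \<subseteq> UNIV \<times> perp (insert w D)"
      using w by (auto simp: perp_insert perp_add perp_smult bf_simps bf_self mult_ac pp)
    show "\<forall>x\<in>UNIV \<times> perp (insert w D). (\<lambda>v. (- ?p * bf v w, v + (?p * bf v w) *s w)) ((\<lambda>(t, y). t *s w + y) x) = x"
      by (auto simp: perp_insert bf_simps bf_self mult_ac pp smult_minus_left)
  qed (simp add: smult_minus_left)
  have "nQ D r = (\<Sum>v\<in>perp D. of_bool (Q_minus v = r))"
    by (simp add: nQ_sum)
  also have "\<dots> = (\<Sum>x\<in>UNIV \<times> perp (insert w D). of_bool (Q_minus ((\<lambda>(t, y). t *s w + y) x) = r))"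
    by (rule sum.reindex_bij_betw[OF bij, symmetric])
  also have "\<dots> = (\<Sum>t\<in>UNIV. \<Sum>y\<in>perp (insert w D). of_bool (Q_minus y = r - t * t * ?p))"
    unfolding sum.cartesian_product by (intro sum.cong refl) (auto simp: Q eq_diff_eq)
  finally show ?thesis unfolding nQ_sum[symmetric] by (simp add: sum_F3)
qed

lemma nQ_pair_nonsingular:
  assumes e: "Q_minus e = 0" "Q_minus f = 0" "bf e f \<noteq> 0" and w: "w \<in> perp {e, f}" "Q_minus w \<noteq> 0"
  shows "nQ {w, e, f} 0 = 9" "nQ {w, e, f} (- Q_minus w) = 6"
proof -
  let ?p = "Q_minus w"
  have *: "- ?p - ?p = ?p" "?p - ?p = 0" "0 - ?p = - ?p" using F3_cases[of ?p] by auto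
  have "nQ {e, f} r = nQ {w, e, f} r + 2 * nQ {w, e, f} (r - ?p)" for r
    by (rule nQ_nonsingular[OF w])
  \<comment> \<open>Three linear equations for three counts, with right-hand sides 21, 30 and 30;
    the count not recorded is 12, at the value \<open>Q_minus w\<close>.\<close>
  from this[of 0] this[of ?p] this[of "- ?p"] w(2)
  show "nQ {w, e, f} 0 = 9" "nQ {w, e, f} (- Q_minus w) = 6"
    unfolding * nQ_pair[OF e] by auto
qed

text \<open>The product with \<open>w\<close> fixes the component along \<open>w\<close>, which
  takes the value \<open>Q_minus w\<close>. The rest is orthogonal to \<open>w\<close> and takes the
  opposite value, for which there are six choices.\<close>

lemma card_singular_with_product_nonsingular:
  assumes e: "Q_minus e = 0" "Q_minus f = 0" "bf e f \<noteq> 0" and w: "w \<in> perp {e, f}" "Q_minus w \<noteq> 0" and r: "r \<noteq> 0"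
  shows "card {s \<in> perp {e, f}. Q_minus s = 0 \<and> bf s w = r} = 6"
proof -
  let ?p = "Q_minus w"
  have pp: "?p * ?p = 1" "?p * (?p * a) = a" "r * r = 1" for a using w r by (simp_all add: F3_square mult.assoc[symmetric])
  define c where "c = (- r * ?p) *s w"
  have c: "c \<in> perp {e, f}" "bf c w = r" "Q_minus c = ?p"
    using w pp by (simp_all add: c_def perp_smult bf_simps bf_self Q_smult mult_ac)
  have "bij_betw (\<lambda>v. c + v) {v \<in> perp {w, e, f}. Q_minus v = - ?p} {s \<in> perp {e, f}. Q_minus s = 0 \<and> bf s w = r}"
  proof (rule bij_betw_byWitness[where f' = "\<lambda>s. s - c"])
    have cv: "bf c v = 0" if "bf v w = 0" for v
      using that by (simp add: c_def bf_simps bf_commute[of _ v])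
    show "(\<lambda>v. c + v) ` {v \<in> perp {w, e, f}. Q_minus v = - ?p} \<subseteq> {s \<in> perp {e, f}. Q_minus s = 0 \<and> bf s w = r}"
      using c by (auto simp: perp_insert[of _ w] perp_add bf_add_left Q_add[of c] cv)
    show "(\<lambda>s. s - c) ` {s \<in> perp {e, f}. Q_minus s = 0 \<and> bf s w = r} \<subseteq> {v \<in> perp {w, e, f}. Q_minus v = - ?p}"
    proof clarify
      fix s assume s: "s \<in> perp {e, f}" "Q_minus s = 0" "r = bf s w"
      have 1: "bf (s - c) w = 0"
        using c s by (simp add: bf_diff_left)
      have "Q_minus (c + (s - c)) = Q_minus c + Q_minus (s - c)"
        unfolding Q_add[of c] using cv[OF 1] by simp
      then have "Q_minus (s - c) = - ?p"
        using s c(3) by (simp add: eq_neg_iff_add_eq_0 add.commute)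
      then show "s - c \<in> perp {w, e, f} \<and> Q_minus (s - c) = - ?p"
        using 1 s c(1) by (simp add: perp_insert[of _ w] perp_diff)
    qed
  qed auto
  from bij_betw_same_card[OF this] show ?thesis
    using nQ_pair_nonsingular(2)[OF e w] by (simp add: nQ_def)
qed

section \<open>Points and lines\<close>

abbreviation verts :: "(3^6) set set" where
  "verts \<equiv> O_minus_6_3_verts"

abbreviation adj :: "(3^6) set \<Rightarrow> (3^6) set \<Rightarrow> bool" where
  "adj \<equiv> O_minus_6_3_adj"

abbreviation singular :: "3^6 \<Rightarrow> bool" where
  "singular v \<equiv> v \<noteq> 0 \<and> Q_minus v = 0"

lemma vert_iff: "p \<in> verts \<longleftrightarrow> (\<exists>v. singular v \<and> p = proj_point v)"
  by (auto simp: O_minus_6_3_verts_def)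

lemma singular_vert: "singular v \<Longrightarrow> proj_point v \<in> verts"
  by (auto simp: vert_iff)

lemma proj_point_eq_iff:
  assumes "v \<noteq> 0"
  shows "proj_point v = proj_point w \<longleftrightarrow> w = v \<or> w = - v"
proof
  assume "proj_point v = proj_point w"
  from proj_point_eqD[OF this assms] show "w = v \<or> w = - v" by (auto simp: smult_minus_one)
next
  have "proj_point (- v) = proj_point v"
  proof -
    have "c *s (- v) = (- c) *s v" "c *s v = (- c) *s (- v)" for c :: 3
      by (simp_all add: vec_eq_iff)
    then show ?thesis
      unfolding proj_point_def by (intro equalityI image_subsetI) (blast intro: range_eqI)+
  qed
  then show "w = v \<or> w = - v \<Longrightarrow> proj_point v = proj_point w" by auto
qed

lemma proj_point_minus: "proj_point (- v) = proj_point v"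
  using proj_point_eq_iff[of v "- v"] by (cases "v = 0") auto

lemma neg_eq_iff: "- v = v \<longleftrightarrow> v = 0" for v :: "3^6"
proof
  assume "- v = v"
  then have "- (v $ i) = v $ i" for i by (simp add: vec_eq_iff)
  moreover have "- c = c \<Longrightarrow> c = 0" for c :: 3 using F3_cases[of c] by auto
  ultimately show "v = 0" by (simp add: vec_eq_iff)
qed simp

lemma adj_iff:
  assumes "singular v" "singular w"
  shows "adj (proj_point v) (proj_point w) \<longleftrightarrow> w \<noteq> v \<and> w \<noteq> - v \<and> bf v w = 0"
proof (cases "proj_point v = proj_point w")
  case True
  then show ?thesis using assms proj_point_eq_iff[of v w] by (auto simp: O_minus_6_3_adj_def)
next
  case False
  then show ?thesis
    using O_minus_6_3_adj_iff[of v w] assms proj_point_eq_iff[of v w] by (simp add: Q_add)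
qed

lemma nonadj_iff:
  assumes "singular v" "singular w"
  shows "proj_point v \<noteq> proj_point w \<and> \<not> adj (proj_point v) (proj_point w) \<longleftrightarrow> bf v w \<noteq> 0"
  using assms by (auto simp: adj_iff proj_point_eq_iff bf_simps bf_self)

lemma adj_sym: "adj p q \<longleftrightarrow> adj q p"
proof -
  have "adj q p" if "adj p q" for p q
  proof -
    from that obtain v w where "singular v" "p = proj_point v" "singular w" "q = proj_point w"
      by (auto simp: O_minus_6_3_adj_def vert_iff)
    with that show ?thesis by (auto simp: adj_iff bf_commute)
  qed
  then show ?thesis by blast
qed

lemma adj_irrefl: "\<not> adj p p"
  by (simp add: O_minus_6_3_adj_def)

lemma adj_verts: "adj p q \<Longrightarrow> p \<in> verts \<and> q \<in> verts"
  by (simp add: O_minus_6_3_adj_def)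

lemma finite_verts: "finite verts"
  by simp

text \<open>Every point has exactly two representatives, \<open>v\<close> and
  \<open>- v\<close>.\<close>

lemma sum_proj_point:
  fixes F :: "(3^6) set \<Rightarrow> 'b::real_vector"
  assumes "0 \<notin> A" "\<And>v. v \<in> A \<Longrightarrow> - v \<in> A"
  shows "(\<Sum>v\<in>A. F (proj_point v)) = 2 *\<^sub>R (\<Sum>p\<in>proj_point ` A. F p)"
proof -
  have "(\<Sum>v\<in>A. F (proj_point v)) = (\<Sum>p\<in>proj_point ` A. \<Sum>v\<in>{v \<in> A. proj_point v = p}. F (proj_point v))"
    by (rule sum.image_gen) simp
  also have "\<dots> = (\<Sum>p\<in>proj_point ` A. 2 *\<^sub>R F p)"
  proof (rule sum.cong[OF refl])
    fix p assume "p \<in> proj_point ` A"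
    then obtain v where v: "v \<in> A" "p = proj_point v" by auto
    then have v0: "v \<noteq> 0" using assms by auto
    have *: "{v \<in> A. proj_point v = p} = {v, - v}"
      using v assms proj_point_eq_iff[OF v0] by auto
    have "v \<noteq> - v" using v0 neg_eq_iff[of v] by auto
    then show "(\<Sum>v\<in>{v \<in> A. proj_point v = p}. F (proj_point v)) = 2 *\<^sub>R F p"
      unfolding * using v by (simp add: proj_point_minus scaleR_2)
  qed
  finally show ?thesis by (simp add: scaleR_right.sum)
qed

lemma card_proj_point:
  assumes "0 \<notin> A" "\<And>v. v \<in> A \<Longrightarrow> - v \<in> A"
  shows "card A = 2 * card (proj_point ` A)"
proof -
  have "real (card A) = 2 * real (card (proj_point ` A))"
    using sum_proj_point[OF assms, of "\<lambda>_. 1 :: real"] by simp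
  then show ?thesis by linarith
qed

section \<open>Totally singular lines and the quadrangle property\<close>

lemma singular_partner:
  assumes "singular v"
  obtains f where "Q_minus f = 0" "bf v f \<noteq> 0"
proof -
  obtain t where t: "bf v t \<noteq> 0" using bf_nondegenerate assms by blast
  define f where "f = t - (Q_minus t * bf v t) *s v"
  have "Q_minus f = 0"
    using assms F3_square[OF t] by (simp add: f_def Q_diff Q_smult bf_simps bf_commute[of t v] mult.assoc)
  moreover have "bf v f = bf v t"
    using assms by (simp add: f_def bf_simps bf_self)
  ultimately show ?thesis using that t by simp
qed

text \<open>\<open>perp {v, f}\<close> models the quotient of the orthogonal space of
  \<open>v\<close> by \<open>v\<close>: it is reached by subtracting a multiple of \<open>v\<close>,
  which leaves the form unchanged.\<close>

lemma perp_part: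
  assumes v: "Q_minus v = 0" "Q_minus f = 0" "bf v f \<noteq> 0" and w: "bf w v = 0"
  shows "w - (bf v f * bf w f) *s v \<in> perp {v, f}"
    and "Q_minus (w - c *s v) = Q_minus w"
  using v w by (simp_all add: perp_def bf_simps bf_self Q_diff Q_smult F3_square' mult_ac)

text \<open>Modulo \<open>v\<close>, the vectors \<open>w\<close> and \<open>u\<close> are singular
  and orthogonal in a space of Witt index 1, hence proportional. In other words, no totally singular
  subspace has dimension 3.\<close>

lemma line_span:
  fixes u :: "3^6"
  assumes v: "singular v" and w: "singular w" "w \<noteq> v" "w \<noteq> - v" "bf v w = 0"
    and u: "Q_minus u = 0" "bf u v = 0" "bf u w = 0"
  shows "\<exists>a b. u = a *s v + b *s w"
proof -
  obtain f where f: "Q_minus f = 0" "bf v f \<noteq> 0" using singular_partner[OF v] .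
  define w' where "w' = w - (bf v f * bf w f) *s v"
  define u' where "u' = u - (bf v f * bf u f) *s v"
  have wv: "bf w v = 0" using w by (simp add: bf_commute)
  have "w' \<noteq> 0"
  proof
    assume "w' = 0"
    then have *: "w = (bf v f * bf w f) *s v" by (simp add: w'_def)
    have "c *s v = 0 \<or> c *s v = v \<or> c *s v = - v" for c
      using F3_cases[of c] by (auto simp: vec_eq_iff)
    with * w show False by metis
  qed
  moreover have "bf w' u' = 0"
    using v w u wv by (simp add: w'_def u'_def bf_simps bf_self bf_commute[of v u] bf_commute[of w u])
  ultimately obtain c where "u' = c *s w'"
    using singular_orthogonal_proportional[OF _ f, of w' u'] v w u perp_part[OF _ f wv] perp_part[OF _ f u(2)]
    by (auto simp: w'_def u'_def)
  then have "u = c *s (w - (bf v f * bf w f) *s v) + (bf v f * bf u f) *s v"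
    by (simp add: u'_def w'_def algebra_simps)
  then have "u = ((bf v f * bf u f) - c * (bf v f * bf w f)) *s v + c *s w"
    by (simp add: vec_eq_iff algebra_simps)
  then show ?thesis by blast
qed

text \<open>By \<open>line_span\<close> a common neighbour lies on the line of the two points. That
  line has four points, so two remain.\<close>

lemma common_neighbours_adjacent:
  assumes v: "singular v" and w: "singular w" "w \<noteq> v" "w \<noteq> - v" "bf v w = 0"
  shows "{z \<in> verts. adj (proj_point v) z \<and> adj (proj_point w) z}
      = {proj_point (v + w), proj_point (v - w)}"
    and "singular (v + w)" "singular (v - w)" "proj_point (v + w) \<noteq> proj_point (v - w)"
proof -
  show s: "singular (v + w)" "singular (v - w)"
    using assms by (auto simp: Q_add Q_diff eq_neg_iff_add_eq_0 add.commute)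
  have vw: "v - w \<noteq> v + w" "v - w \<noteq> - (v + w)"
    using v w neg_eq_iff[of v] neg_eq_iff[of w] by (auto simp: algebra_simps eq_neg_iff_add_eq_0)
  then show "proj_point (v + w) \<noteq> proj_point (v - w)"
    using s by (auto simp: proj_point_eq_iff)
  have wv: "bf w v = 0" using w by (simp add: bf_commute)
  show "{z \<in> verts. adj (proj_point v) z \<and> adj (proj_point w) z}
      = {proj_point (v + w), proj_point (v - w)}"
  proof (intro equalityI subsetI)
    fix z assume z: "z \<in> {z \<in> verts. adj (proj_point v) z \<and> adj (proj_point w) z}"
    then obtain u where u: "singular u" "z = proj_point u" by (auto simp: vert_iff)
    with z have u': "u \<noteq> v" "u \<noteq> - v" "u \<noteq> w" "u \<noteq> - w" "bf u v = 0" "bf u w = 0"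
      using v w by (auto simp: adj_iff bf_commute)
    obtain a b where ab: "u = a *s v + b *s w"
      using line_span[OF v w] u u' by blast
    have "u = v + w \<or> u = - (v + w) \<or> u = v - w \<or> u = - (v - w)"
      using F3_cases[of a] F3_cases[of b] ab u u' by (auto simp: smult_minus_one)
    then show "z \<in> {proj_point (v + w), proj_point (v - w)}"
      using u proj_point_minus[of "v + w"] proj_point_minus[of "v - w"] by auto
  next
    fix z assume "z \<in> {proj_point (v + w), proj_point (v - w)}"
    moreover have "v + w \<noteq> v" "v + w \<noteq> - v" "v + w \<noteq> w" "v + w \<noteq> - w" "v - w \<noteq> v" "v - w \<noteq> - v" "v - w \<noteq> w" "v - w \<noteq> - w"
    proof -
      have "c + c = - c" for c :: 3 using F3_cases[of c] by (auto simp: F3_two)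
      then have double: "x + x = - x" for x :: "3^6" by (simp add: vec_eq_iff)
      then have neg_double: "- x - x = x" for x :: "3^6" using double[of "- x"] by simp
      show "v + w \<noteq> v" "v + w \<noteq> w" "v - w \<noteq> v" "v - w \<noteq> - w"
        using v w by auto
      show "v + w \<noteq> - v"
      proof
        assume "v + w = - v"
        then have "w = - v - v" by (metis add_diff_cancel_left')
        then show False using w neg_double[of v] by simp
      qed
      show "v + w \<noteq> - w"
      proof
        assume "v + w = - w"
        then have "v = - w - w" by (metis add_diff_cancel_right')
        then show False using w neg_double[of w] by simp
      qed
      show "v - w \<noteq> - v"
      proof
        assume "v - w = - v"
        then have "w = v - (- v)" by (metis diff_diff_eq2 add_diff_cancel_left')
        then show False using w double[of v] by simp
      qed
      show "v - w \<noteq> w"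
      proof
        assume "v - w = w"
        then have "v = w + w" by (metis diff_add_cancel)
        then show False using w double[of w] by simp
      qed
    qed
    ultimately show "z \<in> {z \<in> verts. adj (proj_point v) z \<and> adj (proj_point w) z}"
      using v w wv s by (auto simp: adj_iff singular_vert bf_simps bf_self)
  qed
qed

text \<open>The quadrangle property in the form used from here on: triangles lie on lines, so any
  two common neighbours of an edge are both on its line.\<close>

lemma common_neighbours_of_edge:
  assumes "adj p q" "adj p r" "adj q r" "adj p s" "adj q s" "r \<noteq> s"
  shows "adj r s"
proof -
  obtain v w where v: "singular v" "p = proj_point v" and w: "singular w" "q = proj_point w"
    using assms(1) adj_verts by (metis vert_iff)
  with assms(1) have vw: "w \<noteq> v" "w \<noteq> - v" "bf v w = 0" by (auto simp: adj_iff)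
  note common = common_neighbours_adjacent[OF v(1) w(1) vw]
  have "r \<in> {proj_point (v + w), proj_point (v - w)}" "s \<in> {proj_point (v + w), proj_point (v - w)}"
    unfolding common(1)[symmetric] using assms v w adj_verts by auto
  moreover have "adj (proj_point (v + w)) (proj_point (v - w))"
    using common v w vw by (auto simp: adj_iff proj_point_eq_iff[of "v + w"] bf_simps bf_self bf_commute[of w v])
  ultimately show ?thesis using assms(6) adj_sym by auto
qed

section \<open>Numbers of common neighbours\<close>

definition common_nbrs :: "(3^6) set \<Rightarrow> (3^6) set \<Rightarrow> (3^6) set set" where
  "common_nbrs p q = {z \<in> verts. adj p z \<and> adj q z}"

definition nonadj :: "(3^6) set \<Rightarrow> (3^6) set \<Rightarrow> bool" where
  "nonadj p q \<longleftrightarrow> p \<in> verts \<and> q \<in> verts \<and> p \<noteq> q \<and> \<not> adj p q"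

lemma nonadj_sym: "nonadj p q \<longleftrightarrow> nonadj q p"
  unfolding nonadj_def using adj_sym by blast

lemma nonadj_proj_point: "singular v \<Longrightarrow> singular w \<Longrightarrow> nonadj (proj_point v) (proj_point w) \<longleftrightarrow> bf v w \<noteq> 0"
  using nonadj_iff[of v w] by (auto simp: nonadj_def singular_vert)

lemma nonadjE:
  assumes "nonadj p q"
  obtains v w where "singular v" "singular w" "p = proj_point v" "q = proj_point w" "bf v w \<noteq> 0"
  using assms nonadj_proj_point unfolding nonadj_def by (metis vert_iff)

definition sing_perp :: "3^6 \<Rightarrow> 3^6 \<Rightarrow> (3^6) set" where
  "sing_perp v w = {s \<in> perp {v, w}. singular s}"

lemma common_nbrs_nonadj:
  assumes "singular v" "singular w" "bf v w \<noteq> 0"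
  shows "common_nbrs (proj_point v) (proj_point w) = proj_point ` sing_perp v w"
proof (intro equalityI subsetI)
  fix z assume z: "z \<in> common_nbrs (proj_point v) (proj_point w)"
  then obtain s where s: "singular s" "z = proj_point s" by (auto simp: common_nbrs_def vert_iff)
  with z assms have "s \<in> sing_perp v w"
    by (auto simp: common_nbrs_def sing_perp_def adj_iff perp_def bf_commute)
  then show "z \<in> proj_point ` sing_perp v w" using s by auto
next
  fix z assume "z \<in> proj_point ` sing_perp v w"
  then obtain s where s: "s \<in> perp {v, w}" "singular s" "z = proj_point s" by (auto simp: sing_perp_def)
  have "s \<noteq> v" "s \<noteq> - v" "s \<noteq> w" "s \<noteq> - w"
    using s(1) assms(3) bf_commute[of w v] by (auto simp: perp_def bf_simps)
  then show "z \<in> common_nbrs (proj_point v) (proj_point w)"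
    using s assms by (auto simp: common_nbrs_def singular_vert adj_iff perp_def bf_commute)
qed

lemma card_sing_perp:
  assumes "singular v" "singular w" "bf v w \<noteq> 0"
  shows "card (sing_perp v w) = 20"
proof -
  have "{s \<in> perp {v, w}. Q_minus s = 0} = insert 0 (sing_perp v w)"
    by (auto simp: sing_perp_def perp_zero Q_zero)
  then have "nQ {v, w} 0 = Suc (card (sing_perp v w))"
    unfolding nQ_def by (simp add: sing_perp_def)
  then show ?thesis using nQ_pair[of v w 0] assms by simp
qed

lemma card_common_nbrs:
  assumes "nonadj p q"
  shows "card (common_nbrs p q) = 10"
proof -
  obtain v w where v: "singular v" "singular w" "p = proj_point v" "q = proj_point w" "bf v w \<noteq> 0"
    using nonadjE[OF assms] .
  have "card (sing_perp v w) = 2 * card (proj_point ` sing_perp v w)"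
    by (rule card_proj_point) (auto simp: sing_perp_def perp_minus Q_minus_uminus)
  then show ?thesis using v card_sing_perp[of v w] by (simp add: common_nbrs_nonadj)
qed

text \<open>The component \<open>y'\<close> of \<open>y\<close> orthogonal to \<open>v\<close> and
  \<open>w\<close> takes minus the product of the three pairwise products as value, so it is
  nonsingular. The count 9 for nonsingular vectors leaves 8 nonzero vectors, that is 4 points; this
  constant number of centres is typical of quadrangles of order \<open>(s, s^2)\<close>.\<close>

lemma card_common_nbrs3:
  assumes "nonadj p q" "nonadj p r" "nonadj q r"
  shows "card {z \<in> common_nbrs p q. adj r z} = 4"
proof -
  obtain v w where v: "singular v" "singular w" "p = proj_point v" "q = proj_point w" and d: "bf v w \<noteq> 0"
    using nonadjE[OF assms(1)] .
  obtain y where y: "singular y" "r = proj_point y" using assms by (metis nonadj_def vert_iff)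
  have vy: "bf v y \<noteq> 0" "bf w y \<noteq> 0" using assms v y by (simp_all add: nonadj_proj_point)
  define y' where "y' = y - (bf v w * bf w y) *s v - (bf v w * bf v y) *s w"
  have y': "y' \<in> perp {v, w}"
    using v d by (simp add: y'_def perp_def bf_simps bf_self bf_commute[of y] bf_commute[of w v] F3_square' mult_ac)
  have "Q_minus y' = - (bf v w * bf v y * bf w y) - (bf v w * bf v y * bf w y) + bf v w * bf v y * bf w y"
    using v y d by (simp add: y'_def Q_diff Q_smult bf_simps bf_commute[of y] bf_commute[of w v] F3_square' mult_ac)
  then have "Q_minus y' \<noteq> 0" using d vy by (simp add: F3_mult_eq_0)
  have eq: "bf s y = bf s y'" if "s \<in> perp {v, w}" for s
    using that by (simp add: y'_def perp_def bf_simps)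
  have "{s \<in> perp {y', v, w}. Q_minus s = 0} = insert 0 {s \<in> sing_perp v w. bf s y = 0}"
    by (auto simp: sing_perp_def perp_zero Q_zero perp_insert[of _ y'] eq bf_simps)
  then have "nQ {y', v, w} 0 = Suc (card {s \<in> sing_perp v w. bf s y = 0})"
    unfolding nQ_def by (simp add: sing_perp_def)
  then have "card {s \<in> sing_perp v w. bf s y = 0} = 8"
    using nQ_pair_nonsingular(1)[OF _ _ d y'] v \<open>Q_minus y' \<noteq> 0\<close> by simp
  moreover have "card {s \<in> sing_perp v w. bf s y = 0} = 2 * card (proj_point ` {s \<in> sing_perp v w. bf s y = 0})"
    by (rule card_proj_point) (auto simp: sing_perp_def perp_minus Q_minus_uminus bf_simps)
  moreover have "proj_point ` {s \<in> sing_perp v w. bf s y = 0} = {z \<in> common_nbrs p q. adj r z}"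
  proof -
    have "bf s y = 0 \<longleftrightarrow> adj r (proj_point s)" if "s \<in> sing_perp v w" for s
    proof -
      have "s \<noteq> y" "s \<noteq> - y" using that vy bf_commute[of _ v] by (auto simp: sing_perp_def perp_def bf_simps)
      then show ?thesis using that y by (auto simp: sing_perp_def adj_iff bf_commute)
    qed
    then show ?thesis using v d by (auto simp: common_nbrs_nonadj)
  qed
  ultimately show ?thesis by simp
qed

text \<open>Through \<open>p\<close> pass nine lines other than \<open>pq\<close>, each with three
  further points. In vectors: 18 classes modulo \<open>v\<close> of 3 vectors each, and 2 vectors
  per point.\<close>

lemma card_nbrs_off_line:
  assumes "adj p q"
  shows "card {z \<in> verts. adj p z \<and> nonadj z q} = 27"
proof -
  obtain v w where v: "singular v" "p = proj_point v" and w: "singular w" "q = proj_point w"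
    using assms adj_verts by (metis vert_iff)
  with assms have vw: "w \<noteq> v" "w \<noteq> - v" "bf v w = 0" by (auto simp: adj_iff)
  obtain f where f: "Q_minus f = 0" "bf v f \<noteq> 0" using singular_partner[OF v(1)] .
  define w' where "w' = w - (bf v f * bf w f) *s v"
  have wv: "bf w v = 0" using vw by (simp add: bf_commute)
  have w': "w' \<in> perp {v, f}" "Q_minus w' = 0"
    using perp_part[OF _ f wv] v w by (simp_all add: w'_def)
  have "w' \<noteq> 0"
  proof
    assume "w' = 0"
    then have *: "w = (bf v f * bf w f) *s v" by (simp add: w'_def)
    have "c *s v = 0 \<or> c *s v = v \<or> c *s v = - v" for c
      using F3_cases[of c] by (auto simp: vec_eq_iff)
    with * w vw show False by metis
  qed
  define A where "A = {s. bf s v = 0 \<and> Q_minus s = 0 \<and> bf s w \<noteq> 0}"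
  define B where "B = {s \<in> perp {v, f}. Q_minus s = 0 \<and> bf s w' \<noteq> 0}"
  have Bw: "bf s w' = bf s w" if "bf s v = 0" for s using that by (simp add: w'_def bf_simps)
  have "bij_betw (\<lambda>(a, s). a *s v + s) (UNIV \<times> B) A"
  proof (rule bij_betw_byWitness[where f' = "\<lambda>s. (bf v f * bf s f, s - (bf v f * bf s f) *s v)"])
    show "\<forall>x\<in>UNIV \<times> B. (\<lambda>s. (bf v f * bf s f, s - (bf v f * bf s f) *s v)) ((\<lambda>(a, s). a *s v + s) x) = x"
      using f by (auto simp: B_def perp_def bf_simps F3_square F3_square' mult_ac)
    show "(\<lambda>(a, s). a *s v + s) ` (UNIV \<times> B) \<subseteq> A"
      using v vw by (auto simp: A_def B_def perp_def bf_simps bf_self Q_add Q_smult Bw bf_commute[of v])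
    show "(\<lambda>s. (bf v f * bf s f, s - (bf v f * bf s f) *s v)) ` A \<subseteq> UNIV \<times> B"
    proof (rule image_subsetI)
      fix s assume s: "s \<in> A"
      then have sv: "bf s v = 0" "Q_minus s = 0" "bf s w \<noteq> 0" by (auto simp: A_def)
      have "bf (s - (bf v f * bf s f) *s v) w' = bf s w"
        using sv v vw wv by (simp add: w'_def bf_simps bf_self)
      then show "(bf v f * bf s f, s - (bf v f * bf s f) *s v) \<in> UNIV \<times> B"
        using perp_part[OF _ f sv(1)] v sv by (simp add: B_def)
    qed
  qed auto
  from bij_betw_same_card[OF this] have "card A = 3 * card B" by simp
  moreover have "card B = 18"
  proof -
    have "B = {s \<in> perp {v, f}. Q_minus s = 0 \<and> bf s w' = 1} \<union> {s \<in> perp {v, f}. Q_minus s = 0 \<and> bf s w' = - 1}"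
      unfolding B_def using F3_cases by auto
    moreover have "card \<dots> = 9 + 9"
      using card_singular_with_product_singular[OF _ f w' \<open>w' \<noteq> 0\<close>] v by (subst card_Un_disjoint) auto
    ultimately show ?thesis by simp
  qed
  moreover have "card A = 2 * card (proj_point ` A)"
    by (rule card_proj_point) (auto simp: A_def bf_simps Q_minus_uminus)
  moreover have "proj_point ` A = {z \<in> verts. adj p z \<and> nonadj z q}"
  proof (intro equalityI subsetI)
    fix z assume "z \<in> proj_point ` A"
    then obtain s where s: "z = proj_point s" "bf s v = 0" "Q_minus s = 0" "bf s w \<noteq> 0" by (auto simp: A_def)
    then have "singular s" "s \<noteq> v" "s \<noteq> - v" using vw by (auto simp: bf_simps)
    then show "z \<in> {z \<in> verts. adj p z \<and> nonadj z q}"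
      using s v w by (auto simp: singular_vert adj_iff nonadj_proj_point bf_commute)
  next
    fix z assume z: "z \<in> {z \<in> verts. adj p z \<and> nonadj z q}"
    then obtain s where "singular s" "z = proj_point s" by (auto simp: vert_iff)
    with z show "z \<in> proj_point ` A"
      using v w by (auto simp: A_def adj_iff nonadj_proj_point bf_commute)
  qed
  ultimately show ?thesis by simp
qed

section \<open>Slides\<close>

abbreviation adjb :: "(3^6) set \<Rightarrow> (3^6) set \<Rightarrow> real" where
  "adjb a b \<equiv> of_bool (adj a b)"

abbreviation nadjb :: "(3^6) set \<Rightarrow> (3^6) set \<Rightarrow> real" where
  "nadjb a b \<equiv> of_bool (a \<noteq> b \<and> \<not> adj a b)"

definition star4 :: "(3^6) set \<Rightarrow> (3^6) set \<Rightarrow> (3^6) set \<Rightarrow> (3^6) set \<Rightarrow> real" where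
  "star4 a b c d = (\<Sum>t\<in>verts. adjb a t * adjb b t * adjb c t * adjb d t)"

text \<open>Opposite sides \<open>ab\<close> and \<open>cd\<close> are nonadjacent and joined by the edges \<open>bc\<close> and \<open>da\<close>; these lie
  on lines of the quadrangle, and \<open>slide\<close> is 1 if the two lines meet in a fifth point and 0 otherwise.\<close>

definition slide :: "(3^6) set \<Rightarrow> (3^6) set \<Rightarrow> (3^6) set \<Rightarrow> (3^6) set \<Rightarrow> real" where
  "slide a b c d = nadjb a b * (adjb b c * (nadjb c d * (adjb d a * star4 a b c d)))"

definition slide2 :: "(3^6) set \<Rightarrow> (3^6) set \<Rightarrow> (3^6) set \<Rightarrow> (3^6) set \<Rightarrow> real" where
  "slide2 a b c d = nadjb a b * (nadjb b c * (nadjb c d * (nadjb d a *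
     (\<Sum>p\<in>verts. \<Sum>q\<in>verts. slide a b q p * slide p q c d))))"

definition slide3 :: "(3^6) set \<Rightarrow> (3^6) set \<Rightarrow> (3^6) set \<Rightarrow> (3^6) set \<Rightarrow> real" where
  "slide3 a b c d = nadjb a b * (adjb b c * (nadjb c d * (adjb d a *
     (\<Sum>p\<in>verts. \<Sum>q\<in>verts. slide2 a b q p * slide p q c d))))"

section \<open>A slide as a sum over the meeting point of the two lines\<close>

lemma sum_restrict:
  fixes f :: "'b \<Rightarrow> real"
  assumes "finite B" "A \<subseteq> B"
  shows "(\<Sum>x\<in>B. of_bool (x \<in> A) * f x) = sum f A"
  using assms by (intro sum.mono_neutral_cong_right) auto

text \<open>The point \<open>p\<close> is on the line \<open>at\<close> and \<open>q\<close> on the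
  line \<open>bt\<close>. Were they equal or adjacent, the quadrangle property would merge the two
  lines, and \<open>a\<close>, \<open>b\<close> would be equal or adjacent.\<close>

lemma nonadj_of_slide:
  assumes "nonadj a b" "t \<in> common_nbrs a b" "p \<in> common_nbrs a t" "q \<in> common_nbrs b t"
  shows "nonadj q p"
proof -
  have "\<not> adj q p"
  proof
    assume "adj q p"
    then have "a = q \<or> adj a q"
      using common_neighbours_of_edge[of p t a q] assms adj_sym unfolding common_nbrs_def by blast
    then have "a = b \<or> adj a b"
      using common_neighbours_of_edge[of q t a b] assms adj_sym unfolding common_nbrs_def by blast
    then show False using assms(1) unfolding nonadj_def by blast
  qed
  moreover have "q \<noteq> p"
  proof
    assume "q = p"
    then have "a = b \<or> adj a b"
      using common_neighbours_of_edge[of p t a b] assms adj_sym unfolding common_nbrs_def by blast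
    then show False using assms(1) unfolding nonadj_def by blast
  qed
  ultimately show ?thesis using assms unfolding nonadj_def common_nbrs_def by blast
qed

text \<open>The summation variable \<open>t\<close> is the meeting point. Once \<open>p\<close> and
  \<open>q\<close> are on the lines through it, the edge masks of \<open>slide\<close> hold by
  definition and its mask \<open>nadjb q p\<close> by \<open>nonadj_of_slide\<close>.\<close>

lemma slide_common:
  assumes ab: "nonadj a b" and pq: "p \<in> verts" "q \<in> verts"
  shows "slide a b q p = (\<Sum>t\<in>verts. of_bool (t \<in> common_nbrs a b) * (of_bool (p \<in> common_nbrs a t) * of_bool (q \<in> common_nbrs b t)))"
proof (cases "adj b q \<and> q \<noteq> p \<and> \<not> adj q p \<and> adj p a")
  case True
  then have "slide a b q p = star4 a b q p"
    using ab by (simp add: slide_def nonadj_def)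
  also have "\<dots> = (\<Sum>t\<in>verts. of_bool (t \<in> common_nbrs a b) * (of_bool (p \<in> common_nbrs a t) * of_bool (q \<in> common_nbrs b t)))"
    unfolding star4_def
  proof (intro sum.cong refl)
    fix t assume "t \<in> verts"
    then have "t \<in> common_nbrs a b \<longleftrightarrow> adj a t \<and> adj b t"
      "p \<in> common_nbrs a t \<longleftrightarrow> adj p t" "q \<in> common_nbrs b t \<longleftrightarrow> adj q t"
      using True pq adj_sym unfolding common_nbrs_def by blast+
    then show "adjb a t * adjb b t * adjb q t * adjb p t
      = of_bool (t \<in> common_nbrs a b) * (of_bool (p \<in> common_nbrs a t) * of_bool (q \<in> common_nbrs b t))"
      by simp
  qed
  finally show ?thesis .
next
  case False
  have "\<not> (t \<in> common_nbrs a b \<and> p \<in> common_nbrs a t \<and> q \<in> common_nbrs b t)" for t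
    using False nonadj_of_slide[OF ab] adj_sym unfolding common_nbrs_def nonadj_def by blast
  moreover have "slide a b q p = 0"
    using False by (auto simp: slide_def)
  ultimately show ?thesis by (auto intro!: sum.neutral[symmetric])
qed

lemma common_nbrs_line:
  assumes "singular v" "singular w" "bf v w = 0" "w \<noteq> v" "w \<noteq> - v"
  shows "common_nbrs (proj_point v) (proj_point w) = {proj_point (v + w), proj_point (v - w)}"
  using common_neighbours_adjacent(1)[OF assms(1,2,4,5,3)] by (simp add: common_nbrs_def)

text \<open>The meeting point determines \<open>s\<close> up to sign, and the lines continue to
  \<open>v + s\<close>, \<open>v - s\<close> and to \<open>w + s\<close>, \<open>w - s\<close>.
  Letting \<open>s\<close> run over both signs permits writing \<open>p\<close> always as
  \<open>v + s\<close>, with a free sign \<open>m\<close> only at \<open>q\<close>; the two factors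
  2 cancel.\<close>

lemma slide_sum:
  fixes G :: "(3^6) set \<Rightarrow> (3^6) set \<Rightarrow> real"
  assumes v: "singular v" and w: "singular w" and vw: "bf v w \<noteq> 0"
  shows "(\<Sum>p\<in>verts. \<Sum>q\<in>verts. slide (proj_point v) (proj_point w) q p * G p q)
    = (\<Sum>s\<in>sing_perp v w. \<Sum>m\<in>{1, - 1}. G (proj_point (v + s)) (proj_point (w + m *s s)))"
proof -
  let ?a = "proj_point v" and ?b = "proj_point w" and ?V = verts
  have ab: "nonadj ?a ?b" using v w vw by (simp add: nonadj_proj_point)
  have sub: "common_nbrs p q \<subseteq> ?V" for p q by (auto simp: common_nbrs_def)
  have "(\<Sum>p\<in>?V. \<Sum>q\<in>?V. slide ?a ?b q p * G p q)
      = (\<Sum>p\<in>?V. \<Sum>q\<in>?V. \<Sum>t\<in>?V. of_bool (t \<in> common_nbrs ?a ?b) * (of_bool (p \<in> common_nbrs ?a t) * (of_bool (q \<in> common_nbrs ?b t) * G p q)))"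
    by (intro sum.cong refl) (simp add: slide_common[OF ab] sum_distrib_right mult.assoc)
  also have "\<dots> = (\<Sum>t\<in>?V. \<Sum>p\<in>?V. \<Sum>q\<in>?V. of_bool (t \<in> common_nbrs ?a ?b) * (of_bool (p \<in> common_nbrs ?a t) * (of_bool (q \<in> common_nbrs ?b t) * G p q)))"
    by (rule sum_swap3)
  also have "\<dots> = (\<Sum>t\<in>common_nbrs ?a ?b. \<Sum>p\<in>common_nbrs ?a t. \<Sum>q\<in>common_nbrs ?b t. G p q)"
    by (simp only: sum_distrib_left[symmetric] sum_restrict[OF finite_verts sub])
  also have "\<dots> = (\<Sum>t\<in>proj_point ` sing_perp v w. \<Sum>p\<in>common_nbrs ?a t. \<Sum>q\<in>common_nbrs ?b t. G p q)"
    using v w vw by (simp add: common_nbrs_nonadj)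
  also have "2 *\<^sub>R \<dots> = (\<Sum>s\<in>sing_perp v w. \<Sum>p\<in>common_nbrs ?a (proj_point s). \<Sum>q\<in>common_nbrs ?b (proj_point s). G p q)"
    by (rule sum_proj_point[symmetric]) (auto simp: sing_perp_def perp_minus Q_minus_uminus)
  also have "\<dots> = (\<Sum>s\<in>sing_perp v w. (\<Sum>m\<in>{1, - 1}. G (proj_point (v + s)) (proj_point (w + m *s s)))
      + (\<Sum>m\<in>{1, - 1}. G (proj_point (v + - s)) (proj_point (w + m *s (- s)))))"
  proof (rule sum.cong[OF refl])
    fix s assume s: "s \<in> sing_perp v w"
    have ne: "s \<noteq> v" "s \<noteq> - v" "s \<noteq> w" "s \<noteq> - w"
      using s vw bf_commute[of w v] by (auto simp: sing_perp_def perp_def bf_simps)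
    have s': "singular s" "bf v s = 0" "bf w s = 0"
      using s by (auto simp: sing_perp_def perp_def bf_commute)
    show "(\<Sum>p\<in>common_nbrs ?a (proj_point s). \<Sum>q\<in>common_nbrs ?b (proj_point s). G p q)
      = (\<Sum>m\<in>{1, - 1}. G (proj_point (v + s)) (proj_point (w + m *s s)))
      + (\<Sum>m\<in>{1, - 1}. G (proj_point (v + - s)) (proj_point (w + m *s (- s))))"
      using common_neighbours_adjacent(4)[OF v s'(1) ne(1,2) s'(2)] common_neighbours_adjacent(4)[OF w s'(1) ne(3,4) s'(3)]
      by (simp add: common_nbrs_line[OF v s'(1,2) ne(1,2)] common_nbrs_line[OF w s'(1,3) ne(3,4)] smult_minus_one)
  qed
  also have "\<dots> = 2 *\<^sub>R (\<Sum>s\<in>sing_perp v w. \<Sum>m\<in>{1, - 1}. G (proj_point (v + s)) (proj_point (w + m *s s)))"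
  proof -
    have "(\<Sum>s\<in>sing_perp v w. \<Sum>m\<in>{1, - 1}. G (proj_point (v + - s)) (proj_point (w + m *s (- s))))
      = (\<Sum>s\<in>sing_perp v w. \<Sum>m\<in>{1, - 1}. G (proj_point (v + s)) (proj_point (w + m *s s)))"
      by (rule sum.reindex_bij_witness[of _ uminus uminus]) (auto simp: sing_perp_def perp_minus Q_minus_uminus)
    then show ?thesis by (simp only: sum.distrib scaleR_2)
  qed
  finally show ?thesis by simp
qed

section \<open>Slides in terms of representing vectors\<close>

lemma nadjb_proj_point: "singular v \<Longrightarrow> singular w \<Longrightarrow> nadjb (proj_point v) (proj_point w) = of_bool (bf v w \<noteq> 0)"
  using nonadj_iff[of v w] by simp

lemma adjb_proj_point: "singular v \<Longrightarrow> singular w \<Longrightarrow> adjb (proj_point v) (proj_point w) = of_bool (w \<noteq> v \<and> w \<noteq> - v \<and> bf v w = 0)"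
  using adj_iff[of v w] by simp

text \<open>For singular lines through \<open>a\<close>, \<open>d\<close> and through
  \<open>b\<close>, \<open>c\<close>, this is the existence of a common point spanned by
  \<open>a + e *s d = - (f *s b + g *s c)\<close>, where nonzero coefficients keep it away from the
  four given points.\<close>

definition signed_relation :: "3^6 \<Rightarrow> 3^6 \<Rightarrow> 3^6 \<Rightarrow> 3^6 \<Rightarrow> bool" where
  "signed_relation a b c d \<longleftrightarrow> (\<exists>e f g. e \<noteq> 0 \<and> f \<noteq> 0 \<and> g \<noteq> 0 \<and> a + e *s d + f *s b + g *s c = 0)"

lemma card_Int_pairs:
  assumes C: "C = {p, q} \<inter> {r, s}" and pq: "\<not> (p \<in> C \<and> q \<in> C)"
  shows "card C = of_bool (p = r \<or> p = s \<or> q = r \<or> q = s)"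
proof (cases "p = r \<or> p = s \<or> q = r \<or> q = s")
  case True
  then have "C = {p} \<or> C = {q}" using C pq by blast
  then show ?thesis using True by auto
next
  case False
  then have "C = {}" using C by blast
  then show ?thesis using False by simp
qed

lemma signed_relation_iff:
  "signed_relation a b c d \<longleftrightarrow> (b + c = a + d \<or> b + c = - (a + d)) \<or> (b - c = a + d \<or> b - c = - (a + d))
     \<or> (b + c = a - d \<or> b + c = - (a - d)) \<or> (b - c = a - d \<or> b - c = - (a - d))"
proof -
  have ex: "(\<exists>x. x \<noteq> 0 \<and> P x) \<longleftrightarrow> P 1 \<or> P (- 1)" for P :: "3 \<Rightarrow> bool"
    using F3_cases F3_distinct by metis
  have "signed_relation a b c d \<longleftrightarrow> (\<exists>e. e \<noteq> 0 \<and> (\<exists>f. f \<noteq> 0 \<and> (\<exists>g. g \<noteq> 0 \<and> a + e *s d + f *s b + g *s c = 0)))"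
    unfolding signed_relation_def by blast
  also have "\<dots> \<longleftrightarrow> (((a + d + b + c = 0 \<or> a + d + b - c = 0) \<or> (a + d - b + c = 0 \<or> a + d - b - c = 0))
     \<or> ((a - d + b + c = 0 \<or> a - d + b - c = 0) \<or> (a - d - b + c = 0 \<or> a - d - b - c = 0)))"
    unfolding ex by (simp add: smult_minus_one)
  finally have *: "signed_relation a b c d \<longleftrightarrow> (((a + d + b + c = 0 \<or> a + d + b - c = 0) \<or> (a + d - b + c = 0 \<or> a + d - b - c = 0))
     \<or> ((a - d + b + c = 0 \<or> a - d + b - c = 0) \<or> (a - d - b + c = 0 \<or> a - d - b - c = 0)))" .
  have "a + d + b + c = 0 \<longleftrightarrow> b + c = - (a + d)" "a + d + b - c = 0 \<longleftrightarrow> b - c = - (a + d)"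
    "a + d - b + c = 0 \<longleftrightarrow> b - c = a + d" "a + d - b - c = 0 \<longleftrightarrow> b + c = a + d"
    "a - d + b + c = 0 \<longleftrightarrow> b + c = - (a - d)" "a - d + b - c = 0 \<longleftrightarrow> b - c = - (a - d)"
    "a - d - b + c = 0 \<longleftrightarrow> b - c = a - d" "a - d - b - c = 0 \<longleftrightarrow> b + c = a - d"
    by (simp_all only: eq_neg_iff_add_eq_0 diff_eq_eq eq_diff_eq add_diff_eq diff_diff_eq add.assoc add_0 add_0_right) (auto simp: algebra_simps)
  with * show ?thesis by blast
qed

text \<open>\<open>star4\<close> counts the coincidences between the two remaining points of one
  line and those of the other. There is at most one, for if \<open>b\<close> were orthogonal to
  \<open>a + d\<close> and \<open>a - d\<close>, it would be orthogonal to \<open>a\<close>.\<close>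

lemma slide_proj_point:
  assumes s: "singular a" "singular b" "singular c" "singular d"
    and ab: "bf a b \<noteq> 0" and bc: "c \<noteq> b" "c \<noteq> - b" "bf b c = 0" and cd: "bf c d \<noteq> 0" and da: "d \<noteq> a" "d \<noteq> - a" "bf a d = 0"
  shows "slide (proj_point a) (proj_point b) (proj_point c) (proj_point d) = of_bool (signed_relation a b c d)"
proof -
  have s1: "singular (a + d)" "singular (a - d)"
    by (fact common_neighbours_adjacent(2)[OF s(1,4) da] common_neighbours_adjacent(3)[OF s(1,4) da])+
  define C where "C = common_nbrs (proj_point a) (proj_point d) \<inter> common_nbrs (proj_point b) (proj_point c)"
  have CN: "C = {proj_point (a + d), proj_point (a - d)} \<inter> {proj_point (b + c), proj_point (b - c)}"
    unfolding C_def common_nbrs_line[OF s(1,4) da(3,1,2)] common_nbrs_line[OF s(2,3) bc(3,1,2)] ..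
  have CV: "C \<subseteq> verts" unfolding C_def common_nbrs_def by blast
  have "slide (proj_point a) (proj_point b) (proj_point c) (proj_point d) = star4 (proj_point a) (proj_point b) (proj_point c) (proj_point d)"
  proof -
    have "bf d a = 0" "a \<noteq> d" "a \<noteq> - d" using da by (auto simp: bf_commute)
    then show ?thesis
      unfolding slide_def nadjb_proj_point[OF s(1,2)] nadjb_proj_point[OF s(3,4)] adjb_proj_point[OF s(2,3)] adjb_proj_point[OF s(4,1)]
      using ab bc cd by simp
  qed
  also have "\<dots> = (\<Sum>t\<in>verts. of_bool (t \<in> C) * 1)"
    unfolding star4_def
  proof (rule sum.cong[OF refl])
    fix t assume t: "t \<in> verts"
    show "adjb (proj_point a) t * adjb (proj_point b) t * adjb (proj_point c) t * adjb (proj_point d) t = of_bool (t \<in> C) * 1"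
      using t unfolding C_def common_nbrs_def Int_iff mem_Collect_eq by (simp only: of_bool_conj) simp
  qed
  also have "\<dots> = real (card C)"
    unfolding sum_restrict[OF finite_verts CV] by simp
  also have "card C = of_bool (proj_point (a + d) = proj_point (b + c) \<or> proj_point (a + d) = proj_point (b - c)
      \<or> proj_point (a - d) = proj_point (b + c) \<or> proj_point (a - d) = proj_point (b - c))"
    using CN
  proof (rule card_Int_pairs)
    show "\<not> (proj_point (a + d) \<in> C \<and> proj_point (a - d) \<in> C)"
    proof
      assume "proj_point (a + d) \<in> C \<and> proj_point (a - d) \<in> C"
      then have "adj (proj_point b) (proj_point (a + d))" "adj (proj_point b) (proj_point (a - d))"
        unfolding C_def common_nbrs_def by blast+
      then have "bf b (a + d) = 0" "bf b (a - d) = 0"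
        using adj_iff[OF s(2) s1(1)] adj_iff[OF s(2) s1(2)] by blast+
      then have "bf b a + bf b a = 0" by (simp add: bf_simps)
      then have "bf b a = 0" using F3_cases[of "bf b a"] by auto
      with ab show False by (simp add: bf_commute)
    qed
  qed
  also have "\<dots> = of_bool (signed_relation a b c d)"
    unfolding proj_point_eq_iff[OF conjunct1[OF s1(1)]] proj_point_eq_iff[OF conjunct1[OF s1(2)]] signed_relation_iff by (simp only: disj_assoc)
  finally show ?thesis by simp
qed

lemma signed_relation_orthogonal:
  assumes "signed_relation a b c d" "Q_minus a = 0" "Q_minus b = 0" "Q_minus c = 0" "Q_minus d = 0" "bf a d = 0"
  shows "bf b c = 0"
proof -
  obtain e f g where e: "e \<noteq> 0" "f \<noteq> 0" "g \<noteq> 0" "a + e *s d + f *s b + g *s c = 0"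
    using assms(1) unfolding signed_relation_def by blast
  have "(f *s b + g *s c) + (a + e *s d) = 0"
    using e(4) by (simp add: add_ac)
  then have "f *s b + g *s c = - (a + e *s d)"
    by (simp only: eq_neg_iff_add_eq_0)
  then have "Q_minus (f *s b + g *s c) = Q_minus (a + e *s d)"
    by (simp only: Q_minus_uminus)
  then have "g * (f * bf b c) = 0"
    using assms by (simp add: Q_add Q_smult bf_simps)
  then show ?thesis using e by (simp add: F3_mult_eq_0)
qed

text \<open>The conditions on the edge \<open>bc\<close> are absorbed: the relation forces
  \<open>bf b c = 0\<close> by comparing values of the form, and if \<open>c\<close> were a multiple
  of \<open>b\<close>, pairing with \<open>a\<close> would cancel both and leave
  \<open>a + e *s d = 0\<close>.\<close>

lemma slide_eq_signed_relation:
  assumes s: "singular a" "singular b" "singular c" "singular d"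
    and ab: "bf a b \<noteq> 0" and cd: "bf c d \<noteq> 0" and da: "d \<noteq> a" "d \<noteq> - a"
  shows "slide (proj_point a) (proj_point b) (proj_point c) (proj_point d) = of_bool (bf a d = 0 \<and> signed_relation a b c d)"
proof (cases "bf a d = 0 \<and> bf b c = 0 \<and> c \<noteq> b \<and> c \<noteq> - b")
  case True
  then show ?thesis using slide_proj_point[OF s ab _ _ _ cd da] by simp
next
  case False
  have "\<not> (bf a d = 0 \<and> signed_relation a b c d)"
  proof
    assume *: "bf a d = 0 \<and> signed_relation a b c d"
    then have "bf b c = 0" using signed_relation_orthogonal s by blast
    with False * have "c = 1 *s b \<or> c = (- 1) *s b" by (simp add: smult_minus_one)
    then obtain h where h: "c = h *s b" by blast
    obtain e f g where e: "e \<noteq> 0" "f \<noteq> 0" "g \<noteq> 0" "a + e *s d + f *s b + g *s c = 0"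
      using * unfolding signed_relation_def by blast
    have "bf a (a + e *s d + f *s b + g *s c) = 0" using e by (simp add: bf_simps)
    then have "(f + g * h) * bf a b = 0"
      using * s by (simp add: bf_simps bf_self h algebra_simps)
    then have "f + g * h = 0" using ab by (simp add: F3_mult_eq_0)
    then have "f *s b + g *s c = 0" by (metis h vector_smult_assoc vector_sadd_rdistrib vector_smult_lzero)
    then have "a + e *s d = 0" using e(4) by (simp add: add.assoc)
    moreover have "e = 1 \<or> e = - 1" using e(1) F3_cases by blast
    ultimately have "a + d = 0 \<or> a = d" by (auto simp: smult_minus_one)
    then show False using da by (auto simp: eq_neg_iff_add_eq_0 add.commute)
  qed
  moreover have "slide (proj_point a) (proj_point b) (proj_point c) (proj_point d) = 0"
    using False by (auto simp: slide_def adjb_proj_point s bf_commute[of d a])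
  ultimately show ?thesis by simp
qed

lemma slide_reverse: "slide a b c d = slide d c b a"
proof -
  have "nadjb x y = nadjb y x" "adjb x y = adjb y x" for x y using adj_sym[of x y] by auto
  moreover have "star4 a b c d = star4 d c b a"
    unfolding star4_def by (intro sum.cong refl) (simp only: mult_ac)
  ultimately show ?thesis unfolding slide_def by (simp only: mult_ac)
qed

text \<open>Representatives of a configuration in the support of \<^const>\<open>slide\<close>, without the condition that
  the two lines meet; the latter is \<open>bf x2 x3 = bf x1 x3 * bf x0 x2\<close>.\<close>

locale skew_quadrangle =
  fixes x0 x1 x2 x3 :: "3^6"
  assumes sing: "singular x0" "singular x1" "singular x2" "singular x3"
    and b01: "bf x0 x1 = 1" and b12: "bf x1 x2 = 0" and b23: "bf x2 x3 \<noteq> 0" and b03: "bf x0 x3 = 0"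
    and ne: "x2 \<noteq> x1" "x2 \<noteq> - x1" "x3 \<noteq> x0" "x3 \<noteq> - x0"
begin

text \<open>The intermediate points in the threefold composition of slides are spanned by \<open>x0 + s\<close>, \<open>x1 + m s\<close>,
  \<open>x3 + z\<close> and \<open>x2 + e z\<close>, with signs \<open>m\<close> and \<open>e\<close>.\<close>

definition solution :: "3^6 \<Rightarrow> 3 \<Rightarrow> 3^6 \<Rightarrow> 3 \<Rightarrow> bool" where
  "solution s m z e \<longleftrightarrow> bf x0 z \<noteq> 0 \<and> bf x1 z \<noteq> 0 \<and> bf (x0 + s) (x3 + z) = 0
     \<and> signed_relation (x0 + s) (x1 + m *s s) (x2 + e *s z) (x3 + z)"

lemma bf_rev: "bf x1 x0 = 1" "bf x2 x1 = 0" "bf x3 x2 = bf x2 x3" "bf x3 x0 = 0"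
  using b01 b12 b03 by (simp_all add: bf_commute)

lemma sing_perpD:
  assumes "s \<in> sing_perp v w"
  shows "singular s" "bf s v = 0" "bf s w = 0" "bf v s = 0" "bf w s = 0"
  using assms by (auto simp: sing_perp_def perp_def bf_commute)

lemma slide_solution:
  assumes s: "s \<in> sing_perp x0 x1" and z: "z \<in> sing_perp x3 x2" and z0: "bf x0 z \<noteq> 0" and z1: "bf x1 z \<noteq> 0"
  shows "slide (proj_point (x0 + s)) (proj_point (x1 + m *s s)) (proj_point (x2 + e *s z)) (proj_point (x3 + z))
    = of_bool (solution s m z e)"
proof -
  note s' = sing_perpD[OF s] and z' = sing_perpD[OF z]
  have nz: "bf (x0 + s) (x1 + m *s s) \<noteq> 0" "bf (x2 + e *s z) (x3 + z) \<noteq> 0"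
    using s' z' b01 b23 by (simp_all add: bf_simps bf_self)
  then have "x0 + s \<noteq> 0" "x1 + m *s s \<noteq> 0" "x2 + e *s z \<noteq> 0" "x3 + z \<noteq> 0"
    using bf_zero_left bf_zero_right by metis+
  then have sg: "singular (x0 + s)" "singular (x1 + m *s s)" "singular (x2 + e *s z)" "singular (x3 + z)"
    using s' z' sing by (simp_all add: Q_add Q_smult bf_simps)
  have "bf (x3 + z) x0 \<noteq> 0" using z0 bf_rev by (simp add: bf_simps bf_commute)
  moreover have "bf (x0 + s) x0 = 0" "bf (- (x0 + s)) x0 = 0" using s' sing by (simp_all add: bf_simps bf_self)
  ultimately have "x3 + z \<noteq> x0 + s" "x3 + z \<noteq> - (x0 + s)" by metis+
  then show ?thesis
    using slide_eq_signed_relation[OF sg nz] z0 z1 by (simp add: solution_def)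
qed

text \<open>\<open>slide_reverse\<close> lets the last slide start from \<open>x3\<close>,
  \<open>x2\<close>, so that \<open>slide_sum\<close> applies to it as well as to the first one. The
  masks of \<open>slide2\<close> become the conditions on \<open>bf x0 z\<close> and
  \<open>bf x1 z\<close> in \<open>solution\<close>, and the middle slide becomes the signed
  relation.\<close>

lemma slide3_count:
  "slide3 (proj_point x0) (proj_point x1) (proj_point x2) (proj_point x3)
    = (\<Sum>z\<in>sing_perp x3 x2. \<Sum>e\<in>{1, - 1}. \<Sum>s\<in>sing_perp x0 x1. \<Sum>m\<in>{1, - 1}. of_bool (solution s m z e))"
proof -
  let ?a = "proj_point x0" and ?b = "proj_point x1" and ?c = "proj_point x2" and ?d = "proj_point x3"
  have "bf x2 x1 = 0" "bf x3 x0 = 0" by (simp_all add: bf_rev)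
  moreover have "x0 \<noteq> x3" "x0 \<noteq> - x3" using ne by auto
  ultimately have "slide3 ?a ?b ?c ?d = (\<Sum>p\<in>verts. \<Sum>q\<in>verts. slide2 ?a ?b q p * slide p q ?c ?d)"
    unfolding slide3_def nadjb_proj_point[OF sing(1,2)] nadjb_proj_point[OF sing(3,4)] adjb_proj_point[OF sing(2,3)] adjb_proj_point[OF sing(4,1)]
    using b01 b12 b23 ne by simp
  also have "\<dots> = (\<Sum>p\<in>verts. \<Sum>q\<in>verts. slide ?d ?c q p * slide2 ?a ?b q p)"
    by (simp only: slide_reverse[of _ _ ?c ?d] mult.commute)
  also have "\<dots> = (\<Sum>z\<in>sing_perp x3 x2. \<Sum>e\<in>{1, - 1}. slide2 ?a ?b (proj_point (x2 + e *s z)) (proj_point (x3 + z)))"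
    using b23 bf_rev by (intro slide_sum sing) simp
  also have "\<dots> = (\<Sum>z\<in>sing_perp x3 x2. \<Sum>e\<in>{1, - 1}. \<Sum>s\<in>sing_perp x0 x1. \<Sum>m\<in>{1, - 1}. of_bool (solution s m z e))"
  proof (rule sum.cong[OF refl], rule sum.cong[OF refl])
    fix z e assume z: "z \<in> sing_perp x3 x2" and "e \<in> {1, - 1 :: 3}"
    then have e: "e \<noteq> 0" by auto
    note z' = sing_perpD[OF z]
    have nz: "bf (x2 + e *s z) (x3 + z) \<noteq> 0"
      using z' b23 by (simp add: bf_simps bf_self)
    then have "x2 + e *s z \<noteq> 0" "x3 + z \<noteq> 0"
      using bf_zero_left bf_zero_right by metis+
    then have sg: "singular (x2 + e *s z)" "singular (x3 + z)"
      using z' sing by (simp_all add: Q_add Q_smult bf_simps)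
    have n: "nadjb ?b (proj_point (x2 + e *s z)) = of_bool (bf x1 z \<noteq> 0)" "nadjb (proj_point (x3 + z)) ?a = of_bool (bf x0 z \<noteq> 0)"
      unfolding nadjb_proj_point[OF sing(2) sg(1)] nadjb_proj_point[OF sg(2) sing(1)]
      using b12 bf_rev e by (simp_all add: bf_simps F3_mult_eq_0 bf_commute[of z x0])
    have "slide2 ?a ?b (proj_point (x2 + e *s z)) (proj_point (x3 + z))
      = of_bool (bf x1 z \<noteq> 0 \<and> bf x0 z \<noteq> 0) * (\<Sum>p\<in>verts. \<Sum>q\<in>verts.
          slide ?a ?b q p * slide p q (proj_point (x2 + e *s z)) (proj_point (x3 + z)))"
      unfolding slide2_def n nadjb_proj_point[OF sing(1,2)] nadjb_proj_point[OF sg]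
      using b01 nz by (simp only: of_bool_conj) simp
    also have "(\<Sum>p\<in>verts. \<Sum>q\<in>verts.
          slide ?a ?b q p * slide p q (proj_point (x2 + e *s z)) (proj_point (x3 + z)))
      = (\<Sum>s\<in>sing_perp x0 x1. \<Sum>m\<in>{1, - 1}. slide (proj_point (x0 + s)) (proj_point (x1 + m *s s)) (proj_point (x2 + e *s z)) (proj_point (x3 + z)))"
      using b01 by (intro slide_sum sing) simp
    also have "of_bool (bf x1 z \<noteq> 0 \<and> bf x0 z \<noteq> 0) * \<dots> = (\<Sum>s\<in>sing_perp x0 x1. \<Sum>m\<in>{1, - 1}. of_bool (solution s m z e))"
    proof (cases "bf x1 z \<noteq> 0 \<and> bf x0 z \<noteq> 0")
      case True
      then have "(\<Sum>s\<in>sing_perp x0 x1. \<Sum>m\<in>{1, - 1}. slide (proj_point (x0 + s)) (proj_point (x1 + m *s s)) (proj_point (x2 + e *s z)) (proj_point (x3 + z)))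
        = (\<Sum>s\<in>sing_perp x0 x1. \<Sum>m\<in>{1, - 1}. of_bool (solution s m z e))"
        by (intro sum.cong refl) (simp add: slide_solution z)
      then show ?thesis using True by simp
    next
      case False
      then have "\<not> solution s m z e" for s m by (auto simp: solution_def)
      then show ?thesis using False by simp
    qed
    finally show "slide2 ?a ?b (proj_point (x2 + e *s z)) (proj_point (x3 + z))
      = (\<Sum>s\<in>sing_perp x0 x1. \<Sum>m\<in>{1, - 1}. of_bool (solution s m z e))" .
  qed
  finally show ?thesis .
qed

end

section \<open>Solutions when the two lines do not meet\<close>

lemma sum_of_bool_unique:
  assumes "finite A" "finite B" "\<And>x y. x \<in> A \<Longrightarrow> y \<in> B \<Longrightarrow> R x y \<longleftrightarrow> P \<and> x = x' \<and> y = y'"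
    and "P \<Longrightarrow> x' \<in> A \<and> y' \<in> B"
  shows "(\<Sum>x\<in>A. \<Sum>y\<in>B. of_bool (R x y)) = (of_bool P :: real)"
proof (cases P)
  case True
  have "(\<Sum>x\<in>A. \<Sum>y\<in>B. of_bool (R x y)) = (\<Sum>x\<in>A. \<Sum>y\<in>B. if y = y' then if x = x' then 1 else 0 else (0 :: real))"
    using assms(3) True by (intro sum.cong refl) auto
  then show ?thesis using assms True by simp
next
  case False
  then show ?thesis using assms(3) by simp
qed

lemma F3_neq_0_cases: "c = 1 \<or> c = - 1" if "c \<noteq> 0" for c :: 3
  using F3_cases[of c] that by auto

text \<open>The unknowns are the inner products of a solution, multiplied by signs so that the coefficients
  \<open>e\<^sub>1, e\<^sub>2, e\<^sub>3\<close> of the signed relation disappear.\<close>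

lemma skew_scalars:
  fixes t r d p q y0 y1 a b y :: 3
  assumes nz: "t \<noteq> 0" "r \<noteq> 0" "d \<noteq> 0" "y0 \<noteq> 0" "y1 \<noteq> 0"
    and 1: "1 + q + (1 + r) * y0 = 0" and 2: "1 + p + (1 + r) * y1 = 0"
    and 3: "(1 + t) * a + p + d = 0" and 4: "q + (1 + t) * b + d = 0"
    and 5: "a + b + (1 + r) * y = 0" and 6: "y0 + y1 + (1 + t) * y = 0" and 7: "y0 + a + y = 0"
    and ne: "d \<noteq> p * q"
  shows "t = 1 \<and> r = 1 \<and> d = 1 \<and> a = p + 1 \<and> b = q + 1 \<and> p + q = 1 \<and> p \<noteq> - 1 \<and> q \<noteq> - 1"
proof -
  have r: "r = 1"
  proof (rule ccontr)
    assume "r \<noteq> 1"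
    then have r: "r = - 1" using F3_neq_0_cases nz(2) by blast
    have pq: "q = - 1" "p = - 1" using 1 2 F3_cases[of q] F3_cases[of p] by (auto simp: r)
    then have d: "d = - 1" using ne F3_neq_0_cases[OF nz(3)] by auto
    show False using F3_neq_0_cases[OF nz(1)] F3_cases[of a] F3_cases[of b] 3 4 5 by (auto simp: r pq d)
  qed
  have y: "y0 = 1 + q" "y1 = 1 + p"
    using 1 2 F3_cases[of q] F3_cases[of p] F3_neq_0_cases[OF nz(4)] F3_neq_0_cases[OF nz(5)] by (auto simp: r)
  have pq: "p = 0 \<or> p = 1" "q = 0 \<or> q = 1" using nz(4,5) F3_cases[of p] F3_cases[of q] by (auto simp: y)
  have t: "t = 1"
  proof (rule ccontr)
    assume "t \<noteq> 1"
    then have t: "t = - 1" using F3_neq_0_cases nz(1) by blast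
    show False using 3 4 6 ne pq F3_neq_0_cases[OF nz(3)] by (auto simp: y t)
  qed
  have ab: "a = p + d" "b = q + d"
    using 3 4 pq F3_neq_0_cases[OF nz(3)] F3_cases[of a] F3_cases[of b] by (auto simp: t)
  have "d = 1" "p + q = 1"
    using 5 6 7 pq F3_neq_0_cases[OF nz(3)] F3_cases[of y] by (auto simp: ab y r t)
  then show ?thesis using r t ab nz(4,5) y pq by auto
qed

context skew_quadrangle
begin

abbreviation (input) "kap \<equiv> bf x1 x3"
abbreviation (input) "lam \<equiv> bf x0 x2"
abbreviation (input) "dd \<equiv> bf x2 x3"

lemma bf_self_zero: "bf x0 x0 = 0" "bf x1 x1 = 0" "bf x2 x2 = 0" "bf x3 x3 = 0"
  using sing by (simp_all add: bf_self)

text \<open>The first six equations pair the relation with \<open>x0\<close>, \<open>x1\<close>,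
  \<open>x3\<close>, \<open>x2\<close>, \<open>s\<close> and \<open>z\<close>; the last one is
  \<open>o\<close>. They match \<open>skew_scalars\<close> with \<open>t = e2 * m\<close>,
  \<open>r = e1 * e3 * h\<close>, \<open>d = e1 * e2 * e3 * dd\<close>, \<open>p = e1 * kap\<close>,
  \<open>q = e2 * e3 * lam\<close>, and the remaining unknowns are scaled products with
  \<open>z\<close> and \<open>s\<close>.\<close>

lemma relation_scaled:
  assumes s: "s \<in> sing_perp x0 x1" and z: "z \<in> sing_perp x3 x2" and o: "bf (x0 + s) (x3 + z) = 0"
    and e: "e1 \<noteq> 0" "e2 \<noteq> 0" "e3 \<noteq> 0"
    and rel: "x0 + s + e1 *s (x3 + z) + e2 *s (x1 + m *s s) + e3 *s (x2 + h *s z) = 0"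
  shows "1 + e2 * e3 * lam + (1 + e1 * e3 * h) * (e1 * e2 * bf z x0) = 0"
    and "1 + e1 * kap + (1 + e1 * e3 * h) * (e1 * bf z x1) = 0"
    and "(1 + e2 * m) * (e1 * e2 * bf s x3) + e1 * kap + e1 * e2 * e3 * dd = 0"
    and "e2 * e3 * lam + (1 + e2 * m) * (e2 * e3 * bf s x2) + e1 * e2 * e3 * dd = 0"
    and "e1 * e2 * bf s x3 + e2 * e3 * bf s x2 + (1 + e1 * e3 * h) * (e1 * e2 * bf z s) = 0"
    and "e1 * e2 * bf z x0 + e1 * bf z x1 + (1 + e2 * m) * (e1 * e2 * bf z s) = 0"
    and "e1 * e2 * bf z x0 + e1 * e2 * bf s x3 + e1 * e2 * bf z s = 0"
proof -
  let ?V = "x0 + s + e1 *s (x3 + z) + e2 *s (x1 + m *s s) + e3 *s (x2 + h *s z)"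
  note s' = sing_perpD[OF s] and z' = sing_perpD[OF z]
  have self: "bf s s = 0" "bf z z = 0" using s' z' by (simp_all add: bf_self)
  have com: "bf x0 z = bf z x0" "bf x1 z = bf z x1" "bf s z = bf z s" "bf x3 s = bf s x3" "bf x2 s = bf s x2"
    "bf x2 x0 = bf x0 x2" "bf x3 x1 = bf x1 x3" by (simp_all add: bf_commute)
  note R = s'(2-) z'(2-) self com b01 b12 b03 bf_rev bf_self_zero
  have sq: "e1 * e1 = 1" "e2 * e2 = 1" "e3 * e3 = 1" "e1 * (e1 * c) = c" "e2 * (e2 * c) = c" "e3 * (e3 * c) = c" for c
    using e by (simp_all add: F3_square F3_square')
  have V: "bf v ?V = 0" for v unfolding rel by (rule bf_zero_right)
  have "1 + e2 * e3 * lam + (1 + e1 * e3 * h) * (e1 * e2 * bf z x0) = e2 * bf x0 ?V"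
    by (simp add: bf_simps R algebra_simps sq)
  then show "1 + e2 * e3 * lam + (1 + e1 * e3 * h) * (e1 * e2 * bf z x0) = 0" using V by simp
  have "1 + e1 * kap + (1 + e1 * e3 * h) * (e1 * bf z x1) = bf x1 ?V"
    by (simp add: bf_simps R algebra_simps sq)
  then show "1 + e1 * kap + (1 + e1 * e3 * h) * (e1 * bf z x1) = 0" using V by simp
  have "(1 + e2 * m) * (e1 * e2 * bf s x3) + e1 * kap + e1 * e2 * e3 * dd = e1 * e2 * bf x3 ?V"
    by (simp add: bf_simps R algebra_simps sq)
  then show "(1 + e2 * m) * (e1 * e2 * bf s x3) + e1 * kap + e1 * e2 * e3 * dd = 0" using V by simp
  have "e2 * e3 * lam + (1 + e2 * m) * (e2 * e3 * bf s x2) + e1 * e2 * e3 * dd = e2 * e3 * bf x2 ?V"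
    by (simp add: bf_simps R algebra_simps sq)
  then show "e2 * e3 * lam + (1 + e2 * m) * (e2 * e3 * bf s x2) + e1 * e2 * e3 * dd = 0" using V by simp
  have "e1 * e2 * bf s x3 + e2 * e3 * bf s x2 + (1 + e1 * e3 * h) * (e1 * e2 * bf z s) = e2 * bf s ?V"
    by (simp add: bf_simps R algebra_simps sq)
  then show "e1 * e2 * bf s x3 + e2 * e3 * bf s x2 + (1 + e1 * e3 * h) * (e1 * e2 * bf z s) = 0" using V by simp
  have "e1 * e2 * bf z x0 + e1 * bf z x1 + (1 + e2 * m) * (e1 * e2 * bf z s) = e1 * e2 * bf z ?V"
    by (simp add: bf_simps R algebra_simps sq)
  then show "e1 * e2 * bf z x0 + e1 * bf z x1 + (1 + e2 * m) * (e1 * e2 * bf z s) = 0" using V by simp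
  have "e1 * e2 * bf z x0 + e1 * e2 * bf s x3 + e1 * e2 * bf z s = e1 * e2 * bf (x0 + s) (x3 + z)"
    by (simp add: bf_simps R algebra_simps)
  then show "e1 * e2 * bf z x0 + e1 * e2 * bf s x3 + e1 * e2 * bf z s = 0" using o by simp
qed

lemma relation_vector:
  "x0 + s + e1 *s (x3 + z) + e2 *s (x1 + m *s s) + e3 *s (x2 + h *s z)
    = (x0 + e2 *s x1 + e3 *s x2 + e1 *s x3) + (1 + e2 * m) *s s + (e1 + e3 * h) *s z"
  by (simp add: vec_eq_iff algebra_simps)

end

lemma skew_converse_scalars:
  fixes m e r k l :: 3
  assumes "m \<noteq> 0" "e \<noteq> 0" "r \<noteq> 0" "e * k + r * l = 1"
  shows "m + m * (e * k) + (m + m * (r * l)) - r * (m * (l + r)) - e * (m * (k + e)) = 0"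
    and "e * (m + r * (m * l)) + m * (k + e) + e * (r * (m * (l + r)) + e * (m * (k + e))) = 0"
  using F3_neq_0_cases[OF assms(1)] F3_neq_0_cases[OF assms(2)] F3_neq_0_cases[OF assms(3)] F3_cases[of k] F3_cases[of l] assms(4)
  by auto

lemma F3_products:
  fixes e1 e2 e3 h m d al be k l :: 3
  assumes "e1 \<noteq> 0" "e2 \<noteq> 0" "e3 \<noteq> 0" "e2 * m = 1" "e1 * e3 * h = 1" "e1 * e2 * e3 * d = 1"
    "e1 * e2 * al = e1 * k + 1" "e2 * e3 * be = e2 * e3 * l + 1"
  shows "e2 = m" "h = e1 * e3" "e1 = d * (e2 * e3)" "al = m * (k + e1)" "be = l + e2 * e3"
proof -
  have 1: "e2 * (e2 * m) = e2 * 1" using assms by simp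
  show m: "e2 = m" using 1 by (simp only: F3_square'[OF assms(2)] mult_1_right)
  have "e1 * (e3 * h) = 1" using assms by (simp add: mult.assoc)
  then have "e3 * (e1 * (e1 * (e3 * h))) = e3 * (e1 * 1)" by simp
  then show "h = e1 * e3" using assms by (simp add: F3_square' mult.commute)
  show "e1 = d * (e2 * e3)"
    using F3_neq_0_cases[OF assms(1)] F3_neq_0_cases[OF assms(2)] F3_neq_0_cases[OF assms(3)] F3_cases[of d] assms(6)
    by auto
  have "e2 * (e1 * (e1 * (e2 * al))) = e2 * (e1 * (e1 * k + 1))"
    using assms(7) by (simp add: mult.assoc)
  then show "al = m * (k + e1)"
    using assms(1,2) by (simp add: F3_square' m[symmetric] distrib_left)
  have "e3 * (e2 * (e2 * (e3 * be))) = e3 * (e2 * (e2 * (e3 * l) + 1))"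
    using assms(8) by (simp add: mult.assoc)
  then show "be = l + e2 * e3"
    using assms(2,3) by (simp add: F3_square' distrib_left mult.commute[of e3 e2])
qed

context skew_quadrangle
begin

text \<open>The coefficient \<open>e\<^sub>2 e\<^sub>3\<close> of the relation behind a solution; it is determined by the quadrangle.\<close>

definition rho :: 3 where
  "rho = (if lam = 0 then dd * kap else lam)"

text \<open>The vector \<open>z\<close> solved from the signed relation, whose coefficients are
  \<open>e1 = dd * rho\<close>, \<open>e2 = m\<close> and \<open>e3 = rho * m\<close>.\<close>

definition target :: "3^6 \<Rightarrow> 3 \<Rightarrow> 3^6" where
  "target s m = (dd * rho) *s (x0 + m *s x1 + (rho * m) *s x2 + (dd * rho) *s x3 - s)"

lemma solution_skewD:
  assumes D: "dd \<noteq> kap * lam" and s: "s \<in> sing_perp x0 x1" and z: "z \<in> sing_perp x3 x2" and m: "m \<noteq> 0" and h: "h \<noteq> 0"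
    and sol: "solution s m z h"
  shows "bf s x3 = m * (kap + dd * rho) \<and> bf s x2 = lam + rho \<and> z = target s m \<and> h = dd * m"
    and "(kap = 0) \<noteq> (lam = 0)"
proof -
  obtain e1 e2 e3 where e: "e1 \<noteq> 0" "e2 \<noteq> 0" "e3 \<noteq> 0"
    and rel: "x0 + s + e1 *s (x3 + z) + e2 *s (x1 + m *s s) + e3 *s (x2 + h *s z) = 0"
    using sol unfolding solution_def signed_relation_def by blast
  have o: "bf (x0 + s) (x3 + z) = 0" and nz: "bf z x0 \<noteq> 0" "bf z x1 \<noteq> 0"
    using sol by (auto simp: solution_def bf_commute)
  note eqs = relation_scaled[OF s z o e rel]
  have "e2 * m \<noteq> 0" "e1 * e3 * h \<noteq> 0" "e1 * e2 * e3 * dd \<noteq> 0" "e1 * e2 * bf z x0 \<noteq> 0" "e1 * bf z x1 \<noteq> 0"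
    using e m h nz b23 by (simp_all add: F3_mult_eq_0)
  moreover have "e1 * e2 * e3 * dd \<noteq> e1 * kap * (e2 * e3 * lam)"
  proof
    assume "e1 * e2 * e3 * dd = e1 * kap * (e2 * e3 * lam)"
    then have "(e1 * e2 * e3) * (dd - kap * lam) = 0" by (simp add: algebra_simps)
    then show False using e D by (simp add: F3_mult_eq_0)
  qed
  ultimately have sc: "e2 * m = 1" "e1 * e3 * h = 1" "e1 * e2 * e3 * dd = 1" "e1 * e2 * bf s x3 = e1 * kap + 1"
    "e2 * e3 * bf s x2 = e2 * e3 * lam + 1" and sum: "e1 * kap + e2 * e3 * lam = 1" and ne: "e1 * kap \<noteq> - 1" "e2 * e3 * lam \<noteq> - 1"
    using skew_scalars[OF _ _ _ _ _ eqs] by blast+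
  note pr = F3_products[OF e sc]
  \<comment> \<open>The scaled numbers \<open>e1 * kap\<close> and \<open>e2 * e3 * lam\<close> sum
    to 1 and neither is -1, so one is 0 and the other 1; the nonzero one determines
    \<open>e2 * e3\<close>.\<close>
  have lk: "(kap = 0) \<noteq> (lam = 0) \<and> e2 * e3 = rho"
    using F3_neq_0_cases[OF e(1)] F3_neq_0_cases[OF e(2)] F3_neq_0_cases[OF e(3)] F3_cases[of kap] F3_cases[of lam]
      F3_neq_0_cases[OF b23] sum ne sc(3) unfolding rho_def by auto
  then show "(kap = 0) \<noteq> (lam = 0)" by blast
  have e1: "e1 = dd * rho" using pr(3) lk by simp
  have e3: "e3 = rho * m" using lk F3_square'[OF m, of e3] by (auto simp: pr(1) mult.commute)
  have hm: "h = dd * m" using lk F3_square[of rho] e pr(1) by (simp add: pr(2) e1 e3 F3_mult_eq_0) (simp add: F3_square' mult_ac)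
  \<comment> \<open>Both use 2 = -1, with \<open>e2 * m = 1\<close> and
    \<open>e3 * h = e1\<close>.\<close>
  have c: "1 + e2 * m = - 1" "e1 + e3 * h = - e1"
    using sc(1) F3_neq_0_cases[OF e(1)] F3_neq_0_cases[OF e(3)] sc(2) F3_neq_0_cases[OF h] by auto
  then have "(x0 + m *s x1 + (rho * m) *s x2 + (dd * rho) *s x3) - s - e1 *s z = 0"
    using rel unfolding relation_vector c by (simp add: smult_minus_left smult_minus_one pr(1) e3[symmetric] e1[symmetric])
  then have "e1 *s (e1 *s z) = target s m" unfolding target_def e1[symmetric] by simp
  then have "z = target s m" using F3_square[OF e(1)] by (simp add: vector_smult_assoc)
  then show "bf s x3 = m * (kap + dd * rho) \<and> bf s x2 = lam + rho \<and> z = target s m \<and> h = dd * m"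
    using pr(4,5) lk hm by (simp add: e1[symmetric])
qed

lemma rho_eq:
  assumes "(kap = 0) \<noteq> (lam = 0)"
  shows "rho \<noteq> 0" "(dd * rho) * kap + rho * lam = 1" "kap + dd * rho \<noteq> 0" "lam + rho \<noteq> 0"
  using assms F3_cases[of kap] F3_cases[of lam] F3_neq_0_cases[OF b23] by (auto simp: rho_def)

text \<open>The prescribed products of \<open>s\<close> are what makes \<open>w\<close> orthogonal
  to \<open>x3\<close> and \<open>x2\<close>. Pairing \<open>w\<close> with its own defining
  combination then shows that it is singular.\<close>

lemma solution_skewI:
  assumes kl: "(kap = 0) \<noteq> (lam = 0)" and s: "s \<in> sing_perp x0 x1" and m: "m \<noteq> 0"
    and al: "bf s x3 = m * (kap + dd * rho)" and be: "bf s x2 = lam + rho"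
  shows "target s m \<in> sing_perp x3 x2" "solution s m (target s m) (dd * m)"
proof -
  define e where "e = dd * rho"
  define w where "w = x0 + m *s x1 + (rho * m) *s x2 + e *s x3 - s"
  have t: "target s m = e *s w" by (simp add: target_def w_def e_def)
  note rho = rho_eq[OF kl, folded e_def]
  have e: "e \<noteq> 0" using rho(1) b23 by (simp add: e_def F3_mult_eq_0)
  have de: "dd * e = rho" using F3_square'[OF b23] by (simp add: e_def)
  have re: "rho * dd = e" by (simp add: e_def)
  note s' = sing_perpD[OF s]
  have self: "bf s s = 0" using s' by (simp add: bf_self)
  have com: "bf x3 s = bf s x3" "bf x2 s = bf s x2" "bf x2 x0 = bf x0 x2" "bf x3 x1 = bf x1 x3" by (simp_all add: bf_commute)
  note R = s'(2-) self com b01 b12 b03 bf_rev bf_self_zero al[folded e_def] be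
  have w3: "bf w x3 = 0" using re by (simp add: w_def bf_simps R algebra_simps)
  have w2: "bf w x2 = 0" using de by (simp add: w_def bf_simps R algebra_simps)
  have w0: "bf w x0 = m + rho * (m * lam)" by (simp add: w_def bf_simps R mult.assoc)
  have w1: "bf w x1 = 1 + e * kap" by (simp add: w_def bf_simps R)
  have ws: "bf w s = rho * (m * (lam + rho)) + e * (m * (kap + e))" by (simp add: w_def bf_simps R mult.assoc)
  have "bf w w = bf w x0 + m * bf w x1 + (rho * m) * bf w x2 + e * bf w x3 - bf w s"
    by (subst (2) w_def) (simp only: bf_simps)
  also have "\<dots> = 0"
    using skew_converse_scalars(1)[OF m e rho(1,2)] unfolding w0 w1 w2 w3 ws by (simp add: algebra_simps)
  finally have Qw: "Q_minus w = 0" by (simp add: bf_self)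
  have nz: "bf w x0 \<noteq> 0" "bf w x1 \<noteq> 0"
    using F3_neq_0_cases[OF m] F3_neq_0_cases[OF e] F3_neq_0_cases[OF rho(1)] F3_cases[of kap] F3_cases[of lam] kl rho(2)
    unfolding w0 w1 by auto
  then have "w \<noteq> 0" by (auto simp: bf_simps)
  then show "target s m \<in> sing_perp x3 x2"
    using e Qw w2 w3 by (auto simp: t sing_perp_def perp_def bf_simps Q_smult vec_eq_iff F3_mult_eq_0)
  have com': "bf x0 w = bf w x0" "bf x1 w = bf w x1" "bf s w = bf w s" by (simp_all add: bf_commute)
  have "bf (x0 + s) (x3 + target s m) = e * (m + rho * (m * lam)) + m * (kap + e) + e * (rho * (m * (lam + rho)) + e * (m * (kap + e)))"
    by (simp add: t bf_simps R com' w0 ws algebra_simps)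
  then have o: "bf (x0 + s) (x3 + target s m) = 0"
    using skew_converse_scalars(2)[OF m e rho(1,2)] by simp
  have c: "1 + m * m = - 1" "e + rho * m * (dd * m) = - e"
    using F3_neq_0_cases[OF m] F3_neq_0_cases[OF e] re by (auto simp: algebra_simps)
  have "(- e) *s (e *s w) = - w"
    by (simp add: smult_minus_left vector_smult_assoc F3_square[OF e])
  then have "x0 + s + e *s (x3 + target s m) + m *s (x1 + m *s s) + (rho * m) *s (x2 + (dd * m) *s target s m) = 0"
    unfolding relation_vector c t by (simp add: w_def smult_minus_one)
  moreover have "rho * m \<noteq> 0" using rho(1) m by (simp add: F3_mult_eq_0)
  ultimately have "signed_relation (x0 + s) (x1 + m *s s) (x2 + (dd * m) *s target s m) (x3 + target s m)"
    unfolding signed_relation_def using e m by blast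
  then show "solution s m (target s m) (dd * m)"
    using o nz e by (simp add: solution_def t bf_simps com' F3_mult_eq_0)
qed

end

section \<open>Solutions when the two lines meet, and the two values of the threefold slide\<close>

lemma degenerate_scalars:
  fixes t r h p q y0 y1 a :: 3
  assumes nz: "t \<noteq> 0" "r \<noteq> 0" "h \<noteq> 0" "p \<noteq> 0" "q \<noteq> 0" "y1 \<noteq> 0"
    and 1: "1 + q + (1 + r) * y0 = 0" and 2: "1 + p + (1 + r) * y1 = 0" and 3: "(1 + t) * a + p + p * q = 0"
    and y: "y0 = h * (p * (q * y1))"
  shows "r = - 1 \<and> p = - 1 \<and> q = - 1 \<or> r = 1 \<and> p = 1 \<and> q = 1 \<and> h = 1 \<and> t = 1"
  using F3_neq_0_cases[OF nz(1)] F3_neq_0_cases[OF nz(2)] F3_neq_0_cases[OF nz(3)] F3_neq_0_cases[OF nz(4)]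
    F3_neq_0_cases[OF nz(5)] F3_neq_0_cases[OF nz(6)] 1 2 3 y by auto

lemma signed_relationI:
  assumes "e \<noteq> 0" "f \<noteq> 0" "g \<noteq> 0" "a + e *s d + f *s b + g *s c = 0"
  shows "signed_relation a b c d"
  unfolding signed_relation_def using assms by blast

context skew_quadrangle
begin

text \<open>\<open>sigma\<close> and \<open>tau\<close> are the components of \<open>x3\<close> and
  \<open>x2\<close> orthogonal to \<open>x0\<close> and \<open>x1\<close>. They are singular, and
  their product \<open>dd - kap * lam\<close> vanishes precisely when they are proportional, which
  is the case of meeting lines.\<close>

definition sigma :: "3^6" where
  "sigma = x3 - kap *s x0"

definition tau :: "3^6" where
  "tau = x2 - lam *s x1"

lemma com: "bf x2 x0 = lam" "bf x3 x1 = kap"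
  by (simp_all add: bf_commute)

lemma sigma_perp: "sigma \<in> perp {x0, x1}" "Q_minus sigma = 0" "sigma \<noteq> 0"
  and tau_perp: "tau \<in> perp {x0, x1}" "Q_minus tau = 0" "tau \<noteq> 0"
proof -
  show "sigma \<in> perp {x0, x1}" "tau \<in> perp {x0, x1}"
    using b01 b12 b03 bf_rev bf_self_zero by (simp_all add: sigma_def tau_def perp_def bf_simps com)
  show "Q_minus sigma = 0" "Q_minus tau = 0"
    using sing b03 b12 bf_rev by (simp_all add: sigma_def tau_def Q_diff Q_smult bf_simps)
  show "sigma \<noteq> 0"
  proof
    assume "sigma = 0"
    then have "x3 = kap *s x0" by (simp add: sigma_def)
    then show False using F3_cases[of kap] sing ne by (auto simp: smult_minus_one)
  qed
  show "tau \<noteq> 0"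
  proof
    assume "tau = 0"
    then have "x2 = lam *s x1" by (simp add: tau_def)
    then show False using F3_cases[of lam] sing ne by (auto simp: smult_minus_one)
  qed
qed

lemma bf_sigma_tau: "bf sigma tau = dd - kap * lam"
  using b01 bf_rev by (simp add: sigma_def tau_def bf_simps com mult.commute)

lemma bf_sigma_tau_perp:
  assumes "s \<in> perp {x0, x1}"
  shows "bf s sigma = bf s x3" "bf s tau = bf s x2"
  using assms by (simp_all add: sigma_def tau_def perp_def bf_simps)

lemma card_prescribed_products:
  assumes D: "dd \<noteq> kap * lam" and r: "r \<noteq> 0" "t \<noteq> 0"
  shows "card {s \<in> sing_perp x0 x1. bf s x3 = r \<and> bf s x2 = t} = 4"
proof -
  have "{s \<in> sing_perp x0 x1. bf s x3 = r \<and> bf s x2 = t}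
    = {s \<in> perp {x0, x1}. Q_minus s = 0 \<and> bf s sigma = r \<and> bf s tau = t}"
    using r by (auto simp: sing_perp_def bf_sigma_tau_perp bf_simps)
  also have "card \<dots> = 4"
    using sing b01 sigma_perp tau_perp D r by (intro card_singular_with_two_products) (simp_all add: bf_sigma_tau)
  finally show ?thesis .
qed

text \<open>The number 8 is 2 * 4: two signs \<open>m\<close>, and for each four vectors
  \<open>s\<close> with the prescribed products; \<open>z\<close> and \<open>e\<close> are then
  determined.\<close>

lemma slide3_skew:
  assumes D: "dd \<noteq> kap * lam"
  shows "slide3 (proj_point x0) (proj_point x1) (proj_point x2) (proj_point x3) = 8 * of_bool ((kap = 0) \<noteq> (lam = 0))"
proof (cases "(kap = 0) \<noteq> (lam = 0)")
  case False
  then have "\<not> solution s m z e" if "s \<in> sing_perp x0 x1" "z \<in> sing_perp x3 x2" "m \<in> {1, - 1}" "e \<in> {1, - 1}" for s m z e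
    using solution_skewD(2)[OF D that(1,2), of m e] that by auto
  then show ?thesis unfolding slide3_count using False by simp
next
  case True
  let ?P = "\<lambda>s m. bf s x3 = m * (kap + dd * rho) \<and> bf s x2 = lam + rho"
  have "slide3 (proj_point x0) (proj_point x1) (proj_point x2) (proj_point x3)
      = (\<Sum>z\<in>sing_perp x3 x2. \<Sum>s\<in>sing_perp x0 x1. \<Sum>m\<in>{1, - 1}. \<Sum>e\<in>{1, - 1}. of_bool (solution s m z e))"
    unfolding slide3_count
    by (rule sum.cong[OF refl], subst sum.swap, rule sum.cong[OF refl], rule sum.swap)
  also have "\<dots> = (\<Sum>s\<in>sing_perp x0 x1. \<Sum>m\<in>{1, - 1}. \<Sum>z\<in>sing_perp x3 x2. \<Sum>e\<in>{1, - 1}. of_bool (solution s m z e))"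
    by (subst sum.swap, rule sum.cong[OF refl], rule sum.swap)
  also have "\<dots> = (\<Sum>s\<in>sing_perp x0 x1. \<Sum>m\<in>{1, - 1}. of_bool (?P s m))"
  proof (rule sum.cong[OF refl], rule sum.cong[OF refl])
    fix s and m :: 3
    assume s: "s \<in> sing_perp x0 x1" and "m \<in> {1, - 1}"
    then have m: "m \<noteq> 0" by auto
    show "(\<Sum>z\<in>sing_perp x3 x2. \<Sum>e\<in>{1, - 1}. of_bool (solution s m z e)) = (of_bool (?P s m) :: real)"
    proof (rule sum_of_bool_unique)
      fix z e assume z: "z \<in> sing_perp x3 x2" and "e \<in> {1, - 1 :: 3}"
      then have e: "e \<noteq> 0" by auto
      show "solution s m z e \<longleftrightarrow> ?P s m \<and> z = target s m \<and> e = dd * m"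
        using solution_skewD(1)[OF D s z m e] solution_skewI(2)[OF True s m] by blast
    next
      assume "?P s m"
      moreover have "dd * m \<in> {1, - 1}" using F3_neq_0_cases[of "dd * m"] m b23 by (simp add: F3_mult_eq_0)
      ultimately show "target s m \<in> sing_perp x3 x2 \<and> dd * m \<in> {1, - 1}"
        using solution_skewI(1)[OF True s m] by blast
    qed simp_all
  qed
  also have "\<dots> = (\<Sum>m\<in>{1, - 1}. real (card {s \<in> sing_perp x0 x1. ?P s m}))"
    by (subst sum.swap) (simp add: Int_def)
  also have "\<dots> = (\<Sum>m\<in>{1, - 1 :: 3}. 4)"
  proof (rule sum.cong[OF refl])
    fix m :: 3 assume "m \<in> {1, - 1}"
    then have "m \<noteq> 0" by auto
    then show "real (card {s \<in> sing_perp x0 x1. ?P s m}) = 4"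
      using card_prescribed_products[OF D, of "m * (kap + dd * rho)" "lam + rho"] rho_eq[OF True] by (simp add: F3_mult_eq_0)
  qed
  finally show ?thesis using True by simp
qed

lemma signed_relation_iff_degenerate:
  "signed_relation x0 x1 x2 x3 \<Longrightarrow> dd = kap * lam"
proof -
  assume "signed_relation x0 x1 x2 x3"
  then obtain e f g where e: "g \<noteq> 0" "x0 + e *s x3 + f *s x1 + g *s x2 = 0"
    unfolding signed_relation_def by blast
  have V: "bf v (x0 + e *s x3 + f *s x1 + g *s x2) = 0" for v unfolding e(2) by (rule bf_zero_right)
  have f: "f = - (g * lam)" using V[of x0] b01 b03 bf_self_zero by (simp add: bf_simps eq_neg_iff_add_eq_0)
  have "f * kap + g * dd = 0" using V[of x3] bf_rev bf_self_zero by (simp add: bf_simps com)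
  then have "g * (dd - kap * lam) = 0" by (simp add: f algebra_simps)
  then show ?thesis using e(1) by (simp add: F3_mult_eq_0)
qed

end

text \<open>If the lines meet, \<open>sigma\<close> and \<open>tau\<close> agree up to sign.
  Changing the sign of \<open>x2\<close> makes them equal, which is the equation assumed
  here.\<close>

locale degenerate_quadrangle = skew_quadrangle +
  assumes x2: "x2 = x3 - bf x1 x3 *s x0 + bf x0 x2 *s x1"
begin

lemma dd_eq: "dd = kap * lam"
proof -
  have "dd = bf x3 (x3 - kap *s x0 + lam *s x1)" unfolding x2[symmetric] by (rule bf_rev(3)[symmetric])
  then show ?thesis using bf_rev bf_self_zero by (simp add: bf_simps com mult.commute)
qed

lemma kap_lam: "kap \<noteq> 0" "lam \<noteq> 0"
  using b23 unfolding dd_eq by (simp_all add: F3_mult_eq_0)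

lemma bf_z:
  assumes z: "z \<in> sing_perp x3 x2"
  shows "bf z x0 = kap * (lam * bf z x1)" and "bf z sigma = - (lam * bf z x1)"
proof -
  note z' = sing_perpD[OF z]
  have "bf z x2 = - (kap * bf z x0) + lam * bf z x1"
    by (subst x2) (simp add: bf_simps z')
  then have 1: "kap * bf z x0 = lam * bf z x1" using z' by (simp add: eq_neg_iff_add_eq_0)
  then have "kap * (kap * bf z x0) = kap * (lam * bf z x1)" by simp
  then show "bf z x0 = kap * (lam * bf z x1)" using F3_square'[OF kap_lam(1)] by simp
  show "bf z sigma = - (lam * bf z x1)" by (simp add: sigma_def bf_simps z' 1)
qed

text \<open>For this \<open>s\<close>, the vector \<open>x0 + s\<close> is \<open>kap *s x3\<close>,
  and with \<open>m = kap * lam\<close> also \<open>x1 + m *s s\<close> is \<open>lam *s x2\<close>: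
  the first slide already arrives at the far pair. It is the only \<open>s\<close> that admits the
  sign -1 in \<open>solution_degenerate\<close>.\<close>

lemma base_solution:
  "kap *s sigma \<in> sing_perp x0 x1" "z \<in> sing_perp x3 x2 \<Longrightarrow> bf (x0 + kap *s sigma) (x3 + z) = 0"
proof -
  show "kap *s sigma \<in> sing_perp x0 x1"
    using sigma_perp kap_lam perp_smult by (auto simp: sing_perp_def Q_smult vec_eq_iff F3_mult_eq_0)
  assume z: "z \<in> sing_perp x3 x2"
  have "bf sigma x3 = 0" using b03 bf_self_zero by (simp add: sigma_def bf_simps)
  moreover have "bf sigma z = - (lam * bf z x1)" "bf x0 z = kap * (lam * bf z x1)"
    using bf_z[OF z] by (simp_all add: bf_commute)
  ultimately show "bf (x0 + kap *s sigma) (x3 + z) = 0" using b03 by (simp add: bf_simps)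
qed

text \<open>Pairing the relation leaves two sign patterns. One fixes all signs, with
  \<open>h = 1\<close>. In the other the coefficient of \<open>z\<close> vanishes, so the vector
  equation either has coefficient 0 at \<open>s\<close> as well or can be solved for
  \<open>s\<close>, giving \<open>kap *s sigma\<close>.\<close>

lemma solution_degenerate:
  assumes s: "s \<in> sing_perp x0 x1" and z: "z \<in> sing_perp x3 x2" and m: "m \<noteq> 0" and h: "h \<noteq> 0"
  shows "solution s m z h \<longleftrightarrow> bf z x1 \<noteq> 0 \<and> bf (x0 + s) (x3 + z) = 0 \<and> m = kap * lam \<and> (h = 1 \<or> h = - 1 \<and> s = kap *s sigma)"
proof
  assume sol: "solution s m z h"
  obtain e1 e2 e3 where e: "e1 \<noteq> 0" "e2 \<noteq> 0" "e3 \<noteq> 0"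
    and rel: "x0 + s + e1 *s (x3 + z) + e2 *s (x1 + m *s s) + e3 *s (x2 + h *s z) = 0"
    using sol unfolding solution_def signed_relation_def by blast
  have o: "bf (x0 + s) (x3 + z) = 0" and nz: "bf z x1 \<noteq> 0"
    using sol by (auto simp: solution_def bf_commute)
  note eqs = relation_scaled[OF s z o e rel]
  have cases: "e1 * e3 * h = - 1 \<and> e1 * kap = - 1 \<and> e2 * e3 * lam = - 1 \<or>
    e1 * e3 * h = 1 \<and> e1 * kap = 1 \<and> e2 * e3 * lam = 1 \<and> e1 * e3 = 1 \<and> e2 * m = 1"
  proof (rule degenerate_scalars[where a = "e1 * e2 * bf s x3"])
    show "e2 * m \<noteq> 0" "e1 * e3 * h \<noteq> 0" "e1 * e3 \<noteq> 0" "e1 * kap \<noteq> 0" "e2 * e3 * lam \<noteq> 0" "e1 * bf z x1 \<noteq> 0"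
      using e m h nz kap_lam by (simp_all add: F3_mult_eq_0)
    show "1 + e2 * e3 * lam + (1 + e1 * e3 * h) * (e1 * e2 * bf z x0) = 0"
      "1 + e1 * kap + (1 + e1 * e3 * h) * (e1 * bf z x1) = 0" by (fact eqs)+
    show "(1 + e2 * m) * (e1 * e2 * bf s x3) + e1 * kap + e1 * kap * (e2 * e3 * lam) = 0"
      using eqs(3) unfolding dd_eq by (simp add: mult_ac)
    show "e1 * e2 * bf z x0 = e1 * e3 * (e1 * kap * (e2 * e3 * lam * (e1 * bf z x1)))"
      unfolding bf_z(1)[OF z] by (simp add: mult_ac F3_square'[OF e(1)] F3_square'[OF e(3)])
  qed
  have "m = kap * lam \<and> (h = 1 \<or> h = - 1 \<and> s = kap *s sigma)"
    using cases
  proof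
    assume c: "e1 * e3 * h = 1 \<and> e1 * kap = 1 \<and> e2 * e3 * lam = 1 \<and> e1 * e3 = 1 \<and> e2 * m = 1"
    then show ?thesis
      using F3_neq_0_cases[OF e(1)] F3_neq_0_cases[OF e(2)] F3_neq_0_cases[OF e(3)]
        F3_neq_0_cases[OF kap_lam(1)] F3_neq_0_cases[OF kap_lam(2)] F3_neq_0_cases[OF m] F3_neq_0_cases[OF h] by auto
  next
    assume c: "e1 * e3 * h = - 1 \<and> e1 * kap = - 1 \<and> e2 * e3 * lam = - 1"
    then have e12: "e1 = - kap" "e2 = - (e3 * lam)" "h = kap * e3"
      using F3_neq_0_cases[OF e(1)] F3_neq_0_cases[OF e(2)] F3_neq_0_cases[OF e(3)]
        F3_neq_0_cases[OF kap_lam(1)] F3_neq_0_cases[OF kap_lam(2)] F3_neq_0_cases[OF h] by auto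
    have C: "e1 + e3 * h = 0" by (simp add: e12 mult.commute[of kap e3] F3_square'[OF e(3)])
    have V: "x0 + e2 *s x1 + e3 *s x2 + e1 *s x3 + (1 + e2 * m) *s s = 0"
      using rel unfolding relation_vector C by simp
    have W: "x0 + e2 *s x1 + e3 *s x2 + e1 *s x3 = (1 - e3 * kap) *s x0 + (e3 - kap) *s x3"
    proof -
      have "e3 *s x2 = e3 *s x3 - (e3 * kap) *s x0 + (e3 * lam) *s x1"
        by (subst x2) (simp add: vec_eq_iff algebra_simps)
      then show ?thesis by (simp add: e12 vec_eq_iff algebra_simps)
    qed
    have A: "e2 * m = 1 \<or> e2 * m = - 1" using F3_neq_0_cases e m by (simp add: F3_mult_eq_0)
    have "e3 = kap \<or> e3 = - kap" using F3_neq_0_cases[OF kap_lam(1)] F3_neq_0_cases[OF e(3)] by auto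
    then show ?thesis
    proof
      assume e3: "e3 = kap"
      then have "(1 + e2 * m) *s s = 0" using V unfolding W by (simp add: F3_square kap_lam)
      then have "e2 * m = - 1" using A sing_perpD(1)[OF s] by (auto simp: vec_eq_iff F3_mult_eq_0)
      then have "m = kap * lam" "h = 1"
        using F3_neq_0_cases[OF kap_lam(1)] F3_neq_0_cases[OF kap_lam(2)] F3_neq_0_cases[OF m] by (auto simp: e12 e3)
      then show ?thesis by blast
    next
      assume e3: "e3 = - kap"
      have "(1 - e3 * kap) *s x0 + (e3 - kap) *s x3 = kap *s sigma"
        using F3_neq_0_cases[OF kap_lam(1)] by (auto simp: e3 sigma_def vec_eq_iff F3_three)
      then have V: "kap *s sigma + (1 + e2 * m) *s s = 0" using V unfolding W by simp
      have "e2 * m \<noteq> - 1"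
      proof
        assume "e2 * m = - 1"
        then have "1 + e2 * m = 0" by simp
        then have "kap *s sigma = 0" using V by (simp only: vector_smult_lzero add_0_right)
        then show False using sing_perpD(1)[OF base_solution(1)] by blast
      qed
      then have em: "e2 * m = 1" using A by blast
      have "m = kap * lam" "h = - 1"
        using em F3_neq_0_cases[OF kap_lam(1)] F3_neq_0_cases[OF kap_lam(2)] F3_neq_0_cases[OF m] by (auto simp: e12 e3)
      moreover have "(1 + e2 * m) = - 1" by (simp add: em)
      then have "kap *s sigma - s = 0" using V by (simp only: smult_minus_one diff_conv_add_uminus)
      ultimately show ?thesis by simp
    qed
  qed
  then show "bf z x1 \<noteq> 0 \<and> bf (x0 + s) (x3 + z) = 0 \<and> m = kap * lam \<and> (h = 1 \<or> h = - 1 \<and> s = kap *s sigma)"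
    using o nz by blast
next
  assume *: "bf z x1 \<noteq> 0 \<and> bf (x0 + s) (x3 + z) = 0 \<and> m = kap * lam \<and> (h = 1 \<or> h = - 1 \<and> s = kap *s sigma)"
  have sq: "kap * kap = 1" "lam * lam = 1" using kap_lam by (simp_all add: F3_square)
  have kl: "kap * lam \<noteq> 0" using kap_lam by (simp add: F3_mult_eq_0)
  have x2': "c *s x2 = c *s x3 - (c * kap) *s x0 + (c * lam) *s x1" for c
    by (subst x2) (simp add: vec_eq_iff algebra_simps)
  have "signed_relation (x0 + s) (x1 + m *s s) (x2 + h *s z) (x3 + z)"
  proof (cases "h = 1")
    case True
    have c: "1 + - (kap * lam) * (kap * lam) = 0" "- kap + kap * 1 = 0"
      using F3_square[OF kl] by simp_all
    have "x0 + s + (- kap) *s (x3 + z) + (- (kap * lam)) *s (x1 + (kap * lam) *s s) + kap *s (x2 + 1 *s z) = 0"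
      unfolding relation_vector c x2' by (simp add: sq smult_minus_left)
    moreover have "- kap \<noteq> 0" "- (kap * lam) \<noteq> 0" using kap_lam kl by simp_all
    moreover have "m = kap * lam" using * by blast
    ultimately show ?thesis using signed_relationI[OF _ _ kap_lam(1)] True by metis
  next
    case False
    then have h: "h = - 1" and s: "s = kap *s sigma" using * by auto
    have c: "1 + kap * lam * (kap * lam) = - 1" "- kap + (- kap) * (- 1) = 0"
      using F3_square[OF kl] by simp_all
    have ks: "kap *s sigma = kap *s x3 - x0"
      unfolding sigma_def by (simp add: vec_eq_iff algebra_simps F3_square[OF kap_lam(1)])
    have kk: "- kap + - kap = kap" using F3_cases[of kap] by auto
    have "(- kap) *s x2 + (- kap) *s x3 = (- kap + - kap) *s x3 + x0 - (kap * lam) *s x1"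
      unfolding x2' by (simp add: vec_eq_iff algebra_simps F3_square[OF kap_lam(1)])
    then have k3: "(- kap) *s x2 + (- kap) *s x3 = kap *s x3 + x0 - (kap * lam) *s x1"
        unfolding kk .
    have "x0 + s + (- kap) *s (x3 + z) + (kap * lam) *s (x1 + (kap * lam) *s s) + (- kap) *s (x2 + (- 1) *s z)
      = x0 + (kap * lam) *s x1 + ((- kap) *s x2 + (- kap) *s x3) - s"
      unfolding relation_vector c by (simp add: smult_minus_one)
    also have "\<dots> = x0 + x0 + x0" unfolding k3 s ks by simp
    also have "\<dots> = 0"
    proof -
      have "c + c + c = 0" for c :: 3 using F3_cases[of c] by auto
      then show ?thesis by (simp add: vec_eq_iff)
    qed
    finally have "x0 + s + (- kap) *s (x3 + z) + (kap * lam) *s (x1 + (kap * lam) *s s) + (- kap) *s (x2 + (- 1) *s z) = 0" .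
    moreover have "- kap \<noteq> 0" using kap_lam by simp
    moreover have "m = kap * lam" using * by blast
    ultimately show ?thesis using signed_relationI[OF _ kl] h by metis
  qed
  moreover have "bf z x0 \<noteq> 0" unfolding bf_z(1)[OF z] using * kap_lam by (simp add: F3_mult_eq_0)
  ultimately show "solution s m z h" using * by (simp add: solution_def bf_commute)
qed

text \<open>By \<open>bf_z\<close>, the product with \<open>x1\<close> amounts to the product with
  \<open>sigma\<close>, a singular vector that is also orthogonal to \<open>x3\<close> and
  \<open>x2\<close>.\<close>

lemma card_z:
  assumes r: "r \<noteq> 0"
  shows "card {z \<in> sing_perp x3 x2. bf z x1 = r} = 9"
proof -
  have sp: "sigma \<in> perp {x3, x2}"
    using b03 b01 bf_rev bf_self_zero dd_eq by (simp add: sigma_def perp_def bf_simps com)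
  have "{z \<in> sing_perp x3 x2. bf z x1 = r} = {z \<in> perp {x3, x2}. Q_minus z = 0 \<and> bf z sigma = - (lam * r)}"
  proof (intro equalityI subsetI)
    fix z assume "z \<in> {z \<in> sing_perp x3 x2. bf z x1 = r}"
    then show "z \<in> {z \<in> perp {x3, x2}. Q_minus z = 0 \<and> bf z sigma = - (lam * r)}"
      using bf_z(2)[of z] by (simp add: sing_perp_def)
  next
    fix z assume z: "z \<in> {z \<in> perp {x3, x2}. Q_minus z = 0 \<and> bf z sigma = - (lam * r)}"
    then have "bf z sigma \<noteq> 0" using r kap_lam by (simp add: F3_mult_eq_0)
    then have "z \<noteq> 0" by (auto simp: bf_simps)
    then have zs: "z \<in> sing_perp x3 x2" using z by (simp add: sing_perp_def)
    then have "lam * bf z x1 = lam * r" using bf_z(2)[OF zs] z by simp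
    then have "lam * (lam * bf z x1) = lam * (lam * r)" by simp
    then show "z \<in> {z \<in> sing_perp x3 x2. bf z x1 = r}" using zs by (simp add: F3_square'[OF kap_lam(2)])
  qed
  also have "card \<dots> = 9"
    using sing b23 bf_rev sp sigma_perp kap_lam r by (intro card_singular_with_product_singular) (simp_all add: F3_mult_eq_0)
  finally show ?thesis .
qed

text \<open>The condition prescribes the product of \<open>s\<close> with \<open>w\<close>, the
  component of \<open>x3 + z\<close> orthogonal to \<open>x0\<close> and \<open>x1\<close>. This
  \<open>w\<close> is singular exactly when \<open>bf z x1 = - kap\<close>, which separates the
  counts 9 and 6.\<close>

lemma card_s:
  assumes z: "z \<in> sing_perp x3 x2" and z1: "bf z x1 \<noteq> 0"
  shows "card {s \<in> sing_perp x0 x1. bf (x0 + s) (x3 + z) = 0} = (if bf z x1 = - kap then 9 else 6)"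
proof -
  note z' = sing_perpD[OF z]
  have z0: "bf z x0 \<noteq> 0" unfolding bf_z(1)[OF z] using z1 kap_lam by (simp add: F3_mult_eq_0)
  define w where "w = (x3 + z) - (kap + bf z x1) *s x0 - bf z x0 *s x1"
  have w: "w \<in> perp {x0, x1}"
    using b01 bf_rev bf_self_zero by (simp add: w_def perp_def bf_simps com)
  have wx: "bf x0 w = 0" "bf x1 w = 0" using w by (simp_all add: perp_def bf_commute)
  have "bf w w = bf (x3 + z) w"
    by (subst w_def) (simp only: bf_simps wx, simp)
  also have "bf (x3 + z) w = - ((kap + bf z x1) * bf z x0) - bf z x0 * (kap + bf z x1)"
    using z' bf_rev bf_self_zero by (simp add: w_def bf_simps com bf_self Q_add algebra_simps)
  finally have Qw: "Q_minus w = - ((kap + bf z x1) * bf z x0)"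
    using F3_cases[of "(kap + bf z x1) * bf z x0"] by (auto simp: bf_self mult.commute)
  have "{s \<in> sing_perp x0 x1. bf (x0 + s) (x3 + z) = 0} = {s \<in> perp {x0, x1}. Q_minus s = 0 \<and> bf s w = - bf z x0}"
  proof (rule Collect_cong)
    fix s
    have "bf s w = bf s (x3 + z)" if "s \<in> perp {x0, x1}"
      using that by (simp add: perp_def w_def bf_simps)
    moreover have "bf (x0 + s) (x3 + z) = 0 \<longleftrightarrow> bf s (x3 + z) = - bf z x0"
      unfolding bf_add_left[of x0] bf_add_right[of x0] b03 bf_commute[of x0 z] eq_neg_iff_add_eq_0
      by (simp only: add_0 add.commute)
    moreover have "s \<noteq> 0" if "bf s w = - bf z x0"
      using that z0 bf_zero_left[of w] by auto
    ultimately show "s \<in> sing_perp x0 x1 \<and> bf (x0 + s) (x3 + z) = 0 \<longleftrightarrow> s \<in> perp {x0, x1} \<and> Q_minus s = 0 \<and> bf s w = - bf z x0"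
      unfolding sing_perp_def mem_Collect_eq by fastforce
  qed
  moreover have "card {s \<in> perp {x0, x1}. Q_minus s = 0 \<and> bf s w = - bf z x0} = (if bf z x1 = - kap then 9 else 6)"
  proof (cases "bf z x1 = - kap")
    case True
    have "bf w x3 = - (kap * bf z x0)"
      using True z' bf_rev b03 bf_self_zero by (simp add: w_def bf_simps mult.commute)
    then have "w \<noteq> 0" using kap_lam z0 by (auto simp: bf_simps F3_mult_eq_0)
    moreover have "Q_minus w = 0" by (simp add: Qw True)
    ultimately show ?thesis
      using True sing b01 w z0 by (simp add: card_singular_with_product_singular)
  next
    case False
    then have "kap + bf z x1 \<noteq> 0" using eq_neg_iff_add_eq_0[of "bf z x1" kap] by (simp add: add.commute)
    then have "Q_minus w \<noteq> 0" using z0 by (simp add: Qw F3_mult_eq_0)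
    then show ?thesis
      using False sing b01 w z0 by (simp add: card_singular_with_product_nonsingular)
  qed
  ultimately show ?thesis by simp
qed

text \<open>153 = 9 * (9 + 1) + 9 * (6 + 1): each nonzero value of \<open>bf z x1\<close> belongs to
  nine \<open>z\<close>, and the added 1 is the exceptional solution with sign -1.\<close>

lemma slide3_degenerate:
  "slide3 (proj_point x0) (proj_point x1) (proj_point x2) (proj_point x3) = 153"
proof -
  have kl: "kap * lam \<in> {1, - 1}" using F3_neq_0_cases[of "kap * lam"] kap_lam by (simp add: F3_mult_eq_0)
  define n :: "3 \<Rightarrow> real" where "n r = (if r = 0 then 0 else if r = - kap then 10 else 7)" for r
  have "slide3 (proj_point x0) (proj_point x1) (proj_point x2) (proj_point x3) = (\<Sum>z\<in>sing_perp x3 x2. n (bf z x1))"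
    unfolding slide3_count
  proof (rule sum.cong[OF refl])
    fix z assume z: "z \<in> sing_perp x3 x2"
    let ?o = "\<lambda>s. bf (x0 + s) (x3 + z) = 0"
    have m: "(\<Sum>m\<in>{1, - 1}. of_bool (solution s m z e)) = (of_bool (bf z x1 \<noteq> 0 \<and> ?o s \<and> (e = 1 \<or> e = - 1 \<and> s = kap *s sigma)) :: real)"
      if s: "s \<in> sing_perp x0 x1" and e: "e \<noteq> 0" for s e
    proof -
      have "(\<Sum>m\<in>{1, - 1}. of_bool (solution s m z e))
        = (\<Sum>m\<in>{1, - 1}. if m = kap * lam then of_bool (bf z x1 \<noteq> 0 \<and> ?o s \<and> (e = 1 \<or> e = - 1 \<and> s = kap *s sigma)) else (0 :: real))"
      proof (rule sum.cong[OF refl])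
        fix m :: 3 assume "m \<in> {1, - 1}"
        then have "m \<noteq> 0" by auto
        from solution_degenerate[OF s z this e]
        show "of_bool (solution s m z e) = (if m = kap * lam then of_bool (bf z x1 \<noteq> 0 \<and> ?o s \<and> (e = 1 \<or> e = - 1 \<and> s = kap *s sigma)) else (0 :: real))"
          by auto
      qed
      then show ?thesis using kl by simp
    qed
    have "(\<Sum>e\<in>{1, - 1}. \<Sum>s\<in>sing_perp x0 x1. \<Sum>m\<in>{1, - 1}. of_bool (solution s m z e))
      = (\<Sum>s\<in>sing_perp x0 x1. of_bool (bf z x1 \<noteq> 0 \<and> ?o s)) + (\<Sum>s\<in>sing_perp x0 x1. of_bool (bf z x1 \<noteq> 0 \<and> ?o s \<and> s = kap *s sigma) :: real)"
      using m by simp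
    also have "(\<Sum>s\<in>sing_perp x0 x1. of_bool (bf z x1 \<noteq> 0 \<and> ?o s \<and> s = kap *s sigma) :: real)
      = (\<Sum>s\<in>sing_perp x0 x1. if s = kap *s sigma then of_bool (bf z x1 \<noteq> 0) else 0)"
      using base_solution(2)[OF z] by (intro sum.cong refl) auto
    also have "\<dots> = of_bool (bf z x1 \<noteq> 0)" using base_solution(1) by simp
    also have "(\<Sum>s\<in>sing_perp x0 x1. of_bool (bf z x1 \<noteq> 0 \<and> ?o s)) = of_bool (bf z x1 \<noteq> 0) * real (card {s \<in> sing_perp x0 x1. ?o s})"
      by (cases "bf z x1 = 0") (simp_all add: Int_def)
    finally show "(\<Sum>e\<in>{1, - 1}. \<Sum>s\<in>sing_perp x0 x1. \<Sum>m\<in>{1, - 1}. of_bool (solution s m z e)) = n (bf z x1)"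
      using card_s[OF z] by (simp add: n_def)
  qed
  also have "\<dots> = (\<Sum>z\<in>sing_perp x3 x2. \<Sum>r\<in>UNIV. if bf z x1 = r then n r else 0)" by simp
  also have "\<dots> = (\<Sum>r\<in>UNIV. \<Sum>z\<in>sing_perp x3 x2. if bf z x1 = r then n r else 0)" by (rule sum.swap)
  also have "\<dots> = (\<Sum>r\<in>UNIV. n r * real (card {z \<in> sing_perp x3 x2. bf z x1 = r}))"
    by (intro sum.cong refl) (simp only: sum.inter_filter[symmetric] finite sum_constant mult.commute)
  also have "\<dots> = (\<Sum>r\<in>UNIV. n r * 9)"
    by (rule sum.cong[OF refl]) (simp add: card_z n_def)
  also have "\<dots> = 153"
    using F3_neq_0_cases[OF kap_lam(1)] by (auto simp: sum_F3 n_def)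
  finally show ?thesis .
qed

lemma signed_relation_degenerate: "signed_relation x0 x1 x2 x3"
proof -
  have "kap *s x2 = kap *s x3 - x0 + (kap * lam) *s x1"
    by (subst x2) (simp add: vec_eq_iff algebra_simps F3_square[OF kap_lam(1)])
  then have "x0 + (- kap) *s x3 + (- (kap * lam)) *s x1 + kap *s x2 = 0" by (simp add: smult_minus_left)
  moreover have "- kap \<noteq> 0" "- (kap * lam) \<noteq> 0" "kap \<noteq> 0" using kap_lam by (simp_all add: F3_mult_eq_0)
  ultimately show ?thesis unfolding signed_relation_def by blast
qed

end

section \<open>The threefold slide for arbitrary configurations of points\<close>

lemma proj_point_smult: "c \<noteq> 0 \<Longrightarrow> proj_point (c *s v) = proj_point v"
  using F3_neq_0_cases[of c] by (auto simp: smult_minus_one proj_point_minus)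

lemma singular_smult: "c \<noteq> 0 \<Longrightarrow> singular v \<Longrightarrow> singular (c *s v)"
  by (auto simp: Q_smult vec_eq_iff F3_mult_eq_0)

context skew_quadrangle
begin

lemma slide_base: "slide (proj_point x0) (proj_point x1) (proj_point x2) (proj_point x3) = of_bool (signed_relation x0 x1 x2 x3)"
  using b01 b23 by (intro slide_proj_point sing ne b12 b03) simp

text \<open>If the lines meet, \<open>kap * lam = dd\<close> is nonzero, so the two terms never
  contribute together. Passing from \<open>x2\<close> to \<open>c *s x2\<close> changes the vector
  but not the point.\<close>

lemma slide3_sector:
  "slide3 (proj_point x0) (proj_point x1) (proj_point x2) (proj_point x3)
    = 8 * of_bool ((kap = 0) \<noteq> (lam = 0)) + 153 * slide (proj_point x0) (proj_point x1) (proj_point x2) (proj_point x3)"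
proof (cases "dd = kap * lam")
  case False
  then have "\<not> signed_relation x0 x1 x2 x3" using signed_relation_iff_degenerate by blast
  then show ?thesis using slide3_skew[OF False] slide_base by simp
next
  case True
  then have kl: "kap \<noteq> 0" "lam \<noteq> 0" using b23 by (auto simp: F3_mult_eq_0)
  have "bf x0 x1 \<noteq> 0" "bf sigma tau = 0" using b01 True by (simp_all add: bf_sigma_tau)
  then obtain c where c: "tau = c *s sigma"
    using singular_orthogonal_proportional[OF _ _ _ sigma_perp tau_perp(1,2)] sing by blast
  have c0: "c \<noteq> 0" using c tau_perp(3) by auto
  interpret deg: degenerate_quadrangle x0 x1 "c *s x2" x3
  proof
    show "c *s x2 \<noteq> 0 \<and> Q_minus (c *s x2) = 0" using c0 sing(3) by (rule singular_smult)
    show "bf x1 (c *s x2) = 0" "bf (c *s x2) x3 \<noteq> 0" using b12 b23 c0 by (simp_all add: bf_simps F3_mult_eq_0)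
    show "c *s x2 \<noteq> x1" "c *s x2 \<noteq> - x1"
      using F3_neq_0_cases[OF c0] ne by (auto simp: smult_minus_one)
    have "c *s x2 = c *s tau + (c * lam) *s x1" by (simp add: tau_def vec_eq_iff algebra_simps)
    also have "c *s tau = sigma" using F3_square[OF c0] by (simp add: c vector_smult_assoc)
    finally show "c *s x2 = x3 - bf x1 x3 *s x0 + bf x0 (c *s x2) *s x1" unfolding sigma_def bf_smult_right .
  qed (use sing b01 b03 ne in auto)
  have p: "proj_point (c *s x2) = proj_point x2" using c0 by (rule proj_point_smult)
  show ?thesis
    using deg.slide3_degenerate deg.slide_base deg.signed_relation_degenerate kl unfolding p by simp
qed

end

text \<open>In representatives, \<open>lam = 0\<close> means that \<open>ac\<close> is an edge and
  \<open>kap = 0\<close> that \<open>bd\<close> is one. Writing the exclusive or as a polynomial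
  exposes the product of the two diagonals, with coefficient -16.\<close>

lemma slide3_eq:
  assumes "a \<in> verts" "b \<in> verts" "c \<in> verts" "d \<in> verts"
  shows "slide3 a b c d = nadjb a b * (adjb b c * (nadjb c d * (adjb d a *
     (8 * (adjb a c + adjb b d - 2 * (adjb a c * adjb b d)))))) + 153 * slide a b c d"
proof (cases "a \<noteq> b \<and> \<not> adj a b \<and> adj b c \<and> c \<noteq> d \<and> \<not> adj c d \<and> adj d a")
  case False
  have "slide3 a b c d = 0" using False unfolding slide3_def by auto
  moreover have "slide a b c d = 0" using False unfolding slide_def by auto
  moreover have "nadjb a b * (adjb b c * (nadjb c d * (adjb d a * (8 * (adjb a c + adjb b d - 2 * (adjb a c * adjb b d)))))) = 0"
    using False by auto
  ultimately show ?thesis by simp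
next
  case True
  obtain v0 v1 v2 v3 where v: "singular v0" "singular v1" "singular v2" "singular v3"
    and abcd: "a = proj_point v0" "b = proj_point v1" "c = proj_point v2" "d = proj_point v3"
    using assms unfolding vert_iff by blast
  have e: "bf v0 v1 \<noteq> 0" "bf v2 v3 \<noteq> 0" "bf v1 v2 = 0" "v2 \<noteq> v1" "v2 \<noteq> - v1" "bf v3 v0 = 0" "v0 \<noteq> v3" "v0 \<noteq> - v3"
    using True nonadj_iff[OF v(1,2)] nonadj_iff[OF v(3,4)] adj_iff[OF v(2,3)] adj_iff[OF v(4,1)] unfolding abcd by blast+
  define k where "k = bf v0 v1"
  have k: "k \<noteq> 0" "k = 1 \<or> k = - 1" using e(1) F3_neq_0_cases[OF e(1)] by (simp_all add: k_def)
  interpret skew_quadrangle v0 "k *s v1" v2 v3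
  proof
    show "k *s v1 \<noteq> 0 \<and> Q_minus (k *s v1) = 0" using k(1) v(2) by (rule singular_smult)
    show "bf v0 (k *s v1) = 1" using F3_square[OF e(1)] by (simp add: bf_simps k_def)
    show "v2 \<noteq> k *s v1" "v2 \<noteq> - (k *s v1)" using k(2) e(4,5) by (auto simp: smult_minus_one)
    show "v3 \<noteq> v0" "v3 \<noteq> - v0" using e(7,8) by auto
  qed (use v e in \<open>simp_all add: bf_simps bf_commute[of v0 v3]\<close>)
  have p: "proj_point (k *s v1) = b" using k(1) abcd by (simp add: proj_point_smult)
  have ac: "adjb a c = of_bool (bf v0 v2 = 0)"
  proof -
    have "bf v0 v1 \<noteq> 0" "bf v2 v1 = 0" using e by (simp_all add: bf_commute[of v2 v1])
    then have "v2 \<noteq> v0" "v2 \<noteq> - v0" by (auto simp: bf_simps)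
    then show ?thesis using adj_iff[OF v(1,3)] unfolding abcd by simp
  qed
  have bd: "adjb b d = of_bool (bf (k *s v1) v3 = 0)"
  proof -
    have "bf v1 v0 \<noteq> 0" using e by (simp add: bf_commute[of v1 v0])
    then have "v3 \<noteq> v1" "v3 \<noteq> - v1" using e(6) by (auto simp: bf_simps)
    then show ?thesis using adj_iff[OF v(2,4)] k(1) unfolding abcd by (simp add: bf_simps F3_mult_eq_0)
  qed
  have s3: "slide3 a b c d = 8 * of_bool ((bf (k *s v1) v3 = 0) \<noteq> (bf v0 v2 = 0)) + 153 * slide a b c d"
    using slide3_sector unfolding p abcd[symmetric] .
  have mask: "nadjb a b * (adjb b c * (nadjb c d * (adjb d a * x))) = x" for x
    using True by simp
  show ?thesis
    unfolding mask ac bd s3 by (cases "bf v0 v2 = 0"; cases "bf (k *s v1) v3 = 0") simp_all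
qed

section \<open>Commutation for the generalized quadrangle\<close>

lemma card_common_nbrs_adj:
  assumes "adj a b"
  shows "card (common_nbrs a b) = 2"
proof -
  obtain v w where v: "singular v" "a = proj_point v" and w: "singular w" "b = proj_point w"
    using assms adj_verts by (metis vert_iff)
  with assms have vw: "w \<noteq> v" "w \<noteq> - v" "bf v w = 0" by (auto simp: adj_iff)
  show ?thesis
    using common_neighbours_adjacent[OF v(1) w(1) vw] v w by (simp add: common_nbrs_def)
qed

text \<open>If some diagonal is neither an edge nor degenerate, no point is adjacent to all four.
  Otherwise the points lie on one line of four points, and the count is 4 minus the number of
  distinct points among them.\<close>

lemma star4_edge_square:
  assumes "adj a b" "adj b c" "adj c d" "adj d a"
  shows "star4 a b c d = of_bool (a = c) + of_bool (b = d) - of_bool (a = c) * nadjb b d - of_bool (b = d) * nadjb a c"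
    and "adj a c \<Longrightarrow> b = d \<or> adj b d"
    and "adj b d \<Longrightarrow> a = c \<or> adj a c"
proof -
  note sym = adj_sym
  have edge: "r = s \<or> adj r s" if "adj p q" "adj p r" "adj q r" "adj p s" "adj q s" for p q r s
    using common_neighbours_of_edge[OF that] by blast
  show 3: "adj a c \<Longrightarrow> b = d \<or> adj b d"
    and 4: "adj b d \<Longrightarrow> a = c \<or> adj a c"
    using edge[of a c b d] edge[of b d a c] assms sym by blast+
  have S: "star4 a b c d = real (card {t \<in> common_nbrs a b. adj c t \<and> adj d t})"
  proof -
    have "star4 a b c d = (\<Sum>t\<in>verts. of_bool (t \<in> {t \<in> common_nbrs a b. adj c t \<and> adj d t}))"
      unfolding star4_def by (intro sum.cong refl) (auto simp: common_nbrs_def)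
    then show ?thesis
      by (simp add: of_bool_def sum.If_cases common_nbrs_def Int_def conj_ac)
  qed
  obtain r s where rs: "common_nbrs a b = {r, s}" "r \<noteq> s"
    using card_common_nbrs_adj[OF assms(1)] by (auto simp: card_2_iff)
  then have rs': "adj a r" "adj b r" "adj a s" "adj b s"
    by (auto simp: common_nbrs_def)
  have "adj r s"
    using edge[OF assms(1) rs'] rs(2) by blast
  have in_rs: "t = r \<or> t = s" if "adj a t" "adj b t" for t
    using rs(1) that adj_verts by (auto simp: common_nbrs_def)
  show "star4 a b c d = of_bool (a = c) + of_bool (b = d) - of_bool (a = c) * nadjb b d - of_bool (b = d) * nadjb a c"
  proof -
    define C where "C = {t \<in> common_nbrs a b. adj c t \<and> adj d t}"
    have C: "C = {t \<in> {r, s}. adj c t \<and> adj d t}"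
      by (simp add: C_def rs)
    have Ct: "adj a t" "adj b t" "adj c t" "adj d t" if "t \<in> C" for t
      using that rs' by (auto simp: C)
    note irr = adj_irrefl
    consider (eq) "a = c" "b = d" | (line1) "a = c" "adj b d" | (far1) "a = c" "b \<noteq> d" "\<not> adj b d"
      | (line2) "adj a c" "b = d" | (far2) "a \<noteq> c" "\<not> adj a c"
      | (line3) "adj a c" "adj b d"
      using 3 by blast
    then have "real (card C) = of_bool (a = c) + of_bool (b = d) - of_bool (a = c) * nadjb b d - of_bool (b = d) * nadjb a c"
    proof cases
      case eq
      then have "C = {r, s}" using rs' by (auto simp: C)
      then show ?thesis using eq rs(2) by simp
    next
      case line1
      then have "d = r \<or> d = s" using in_rs assms sym by blast
      then have "C = {s} \<or> C = {r}"
        using line1 rs' \<open>adj r s\<close> sym irr unfolding C by auto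
      then have "card C = 1" by auto
      then show ?thesis using line1 irr by auto
    next
      case line2
      then have "c = r \<or> c = s" using in_rs assms sym by blast
      then have "C = {s} \<or> C = {r}"
        using line2 rs' \<open>adj r s\<close> sym irr unfolding C by auto
      then have "card C = 1" by auto
      then show ?thesis using line2 irr by auto
    next
      case far1
      then have "C = {}" using Ct edge[of a _ b d] assms sym by blast
      then show ?thesis using far1 by simp
    next
      case far2
      then have "C = {}" using Ct edge[of b _ a c] assms sym by blast
      moreover have "\<not> adj b d" using far2 4 by blast
      ultimately show ?thesis using far2 by simp
    next
      case line3
      then have "c = r \<or> c = s" "d = r \<or> d = s" using in_rs assms sym by blast+
      moreover have "c \<noteq> d" using assms irr by blast
      ultimately have "C = {}" using irr unfolding C by auto
      then show ?thesis using line3 irr by auto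
    qed
    then show ?thesis unfolding S C_def .
  qed
qed

definition crossing :: "(3^6) set \<Rightarrow> (3^6) set \<Rightarrow> (3^6) set \<Rightarrow> (3^6) set \<Rightarrow> real" where
  "crossing a b c d = nadjb a b * (adjb b c * (nadjb c d * (adjb d a * (adjb a c * adjb b d))))"

definition edge_square :: "(3^6) set \<Rightarrow> (3^6) set \<Rightarrow> (3^6) set \<Rightarrow> (3^6) set \<Rightarrow> real" where
  "edge_square a b c d = adjb a b * (adjb b c * (adjb c d * (adjb d a * (nadjb a c * nadjb b d))))"

text \<open>The values are 243 = 27 * 9, 72 = 9 * 8 and 16 = 8 * 2, with one factor for
  \<open>p\<close> and one for \<open>q\<close>. Here 27 counts the neighbours of \<open>b\<close>
  off the line \<open>ab\<close>; the others are the numbers 10 and 4 of common neighbours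
  diminished by the given points. If a diagonal is an edge, no pair qualifies.\<close>

lemma crossing_square_sum:
  assumes "adj a b" "adj b c" "adj c d" "adj d a"
  shows "(\<Sum>p\<in>verts. \<Sum>q\<in>verts. crossing p a b q * edge_square p q c d)
    = 243 * of_bool (a = c \<and> b = d) + 72 * (of_bool (a = c) * nadjb b d + of_bool (b = d) * nadjb a c) + 16 * (nadjb a c * nadjb b d)"
proof -
  define S where "S a b c d = {(p, q). adj b p \<and> adj d p \<and> nonadj p a \<and> nonadj p c \<and>
    adj a q \<and> adj c q \<and> adj p q \<and> nonadj q b \<and> nonadj q d}" for a b c d
  have V: "a \<in> verts" "b \<in> verts" "c \<in> verts" "d \<in> verts"
    using assms adj_verts by blast+
  note neq = nonadj_def[THEN iffD1, THEN conjunct2, THEN conjunct2, THEN conjunct1]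
  \<comment> \<open>Because of this, the nonadjacency conditions in \<open>S\<close> exclude nothing
    but the given points from the sets of common neighbours.\<close>
  have coclique: "nonadj r s" if "nonadj p q" "r \<in> common_nbrs p q" "s \<in> common_nbrs p q" "r \<noteq> s" for p q r s
    using common_neighbours_of_edge[of r s p q] that adj_sym unfolding nonadj_def common_nbrs_def by blast
  have "(\<Sum>p\<in>verts. \<Sum>q\<in>verts. crossing p a b q * edge_square p q c d)
      = (\<Sum>p\<in>verts. \<Sum>q\<in>verts. of_bool ((p, q) \<in> S a b c d))"
  proof (intro sum.cong refl)
    fix p q assume pq: "p \<in> verts" "q \<in> verts"
    have "(p, q) \<in> S a b c d \<longleftrightarrow> (p \<noteq> a \<and> \<not> adj p a) \<and> adj a b \<and> (b \<noteq> q \<and> \<not> adj b q) \<and> adj q p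
        \<and> adj p b \<and> adj a q \<and> adj p q \<and> adj q c \<and> adj c d \<and> adj d p
        \<and> (p \<noteq> c \<and> \<not> adj p c) \<and> (q \<noteq> d \<and> \<not> adj q d)"
      using assms V pq adj_sym unfolding S_def nonadj_def by blast
    then show "crossing p a b q * edge_square p q c d = of_bool ((p, q) \<in> S a b c d)"
      by (simp only: crossing_def edge_square_def of_bool_conj mult.assoc)
  qed
  also have "\<dots> = real (card (S a b c d))"
  proof -
    have "S a b c d \<subseteq> verts \<times> verts"
      by (auto simp: S_def nonadj_def)
    moreover have "(\<Sum>p\<in>verts. \<Sum>q\<in>verts. of_bool ((p, q) \<in> S a b c d))
        = (\<Sum>x\<in>verts \<times> verts. of_bool (x \<in> S a b c d) :: real)"
      unfolding sum.cartesian_product by (intro sum.cong refl) auto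
    ultimately show ?thesis by (simp add: Int_absorb1)
  qed
  also have "\<dots> = 243 * of_bool (a = c \<and> b = d) + 72 * (of_bool (a = c) * nadjb b d + of_bool (b = d) * nadjb a c) + 16 * (nadjb a c * nadjb b d)"
  proof -
    have sub: "S a b c d = (SIGMA p:{p \<in> verts. adj b p \<and> adj d p \<and> nonadj p a \<and> nonadj p c}.
        {q \<in> verts. adj a q \<and> adj c q \<and> adj p q \<and> nonadj q b \<and> nonadj q d})" for a b c d
      by (auto simp: S_def nonadj_def)
    have one_equal: "card (S a b a d) = 72" if "nonadj b d" "adj a b" "adj a d" for a b d
    proof -
      have ab: "a \<in> common_nbrs b d" using that adj_sym adj_verts unfolding common_nbrs_def by blast
      have 1: "{p \<in> verts. adj b p \<and> adj d p \<and> nonadj p a \<and> nonadj p a} = common_nbrs b d - {a}"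
        using coclique[OF that(1) _ ab] neq unfolding common_nbrs_def by blast
      have 2: "card {q \<in> verts. adj a q \<and> adj a q \<and> adj p q \<and> nonadj q b \<and> nonadj q d} = 8"
        if p: "p \<in> common_nbrs b d - {a}" for p
      proof -
        have "nonadj a p" using p 1 nonadj_sym by blast
        have bd: "b \<in> common_nbrs a p" "d \<in> common_nbrs a p" "b \<noteq> d"
          using p \<open>adj a b\<close> \<open>adj a d\<close> neq[OF \<open>nonadj b d\<close>] adj_sym adj_verts unfolding common_nbrs_def by blast+
        have "{q \<in> verts. adj a q \<and> adj a q \<and> adj p q \<and> nonadj q b \<and> nonadj q d} = common_nbrs a p - {b, d}"
          using coclique[OF \<open>nonadj a p\<close> _ bd(1)] coclique[OF \<open>nonadj a p\<close> _ bd(2)] neq unfolding common_nbrs_def by blast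
        then show ?thesis
          using card_common_nbrs[OF \<open>nonadj a p\<close>] bd by (simp add: card_Diff_subset)
      qed
      have "card (S a b a d) = (\<Sum>p\<in>common_nbrs b d - {a}. 8)"
        unfolding sub 1 by (subst card_SigmaI, simp, simp, rule sum.cong[OF refl 2])
      then show ?thesis using card_common_nbrs[OF that(1)] ab by simp
    qed
    have swap: "card (S a b c d) = card (S b a d c)" for a b c d
    proof -
      have "bij_betw prod.swap (S a b c d) (S b a d c)"
        using adj_sym by (intro bij_betw_byWitness[where f' = prod.swap]) (auto simp: S_def)
      then show ?thesis by (rule bij_betw_same_card)
    qed
    have line: "S a b c d = {}" if "adj a c \<or> adj b d"
    proof -
      have False if "(p, q) \<in> S a b c d" for p q
        using that \<open>adj a c \<or> adj b d\<close> common_neighbours_of_edge[of a c b q] common_neighbours_of_edge[of b d a p]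
          assms adj_sym unfolding S_def nonadj_def by blast
      then show ?thesis by auto
    qed
    consider (eq) "a = c" "b = d" | (1) "a = c" "nonadj b d" | (2) "nonadj a c" "b = d" | (far) "nonadj a c" "nonadj b d"
      | (line) "adj a c \<or> adj b d"
      using V by (auto simp: nonadj_def)
    then show ?thesis
    proof cases
      case eq
      have 1: "{p \<in> verts. adj b p \<and> adj b p \<and> nonadj p a \<and> nonadj p a} = {p \<in> verts. adj b p \<and> nonadj p a}"
        by auto
      have 2: "card {q \<in> verts. adj a q \<and> adj a q \<and> adj p q \<and> nonadj q b \<and> nonadj q b} = 9"
        if p: "p \<in> {p \<in> verts. adj b p \<and> nonadj p a}" for p
      proof -
        have "nonadj a p" using p nonadj_sym by blast
        have b: "b \<in> common_nbrs a p"
          using p assms(1) V adj_sym unfolding common_nbrs_def by blast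
        have "{q \<in> verts. adj a q \<and> adj a q \<and> adj p q \<and> nonadj q b \<and> nonadj q b} = common_nbrs a p - {b}"
          using coclique[OF \<open>nonadj a p\<close> _ b] neq unfolding common_nbrs_def by blast
        then show ?thesis
          using card_common_nbrs[OF \<open>nonadj a p\<close>] b by simp
      qed
      have "adj b a" using assms(1) adj_sym by blast
      then have 27: "card {p \<in> verts. adj b p \<and> nonadj p a} = 27"
        by (rule card_nbrs_off_line)
      have "card (S a b a b) = (\<Sum>p\<in>{p \<in> verts. adj b p \<and> nonadj p a}. 9)"
        unfolding sub 1 by (subst card_SigmaI) (simp, simp, rule sum.cong[OF refl 2])
      then have "card (S a b a b) = 243" using 27 by simp
      then show ?thesis using eq by simp
    next
      case 1
      then have "card (S a b c d) = 72" using one_equal[of b d a] assms adj_sym by blast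
      then show ?thesis using 1 by (simp add: nonadj_def)
    next
      case 2
      then have "card (S b a d c) = 72" using one_equal[of a c b] assms adj_sym by blast
      then show ?thesis using 2 swap[of a b c d] by (simp add: nonadj_def)
    next
      case far
      have ac: "a \<in> common_nbrs b d" "c \<in> common_nbrs b d" "b \<in> common_nbrs a c" "d \<in> common_nbrs a c"
        using assms V adj_sym unfolding common_nbrs_def by blast+
      have 1: "{p \<in> verts. adj b p \<and> adj d p \<and> nonadj p a \<and> nonadj p c} = common_nbrs b d - {a, c}"
        using coclique[OF \<open>nonadj b d\<close> _ ac(1)] coclique[OF \<open>nonadj b d\<close> _ ac(2)] neq unfolding common_nbrs_def by blast
      have 2: "card {q \<in> verts. adj a q \<and> adj c q \<and> adj p q \<and> nonadj q b \<and> nonadj q d} = 2"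
        if p: "p \<in> common_nbrs b d - {a, c}" for p
      proof -
        have pn: "nonadj a p" "nonadj c p" using p 1 nonadj_sym by blast+
        have "{q \<in> verts. adj a q \<and> adj c q \<and> adj p q \<and> nonadj q b \<and> nonadj q d}
            = {q \<in> common_nbrs a c. adj p q} - {b, d}"
          using coclique[OF \<open>nonadj a c\<close> _ ac(3)] coclique[OF \<open>nonadj a c\<close> _ ac(4)] neq unfolding common_nbrs_def by blast
        moreover have "{b, d} \<subseteq> {q \<in> common_nbrs a c. adj p q}"
          using p ac adj_sym unfolding common_nbrs_def by blast
        ultimately show ?thesis
          using card_common_nbrs3[OF \<open>nonadj a c\<close> pn] neq[OF \<open>nonadj b d\<close>] by (simp add: card_Diff_subset)
      qed
      have "card (common_nbrs b d - {a, c}) = 8"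
        using card_common_nbrs[OF \<open>nonadj b d\<close>] ac neq[OF \<open>nonadj a c\<close>] by (simp add: card_Diff_subset)
      then have "card (S a b c d) = 16"
        unfolding sub 1 by (simp add: 2)
      then show ?thesis using far by (simp add: nonadj_def)
    next
      case line
      then have "a \<noteq> c \<or> b \<noteq> d" using adj_irrefl by blast
      moreover have "adj a c \<Longrightarrow> b = d \<or> adj b d" "adj b d \<Longrightarrow> a = c \<or> adj a c"
        using star4_edge_square(2,3)[OF assms] by blast+
      ultimately show ?thesis using line \<open>adj a c \<or> adj b d \<Longrightarrow> S a b c d = {}\<close> adj_irrefl by auto
    qed
  qed
  finally show ?thesis .
qed

section \<open>Invariance of the crossing and of the flip, and commutation\<close>

locale generalized_quadrangle_unitary =
  magic_unitary verts adj U for U :: "(3^6) set \<Rightarrow> (3^6) set \<Rightarrow> 'a::real_algebra_1"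
begin

lemma inv2_adjb: "inv2 adjb" and inv2_nadjb: "inv2 nadjb" and inv2_eq: "inv2 (\<lambda>a b. of_bool (a = b))"
  using inv2_relation[of "\<lambda>eq e. of_bool e"] inv2_relation[of "\<lambda>eq e. of_bool (\<not> eq \<and> \<not> e)"] inv2_relation[of "\<lambda>eq e. of_bool eq"]
  by simp_all

lemmas inv4_masks = inv4_mask01[OF _ inv2_adjb] inv4_mask01[OF _ inv2_nadjb]
  inv4_mask12[OF _ inv2_adjb] inv4_mask12[OF _ inv2_nadjb]
  inv4_mask23[OF _ inv2_adjb] inv4_mask23[OF _ inv2_nadjb]
  inv4_mask30[OF _ inv2_adjb] inv4_mask30[OF _ inv2_nadjb]

lemma inv4_star4: "inv4 star4"
  using inv4_star by (simp add: star4_def[abs_def])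

lemma inv4_slide: "inv4 slide"
  unfolding slide_def[abs_def] by (intro inv4_masks inv4_star4)

lemma inv4_slide2: "inv4 slide2"
  unfolding slide2_def[abs_def] by (intro inv4_masks inv4_compose inv4_slide)

lemma inv4_slide3: "inv4 slide3"
  unfolding slide3_def[abs_def] by (intro inv4_masks inv4_compose inv4_slide inv4_slide2)

text \<open>\<open>slide3_eq\<close> is solved for the product of the diagonals, whose coefficient
  accounts for 1/16.\<close>

lemma inv4_crossing: "inv4 crossing"
proof (rule inv4_cong)
  show "inv4 (\<lambda>a b c d. 1/16 * ((8 * (nadjb a b * (adjb b c * (nadjb c d * (adjb d a * adjb a c))))
      + 8 * (nadjb a b * (adjb b c * (nadjb c d * (adjb d a * adjb b d)))) + 153 * slide a b c d) - slide3 a b c d))"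
    by (intro inv4_scale inv4_diff inv4_add inv4_masks inv4_slide inv4_slide3 inv4_diagonal02 inv4_diagonal13 inv2_adjb)
qed (simp add: slide3_eq crossing_def algebra_simps)

text \<open>The product of the two diagonal conditions is not a mask. On closed walks of four edges,
  \<open>star4_edge_square\<close> makes it linear in \<open>star4\<close> and functions of a single
  diagonal.\<close>

lemma inv4_edge_square: "inv4 edge_square"
proof (rule inv4_cong)
  show "inv4 (\<lambda>a b c d. adjb a b * (adjb b c * (adjb c d * (adjb d a *
      (1/2 * ((nadjb a c + nadjb b d + star4 a b c d) - (of_bool (a = c) + of_bool (b = d))))))))"
    by (intro inv4_scale inv4_diff inv4_add inv4_masks inv4_star4 inv4_diagonal02 inv4_diagonal13 inv2_nadjb inv2_eq)
next
  fix a b c d :: "(3^6) set"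
  show "adjb a b * (adjb b c * (adjb c d * (adjb d a *
      (1/2 * ((nadjb a c + nadjb b d + star4 a b c d) - (of_bool (a = c) + of_bool (b = d)))))))
    = edge_square a b c d"
  proof (cases "adj a b \<and> adj b c \<and> adj c d \<and> adj d a")
    case True
    then show ?thesis
      using star4_edge_square[of a b c d] adj_irrefl by (auto simp: edge_square_def)
  qed (auto simp: edge_square_def)
qed

definition half_flip :: "(3^6) set \<Rightarrow> (3^6) set \<Rightarrow> (3^6) set \<Rightarrow> (3^6) set \<Rightarrow> real" where
  "half_flip a b c d = adjb a b * (adjb b c * (adjb c d * (adjb d a * (of_bool (a = c) * nadjb b d + of_bool (b = d) * nadjb a c))))"

lemma inv4_half_flip: "inv4 half_flip"
proof (rule inv4_cong)
  show "inv4 (\<lambda>a b c d. adjb a b * (adjb b c * (adjb c d * (adjb d a * ((of_bool (a = c) + of_bool (b = d)) - star4 a b c d)))))"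
    by (intro inv4_scale inv4_diff inv4_add inv4_masks inv4_star4 inv4_diagonal02 inv4_diagonal13 inv2_eq)
next
  fix a b c d :: "(3^6) set"
  show "adjb a b * (adjb b c * (adjb c d * (adjb d a * ((of_bool (a = c) + of_bool (b = d)) - star4 a b c d))))
    = half_flip a b c d"
  proof (cases "adj a b \<and> adj b c \<and> adj c d \<and> adj d a")
    case True
    then show ?thesis
      using star4_edge_square(1)[of a b c d] by (simp add: half_flip_def)
  qed (auto simp: half_flip_def)
qed

text \<open>A rotated crossing is composed with \<open>edge_square\<close>. By
  \<open>crossing_square_sum\<close> its values away from the flip are combinations of tensors
  already known to be invariant; subtracting them leaves 243 times the flip.\<close>

lemma inv4_flip: "inv4 (\<lambda>a b c d. of_bool (a = c \<and> b = d \<and> adj a b))"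
proof (rule inv4_cong)
  show "inv4 (\<lambda>a b c d. 1/243 * ((adjb a b * (adjb b c * (adjb c d * (adjb d a *
      (\<Sum>p\<in>verts. \<Sum>q\<in>verts. crossing p a b q * edge_square p q c d)))))
      - (72 * half_flip a b c d + 16 * edge_square a b c d)))"
    by (intro inv4_scale inv4_diff inv4_add inv4_masks inv4_half_flip inv4_edge_square
        inv4_compose[of "\<lambda>a b c d. crossing d a b c"] inv4_rot[of crossing] inv4_crossing)
next
  fix a b c d assume V: "a \<in> verts" "b \<in> verts" "c \<in> verts" "d \<in> verts"
  show "1/243 * ((adjb a b * (adjb b c * (adjb c d * (adjb d a *
      (\<Sum>p\<in>verts. \<Sum>q\<in>verts. crossing p a b q * edge_square p q c d)))))
      - (72 * half_flip a b c d + 16 * edge_square a b c d)) = of_bool (a = c \<and> b = d \<and> adj a b)"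
    using crossing_square_sum[of a b c d] V adj_sym
    by (cases "adj a b \<and> adj b c \<and> adj c d \<and> adj d a")
       (auto simp: crossing_def[abs_def] half_flip_def edge_square_def)
qed

lemma adjacent_commute:
  assumes "x \<in> verts" "y \<in> verts" "a \<in> verts" "b \<in> verts"
    and "adj x y"
  shows "U x a * U y b = U y b * U x a"
  by (rule inv4_flip_commute[OF inv4_flip]) (use assms adj_sym in \<open>auto intro: sympI\<close>)

text \<open>Inserting the row sum of a common neighbour \<open>z\<close> of \<open>x\<close> and
  \<open>y\<close> restricts the column \<open>d\<close> to the common neighbours \<open>D\<close>
  of \<open>a\<close>, \<open>b\<close>, \<open>b'\<close>. Adding up the 10 choices of
  \<open>z\<close> and collapsing the column sum yields
  \<open>10 *\<^sub>R p = card D *\<^sub>R p\<close>, while \<open>D\<close> has at most 4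
  elements.\<close>

lemma nonadjacent_sandwich:
  assumes xy: "nonadj x y" and b: "b \<in> verts" "b' \<in> verts" "b \<noteq> b'" and a: "a \<in> verts"
  shows "U y b * U x a * U y b' = 0"
proof (cases "nonadj a b \<and> nonadj a b'")
  case False
  have x: "x \<in> verts" "y \<in> verts" "x \<noteq> y" "\<not> adj x y" "\<not> adj y x"
    using xy adj_sym by (auto simp: nonadj_def)
  from False have "U y b * U x a = 0 \<or> U x a * U y b' = 0"
    using edge_orth[of y x b a] edge_orth[of x y a b'] col_orth[of y x a] col_orth[of x y a] x a b adj_sym
    by (auto simp: nonadj_def)
  then show ?thesis by (metis mult.assoc mult_zero_left mult_zero_right)
next
  case True
  define p where "p = U y b * U x a * U y b'"
  have x: "x \<in> verts" "y \<in> verts"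
    using xy by (auto simp: nonadj_def)
  define D where "D = {d \<in> common_nbrs b a. adj b' d}"
  have adj_mult: "U z d * U w e = 0" if "adj z w" "\<not> adj d e" "z \<in> verts" "w \<in> verts"
    "d \<in> verts" "e \<in> verts" for z w d e
    using edge_orth[of z w d e] that by simp
  have expand: "p = (\<Sum>d\<in>D. U y b * U z d * (U x a * U y b'))" if z: "z \<in> common_nbrs y x" for z
  proof -
    have zv: "z \<in> verts" "adj y z" "adj x z" "adj z y" "adj z x"
      using z adj_sym by (auto simp: common_nbrs_def)
    have "p = (\<Sum>d\<in>verts. U y b * U z d * (U x a * U y b'))"
      using row_sum[OF zv(1)] by (simp add: p_def sum_distrib_left[symmetric] sum_distrib_right[symmetric] mult.assoc)
    also have "\<dots> = (\<Sum>d\<in>D. U y b * U z d * (U x a * U y b'))"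
    proof (rule sum.mono_neutral_right)
      show "\<forall>d\<in>verts - D. U y b * U z d * (U x a * U y b') = 0"
      proof
        fix d assume d: "d \<in> verts - D"
        then consider "\<not> adj b d" | "\<not> adj d a" | "\<not> adj d b'"
          using adj_sym by (auto simp: D_def common_nbrs_def)
        then show "U y b * U z d * (U x a * U y b') = 0"
        proof cases
          case 1
          then show ?thesis using adj_mult[of y z b d] zv x b d by simp
        next
          case 2
          then have "U z d * U x a = 0" using adj_mult[of z x d a] zv x a d by simp
          then show ?thesis by (metis mult.assoc mult_zero_left mult_zero_right)
        next
          case 3
          then have "U z d * U y b' = 0" using adj_mult[of z y d b'] zv x b d by simp
          \<comment> \<open>As \<open>z\<close> and \<open>x\<close> are adjacent, commutation for
            edges lets \<open>U z d\<close> pass \<open>U x a\<close> and meet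
            \<open>U y b'\<close>.\<close>
          moreover have "U z d * (U x a * U y b') = U x a * (U z d * U y b')"
            using adjacent_commute[of z x d a] zv x a d by (metis DiffD1 mult.assoc)
          ultimately show ?thesis by (simp add: mult.assoc)
        qed
      qed
    qed (auto simp: D_def common_nbrs_def)
    finally show ?thesis .
  qed
  have collapse: "(\<Sum>z\<in>common_nbrs y x. U y b * U z d * U x a) = U y b * U x a" if d: "d \<in> D" for d
  proof -
    have dv: "d \<in> verts" "adj b d" "adj d a"
      using d adj_sym by (auto simp: D_def common_nbrs_def)
    have "(\<Sum>z\<in>common_nbrs y x. U y b * U z d * U x a) = (\<Sum>z\<in>verts. U y b * U z d * U x a)"
    proof (rule sum.mono_neutral_left)
      show "\<forall>z\<in>verts - common_nbrs y x. U y b * U z d * U x a = 0"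
      proof
        fix z assume z: "z \<in> verts - common_nbrs y x"
        then have "adj y z \<noteq> adj b d \<or> adj z x \<noteq> adj d a"
          using dv adj_sym by (auto simp: common_nbrs_def)
        then have "U y b * U z d = 0 \<or> U z d * U x a = 0"
          using edge_orth[of y z b d] edge_orth[of z x d a] z dv x a b by blast
        then show "U y b * U z d * U x a = 0"
          by (metis mult.assoc mult_zero_left mult_zero_right)
      qed
    qed (auto simp: common_nbrs_def)
    also have "\<dots> = U y b * (\<Sum>z\<in>verts. U z d) * U x a"
      by (simp only: sum_distrib_left sum_distrib_right)
    finally show ?thesis using col_sum[OF dv(1)] by simp
  qed
  have "10 *\<^sub>R p = (\<Sum>z\<in>common_nbrs y x. p)"
    using card_common_nbrs[of y x] xy nonadj_sym by (simp add: scaleR_conv_of_real)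
  also have "\<dots> = (\<Sum>z\<in>common_nbrs y x. \<Sum>d\<in>D. U y b * U z d * (U x a * U y b'))"
    by (rule sum.cong[OF refl expand])
  also have "\<dots> = (\<Sum>d\<in>D. (\<Sum>z\<in>common_nbrs y x. U y b * U z d * U x a) * U y b')"
    by (subst sum.swap) (simp add: sum_distrib_right mult.assoc)
  also have "\<dots> = real (card D) *\<^sub>R p"
    by (simp add: collapse p_def scaleR_conv_of_real)
  finally have "(10 - real (card D)) *\<^sub>R p = 0"
    by (simp add: scaleR_left_diff_distrib)
  moreover have "card D < 10"
  proof (cases "nonadj b b'")
    case True
    have "card D = 4"
      unfolding D_def by (rule card_common_nbrs3) (use True \<open>nonadj a b \<and> nonadj a b'\<close> nonadj_sym in blast)+
    then show ?thesis by simp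
  next
    case False
    then have "adj b b'" using b by (auto simp: nonadj_def)
    then have "card (common_nbrs b b') = 2" by (rule card_common_nbrs_adj)
    moreover have "D \<subseteq> common_nbrs b b'" by (auto simp: D_def common_nbrs_def)
    ultimately have "card D \<le> 2" by (metis card_mono finite)
    then show ?thesis by simp
  qed
  ultimately show ?thesis by (simp add: p_def)
qed

text \<open>For nonadjacent rows, inserting the row sum of \<open>y\<close> to the left of
  \<open>U x a * U y b\<close> or to the right of \<open>U y b * U x a\<close> leaves the same term
  \<open>U y b * U x a * U y b\<close>.\<close>

lemma all_commute:
  assumes "x \<in> verts" "y \<in> verts" "a \<in> verts" "b \<in> verts"
  shows "U x a * U y b = U y b * U x a"
proof -
  consider "x = y" | "adj x y" | "nonadj x y"
    using assms by (auto simp: nonadj_def)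
  then show ?thesis
  proof cases
    case 1
    then show ?thesis using assms by (auto simp: row_mult)
  next
    case 2
    then show ?thesis using adjacent_commute assms by blast
  next
    case 3
    have "U x a * U y b = (\<Sum>c\<in>verts. U y c * U x a * U y b)"
      using col_sum row_sum[OF assms(2)] by (simp add: sum_distrib_right[symmetric])
    also have "\<dots> = (\<Sum>c\<in>verts. if c = b then U y b * U x a * U y b else 0)"
      using nonadjacent_sandwich[OF 3] assms by (intro sum.cong) auto
    finally have 1: "U x a * U y b = U y b * U x a * U y b"
      using assms by simp
    have "U y b * U x a = (\<Sum>c\<in>verts. U y b * U x a * U y c)"
      using row_sum[OF assms(2)] by (simp add: sum_distrib_left[symmetric])
    also have "\<dots> = (\<Sum>c\<in>verts. if c = b then U y b * U x a * U y b else 0)"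
      using nonadjacent_sandwich[OF 3] assms by (intro sum.cong) auto
    finally show ?thesis using 1 assms by simp
  qed
qed

end

section \<open>The quotient algebra\<close>

text \<open>Scalars are supported on the empty word, the neutral element of the monoid, and so
  commute with every monomial.\<close>

lemma scal_commute: "scal c * x = x * scal c"
proof (induction x rule: update_induct)
  case (update x k v)
  have "Poly_Mapping.update k v x = x + Poly_Mapping.single k v"
    using update(1) by (intro poly_mapping_eqI)
      (auto simp: lookup_update lookup_add lookup_single in_keys_iff when_def)
  then show ?case
    using update(3) by (simp add: algebra_simps scal_def mult_single mult.commute)
qed simp

definition hypothesis :: "nat \<times> (nat \<Rightarrow> nat \<Rightarrow> bool) \<Rightarrow> bool" where
  "hypothesis p \<longleftrightarrow> is_McLaughlin_graph {..<fst p} (snd p) \<or> is_O_minus_6_3_graph {..<fst p} (snd p)"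

text \<open>A quotient type cannot depend on \<open>N\<close> and \<open>E\<close>. It is therefore formed for a single graph, which is
  a counterexample to the theorem if there is one.\<close>

definition generic_graph :: "nat \<times> (nat \<Rightarrow> nat \<Rightarrow> bool)" where
  "generic_graph = (SOME p. hypothesis p \<and> flip_tensor (fst p) \<notin> P_plus (fst p) (snd p) 4)"

abbreviation generic_ideal :: "free_alg set" where
  "generic_ideal \<equiv> aut_ideal (fst generic_graph) (snd generic_graph)"

text \<open>The case distinction makes \<open>0 \<noteq> 1\<close> hold in the quotient also if the ideal is everything.\<close>

definition generic_eq :: "free_alg \<Rightarrow> free_alg \<Rightarrow> bool" where
  "generic_eq a b \<longleftrightarrow> (if 1 \<in> generic_ideal then a = b else a - b \<in> generic_ideal)"

lemma aut_ideal_diff: "a \<in> aut_ideal N E \<Longrightarrow> b \<in> aut_ideal N E \<Longrightarrow> a - b \<in> aut_ideal N E"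
  using aut_ideal.add[of a N E "(- 1) * b"] aut_ideal.mult_left[of b N E "- 1"] by simp

lemma aut_ideal_uminus: "a \<in> aut_ideal N E \<Longrightarrow> - a \<in> aut_ideal N E"
  using aut_ideal.mult_left[of a N E "- 1"] by simp

lemma generic_eq_refl: "generic_eq a a"
  by (simp add: generic_eq_def aut_ideal.zero)

lemma generic_eq_sym: "generic_eq a b \<Longrightarrow> generic_eq b a"
  using aut_ideal_uminus[of "a - b" "fst generic_graph" "snd generic_graph"]
  by (simp add: generic_eq_def split: if_splits)

lemma generic_eq_trans: "generic_eq a b \<Longrightarrow> generic_eq b c \<Longrightarrow> generic_eq a c"
  using aut_ideal.add[of "a - b" "fst generic_graph" "snd generic_graph" "b - c"]
  by (simp add: generic_eq_def split: if_splits)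

quotient_type quantum_alg = free_alg / generic_eq
  by (intro equivpI reflpI sympI transpI) (fact generic_eq_refl generic_eq_sym generic_eq_trans)+

lemma generic_eq_times:
  assumes "generic_eq a b" "generic_eq c d"
  shows "generic_eq (a * c) (b * d)"
proof (cases "1 \<in> generic_ideal")
  case False
  then have "(a - b) * c + b * (c - d) \<in> generic_ideal"
    using assms unfolding generic_eq_def
    by (intro aut_ideal.add aut_ideal.mult_left aut_ideal.mult_right) simp_all
  then show ?thesis using False by (simp add: generic_eq_def algebra_simps)
qed (use assms in \<open>simp add: generic_eq_def\<close>)

lemma generic_eq_plus:
  assumes "generic_eq a b" "generic_eq c d"
  shows "generic_eq (a + c) (b + d)"
proof (cases "1 \<in> generic_ideal")
  case False
  then have "(a - b) + (c - d) \<in> generic_ideal"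
    using assms unfolding generic_eq_def by (intro aut_ideal.add) simp_all
  then show ?thesis using False by (simp add: generic_eq_def algebra_simps)
qed (use assms in \<open>simp add: generic_eq_def\<close>)

lemma generic_eq_minus:
  assumes "generic_eq a b" "generic_eq c d"
  shows "generic_eq (a - c) (b - d)"
proof (cases "1 \<in> generic_ideal")
  case False
  then have "(a - b) - (c - d) \<in> generic_ideal"
    using assms unfolding generic_eq_def by (intro aut_ideal_diff[of "a - b" _ _ "c - d"]) simp_all
  then show ?thesis using False by (simp add: generic_eq_def algebra_simps)
qed (use assms in \<open>simp add: generic_eq_def\<close>)

instantiation quantum_alg :: real_algebra_1
begin

lift_definition zero_quantum_alg :: quantum_alg is 0 .
lift_definition one_quantum_alg :: quantum_alg is 1 .
lift_definition plus_quantum_alg :: "quantum_alg \<Rightarrow> quantum_alg \<Rightarrow> quantum_alg" is "(+)" by (rule generic_eq_plus)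
lift_definition minus_quantum_alg :: "quantum_alg \<Rightarrow> quantum_alg \<Rightarrow> quantum_alg" is "(-)" by (rule generic_eq_minus)
lift_definition times_quantum_alg :: "quantum_alg \<Rightarrow> quantum_alg \<Rightarrow> quantum_alg" is "(*)" by (rule generic_eq_times)
lift_definition uminus_quantum_alg :: "quantum_alg \<Rightarrow> quantum_alg" is uminus
proof -
  fix a b assume "generic_eq a b"
  from generic_eq_minus[OF generic_eq_refl[of 0] this] show "generic_eq (- a) (- b)" by simp
qed
lift_definition scaleR_quantum_alg :: "real \<Rightarrow> quantum_alg \<Rightarrow> quantum_alg" is "\<lambda>r a. scal (complex_of_real r) * a"
  by (rule generic_eq_times[OF generic_eq_refl])

instance
proof
  have r: "generic_eq a a" for a by (simp add: generic_eq_def aut_ideal.zero)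
  have s: "a = b \<Longrightarrow> generic_eq a b" for a b using r by simp
  fix a b c :: quantum_alg and r t :: real
  show "a + b + c = a + (b + c)" by transfer (rule s, simp add: algebra_simps)
  show "a + b = b + a" by transfer (rule s, simp add: algebra_simps)
  show "0 + a = a" by transfer (rule s, simp)
  show "- a + a = 0" by transfer (rule s, simp)
  show "a - b = a + - b" by transfer (rule s, simp)
  show "a * b * c = a * (b * c)" by transfer (rule s, simp add: mult.assoc)
  show "1 * a = a" "a * 1 = a" by (transfer, rule s, simp)+
  show "(a + b) * c = a * c + b * c" "a * (b + c) = a * b + a * c" by (transfer, rule s, simp add: algebra_simps)+
  show "(0::quantum_alg) \<noteq> 1"
  proof (transfer, rule notI)
    assume "generic_eq 0 1"
    then have "1 \<notin> generic_ideal" "- 1 \<in> generic_ideal"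
      by (simp_all add: generic_eq_def split: if_splits)
    then show False using aut_ideal_uminus[of "- 1"] by simp
  qed
  show "r *\<^sub>R (a + b) = r *\<^sub>R a + r *\<^sub>R b" by transfer (rule s, simp add: algebra_simps)
  show "(r + t) *\<^sub>R a = r *\<^sub>R a + t *\<^sub>R a"
    by transfer (rule s, simp add: scal_def single_add algebra_simps)
  show "r *\<^sub>R t *\<^sub>R a = (r * t) *\<^sub>R a"
    by transfer (rule s, simp add: scal_def mult.assoc[symmetric] mult_single)
  show "1 *\<^sub>R a = a" by transfer (rule s, simp add: scal_def)
  show "r *\<^sub>R a * b = r *\<^sub>R (a * b)" by transfer (rule s, simp add: mult.assoc)
  show "a * r *\<^sub>R b = r *\<^sub>R (a * b)"
    by transfer (rule s, simp add: scal_commute mult.assoc)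
qed

end
lemma abs_quantum_alg_hom:
  "abs_quantum_alg (a + b) = abs_quantum_alg a + abs_quantum_alg b"
  "abs_quantum_alg (a - b) = abs_quantum_alg a - abs_quantum_alg b"
  "abs_quantum_alg (a * b) = abs_quantum_alg a * abs_quantum_alg b"
  "abs_quantum_alg 0 = 0" "abs_quantum_alg 1 = 1"
  by (simp_all add: plus_quantum_alg.abs_eq minus_quantum_alg.abs_eq times_quantum_alg.abs_eq
      zero_quantum_alg.abs_eq one_quantum_alg.abs_eq)

lemma abs_quantum_alg_sum: "abs_quantum_alg (sum f A) = (\<Sum>x\<in>A. abs_quantum_alg (f x))"
  by (induction A rule: infinite_finite_induct) (simp_all add: abs_quantum_alg_hom)

lemma abs_quantum_alg_relator:
  assumes "1 \<notin> generic_ideal" "a - b \<in> aut_relators (fst generic_graph) (snd generic_graph)"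
  shows "abs_quantum_alg a = abs_quantum_alg b"
  using assms aut_ideal.relator by (simp add: quantum_alg.abs_eq_iff generic_eq_def)

definition quantum_u :: "nat \<Rightarrow> nat \<Rightarrow> quantum_alg" where
  "quantum_u i j = abs_quantum_alg (u i j)"

lemma quantum_u_magic_unitary:
  assumes ideal: "1 \<notin> generic_ideal"
  shows "magic_unitary {..<fst generic_graph} (snd generic_graph) quantum_u"
proof
  define N E where "N = fst generic_graph" and "E = snd generic_graph"
  note relator = abs_quantum_alg_relator[OF ideal, folded N_def E_def]
  fix i j k l
  assume i: "i \<in> {..<N}" and j: "j \<in> {..<N}"
  show "quantum_u i j * quantum_u i j = quantum_u i j"
    unfolding quantum_u_def abs_quantum_alg_hom[symmetric]
    by (rule relator) (rule aut_relators.idempotent)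
  show "quantum_u i j * quantum_u i k = 0" if "j \<noteq> k" for k
    unfolding quantum_u_def abs_quantum_alg_hom[symmetric]
    by (rule relator) (use aut_relators.row_orthogonal[OF that] in simp)
  show "quantum_u i j * quantum_u k j = 0" if "i \<noteq> k" for k
    unfolding quantum_u_def abs_quantum_alg_hom[symmetric]
    by (rule relator) (use aut_relators.column_orthogonal[OF that] in simp)
  show "(\<Sum>j<N. quantum_u i j) = 1"
    unfolding quantum_u_def abs_quantum_alg_hom[symmetric] abs_quantum_alg_sum[symmetric]
    by (rule relator) (use aut_relators.row_sum i in simp)
  show "(\<Sum>i<N. quantum_u i j) = 1"
    unfolding quantum_u_def abs_quantum_alg_hom[symmetric] abs_quantum_alg_sum[symmetric]
    by (rule relator) (use aut_relators.column_sum j in simp)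
  have adj: "abs_quantum_alg (scal (adj_mat E i j)) = of_bool (E i j) *\<^sub>R 1" for i j
    by (simp add: adj_mat_def scal_def abs_quantum_alg_hom)
  have "abs_quantum_alg (\<Sum>k<N. scal (adj_mat E i k) * u k j) = abs_quantum_alg (\<Sum>k<N. u i k * scal (adj_mat E k j))"
    by (rule relator) (use aut_relators.commutes_adj_mat i j in simp)
  then show "(\<Sum>k<N. of_bool (E i k) *\<^sub>R quantum_u k j) = (\<Sum>k<N. of_bool (E k j) *\<^sub>R quantum_u i k)"
    by (simp add: abs_quantum_alg_sum abs_quantum_alg_hom adj quantum_u_def)
qed simp

section \<open>From commuting entries to the flip in the space of invariant tensors\<close>

lemma sum_lookup_flip_tensor:
  fixes F :: "nat list \<Rightarrow> free_alg"
  shows "(\<Sum>ys\<in>indices N 4. scal (Poly_Mapping.lookup (flip_tensor N) ys) * F ys) = (\<Sum>a<N. \<Sum>b<N. F [a, b, a, b])"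
proof -
  have fin: "finite (indices N 4)"
    using finite_lists_length_eq[of "{..<N}" 4] by (simp add: indices_def conj_commute)
  have "(\<Sum>ys\<in>indices N 4. scal (Poly_Mapping.lookup (flip_tensor N) ys) * F ys)
      = (\<Sum>ys\<in>indices N 4. \<Sum>a<N. \<Sum>b<N. if ys = [a, b, a, b] then F [a, b, a, b] else 0)"
  proof (intro sum.cong refl)
    fix ys
    have "scal (Poly_Mapping.lookup (flip_tensor N) ys) = (\<Sum>a<N. \<Sum>b<N. if ys = [a, b, a, b] then 1 else 0)"
    proof -
      have "scal (\<Sum>a\<in>A. f a) = (\<Sum>a\<in>A. scal (f a))" for f :: "nat \<Rightarrow> complex" and A
        by (induction A rule: infinite_finite_induct) (simp_all add: scal_def single_add)
      then show ?thesis
        by (simp add: flip_tensor_def delta_def lookup_sum lookup_single when_def eq_commute[of ys])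
           (simp add: scal_def if_distrib cong: if_cong)
    qed
    then show "scal (Poly_Mapping.lookup (flip_tensor N) ys) * F ys = (\<Sum>a<N. \<Sum>b<N. if ys = [a, b, a, b] then F [a, b, a, b] else 0)"
      by (simp add: sum_distrib_right if_distrib[of "\<lambda>r. r * _"] cong: if_cong)
  qed
  also have "\<dots> = (\<Sum>a<N. \<Sum>b<N. \<Sum>ys\<in>indices N 4. if ys = [a, b, a, b] then F [a, b, a, b] else 0)"
    by (subst sum.swap, rule sum.cong[OF refl], rule sum.swap)
  also have "\<dots> = (\<Sum>a<N. \<Sum>b<N. F [a, b, a, b])"
    using fin by (intro sum.cong refl) (simp add: indices_def)
  finally show ?thesis .
qed

lemma flip_tensor_in_P_plusI:
  assumes "\<And>x y z w. x < N \<Longrightarrow> y < N \<Longrightarrow> z < N \<Longrightarrow> w < N \<Longrightarrow>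
     aut_eq N E (\<Sum>a<N. \<Sum>b<N. u x a * (u y b * (u z a * u w b))) (scal (of_bool (x = z \<and> y = w)))"
  shows "flip_tensor N \<in> P_plus N E 4"
proof -
  have "Poly_Mapping.lookup (flip_tensor N) ys = 0" if "ys \<notin> indices N 4" for ys
    unfolding flip_tensor_def delta_def lookup_sum lookup_single
    using that by (intro sum.neutral ballI) (auto simp: indices_def when_def)
  then have tp: "flip_tensor N \<in> tensor_power N 4"
    by (auto simp: tensor_power_def in_keys_iff)
  have val: "Poly_Mapping.lookup (flip_tensor N) [x, y, z, w] = of_bool (x = z \<and> y = w)" if "x < N" "y < N" for x y z w
  proof -
    have "Poly_Mapping.lookup (flip_tensor N) [x, y, z, w] = (\<Sum>a<N. \<Sum>b<N. if b = y then (if a = x then of_bool (x = z \<and> y = w) else 0) else 0)"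
      unfolding flip_tensor_def delta_def lookup_sum lookup_single when_def
      by (intro sum.cong refl) auto
    then show ?thesis using that by simp
  qed
  have four: "\<exists>x<N. \<exists>y<N. \<exists>z<N. \<exists>w<N. xs = [x, y, z, w]" if "xs \<in> indices N 4" for xs
    using that by (auto simp: indices_def numeral_eq_Suc length_Suc_conv)
  have aut: "aut_eq N E (\<Sum>a<N. \<Sum>b<N. prod_list (map2 u xs [a, b, a, b])) (scal (Poly_Mapping.lookup (flip_tensor N) xs))"
    if xs: "xs \<in> indices N 4" for xs
  proof -
    obtain x y z w where "x < N" "y < N" "z < N" "w < N" "xs = [x, y, z, w]"
      using four[OF xs] by blast
    then show ?thesis
      using assms[of x y z w] by (simp add: val)
  qed
  show ?thesis
    unfolding P_plus_def mem_Collect_eq sum_lookup_flip_tensor by (intro conjI tp ballI aut)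
qed

text \<open>If 1 lies in the ideal, any two elements are identified and the claim is trivial.
  Otherwise \<open>generic_eq\<close> is congruence modulo the ideal, so equations in the quotient
  type are the required ones.\<close>

lemma flip_tensor_of_commute:
  assumes "\<And>x y a b. 1 \<notin> generic_ideal \<Longrightarrow> x < fst generic_graph \<Longrightarrow> y < fst generic_graph \<Longrightarrow> a < fst generic_graph \<Longrightarrow>
    b < fst generic_graph \<Longrightarrow> quantum_u x a * quantum_u y b = quantum_u y b * quantum_u x a"
  shows "flip_tensor (fst generic_graph) \<in> P_plus (fst generic_graph) (snd generic_graph) 4"
proof (cases "1 \<in> generic_ideal")
  case True
  have "a \<in> generic_ideal" for a
    using aut_ideal.mult_left[OF True, of a] by simp
  then show ?thesis
    by (intro flip_tensor_in_P_plusI) (simp add: aut_eq_def)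
next
  case False
  interpret magic_unitary "{..<fst generic_graph}" "snd generic_graph" quantum_u
    by (rule quantum_u_magic_unitary[OF False])
  show ?thesis
  proof (rule flip_tensor_in_P_plusI)
    fix x y z w
    assume "x < fst generic_graph" "y < fst generic_graph" "z < fst generic_graph" "w < fst generic_graph"
    then have "(\<Sum>a<fst generic_graph. \<Sum>b<fst generic_graph. quantum_u x a * (quantum_u y b * (quantum_u z a * quantum_u w b)))
        = of_bool (x = z \<and> y = w)"
      using assms[OF False] by (intro commuting_flip) auto
    then have "abs_quantum_alg (\<Sum>a<fst generic_graph. \<Sum>b<fst generic_graph. u x a * (u y b * (u z a * u w b)))
        = of_bool (x = z \<and> y = w)"
      by (simp only: abs_quantum_alg_sum abs_quantum_alg_hom quantum_u_def)
    also have "\<dots> = abs_quantum_alg (scal (of_bool (x = z \<and> y = w)))"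
      by (simp add: scal_def abs_quantum_alg_hom)
    finally have "abs_quantum_alg (\<Sum>a<fst generic_graph. \<Sum>b<fst generic_graph. u x a * (u y b * (u z a * u w b)))
        = abs_quantum_alg (scal (of_bool (x = z \<and> y = w)))" .
    then show "aut_eq (fst generic_graph) (snd generic_graph)
        (\<Sum>a<fst generic_graph. \<Sum>b<fst generic_graph. u x a * (u y b * (u z a * u w b))) (scal (of_bool (x = z \<and> y = w)))"
      using False by (simp add: aut_eq_def quantum_alg.abs_eq_iff generic_eq_def)
  qed
qed

lemma (in magic_unitary) reindex:
  assumes g: "bij_betw g W V" and F: "\<And>p q. p \<in> W \<Longrightarrow> q \<in> W \<Longrightarrow> F p q \<longleftrightarrow> E (g p) (g q)"
  shows "magic_unitary W F (\<lambda>p q. U (g p) (g q))"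
proof
  have gV: "g p \<in> V" if "p \<in> W" for p using g that by (rule bij_betwE[rule_format])
  have ne: "g p \<noteq> g q" if "p \<in> W" "q \<in> W" "p \<noteq> q" for p q
    using bij_betw_imp_inj_on[OF g] that by (auto dest: inj_onD)
  show "finite W" using bij_betw_finite[OF g] finite_V by simp
  fix p q r assume p: "p \<in> W" and q: "q \<in> W"
  show "U (g p) (g q) * U (g p) (g q) = U (g p) (g q)" using p q by (intro idem gV)
  show "U (g p) (g q) * U (g p) (g r) = 0" if "r \<in> W" "q \<noteq> r" using p q that by (intro row_orth gV ne)
  show "U (g p) (g q) * U (g r) (g q) = 0" if "r \<in> W" "p \<noteq> r" using p q that by (intro col_orth gV ne)
  show "(\<Sum>q\<in>W. U (g p) (g q)) = 1" "(\<Sum>p\<in>W. U (g p) (g q)) = 1"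
    using row_sum[OF gV[OF p]] col_sum[OF gV[OF q]]
      sum.reindex_bij_betw[OF g, of "\<lambda>a. U (g p) a"] sum.reindex_bij_betw[OF g, of "\<lambda>x. U x (g q)"] by simp_all
  show "(\<Sum>k\<in>W. of_bool (F p k) *\<^sub>R U (g k) (g q)) = (\<Sum>k\<in>W. of_bool (F k q) *\<^sub>R U (g p) (g k))"
    using commutes_adj[OF gV[OF p] gV[OF q]] F p q
      sum.reindex_bij_betw[OF g, of "\<lambda>k. of_bool (E (g p) k) *\<^sub>R U k (g q)"]
      sum.reindex_bij_betw[OF g, of "\<lambda>k. of_bool (E k (g q)) *\<^sub>R U (g p) k"] by simp
qed

lemma quantum_u_commute:
  assumes ideal: "1 \<notin> generic_ideal" and hyp: "hypothesis generic_graph"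
    and x: "x < fst generic_graph" "y < fst generic_graph" "a < fst generic_graph" "b < fst generic_graph"
  shows "quantum_u x a * quantum_u y b = quantum_u y b * quantum_u x a"
proof -
  define N E where "N = fst generic_graph" and "E = snd generic_graph"
  interpret magic_unitary "{..<N}" E quantum_u
    unfolding N_def E_def by (rule quantum_u_magic_unitary[OF ideal])
  have x: "x \<in> {..<N}" "y \<in> {..<N}" "a \<in> {..<N}" "b \<in> {..<N}" using x by (simp_all add: N_def)
  from hyp consider "is_McLaughlin_graph {..<N} E" | "is_O_minus_6_3_graph {..<N} E"
    unfolding hypothesis_def N_def E_def by blast
  then show ?thesis
  proof cases
    case 1
    then show ?thesis using McLaughlin_commute x unfolding is_McLaughlin_graph_def by blast
  next
    case 2
    then obtain f where f: "bij_betw f {..<N} verts"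
      and E: "\<And>x y. x \<in> {..<N} \<Longrightarrow> y \<in> {..<N} \<Longrightarrow> E x y \<longleftrightarrow> adj (f x) (f y)"
      unfolding is_O_minus_6_3_graph_def graph_isomorphic_def by blast
    define g where "g = inv_into {..<N} f"
    have g: "bij_betw g verts {..<N}" unfolding g_def by (rule bij_betw_inv_into[OF f])
    have gf: "g (f x) = x" if "x \<in> {..<N}" for x unfolding g_def by (rule bij_betw_inv_into_left[OF f that])
    have fg: "f (g p) = p" if "p \<in> verts" for p unfolding g_def by (rule bij_betw_inv_into_right[OF f that])
    have "magic_unitary verts adj (\<lambda>p q. quantum_u (g p) (g q))"
    proof (rule reindex[OF g])
      fix p q assume "p \<in> verts" "q \<in> verts"
      then show "adj p q \<longleftrightarrow> E (g p) (g q)"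
        using E[of "g p" "g q"] fg bij_betwE[OF g] by simp
    qed
    then interpret O: generalized_quadrangle_unitary "\<lambda>p q. quantum_u (g p) (g q)"
      by (simp add: generalized_quadrangle_unitary_def)
    show ?thesis
      using O.all_commute[of "f x" "f y" "f a" "f b"] x gf bij_betwE[OF f] by simp
  qed
qed

theorem theorem5p6:
  fixes N :: nat and E :: "nat \<Rightarrow> nat \<Rightarrow> bool"
  assumes "is_McLaughlin_graph {..<N} E \<or> is_O_minus_6_3_graph {..<N} E"
  shows "flip_tensor N \<in> P_plus N E 4"
proof (rule ccontr)
  assume "flip_tensor N \<notin> P_plus N E 4"
  then have "hypothesis (N, E) \<and> flip_tensor (fst (N, E)) \<notin> P_plus (fst (N, E)) (snd (N, E)) 4"
    using assms by (simp add: hypothesis_def)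
  then have "hypothesis generic_graph \<and> flip_tensor (fst generic_graph) \<notin> P_plus (fst generic_graph) (snd generic_graph) 4"
    unfolding generic_graph_def by (rule someI)
  then show False
    using flip_tensor_of_commute quantum_u_commute by blast
qed

end
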